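(* There exists a numerical constant $c>0$ such that the following holds. Let $n \geq 2$, $0 < \varepsilon < \frac{1}{2}$, and let $K \subset \mathbb{R}^n$ be a convex body. Then there exist at most $c\, n \log \frac{1}{\varepsilon}$ Minkowski symmetrizations which, when applied successively to $K$, transform $K$ into a body $\tilde{K}$ that satisfies $$ (1 - \varepsilon) M^*(K) D \subset \tilde{K} \subset (1 + \varepsilon) M^*(K) D . $$
   Context: $D$ is the standard Euclidean unit ball in $\mathbb{R}^n$ (centered at the origin), $S^{n-1}$ is the unit sphere, and $\log$ is the natural logarithm. For a unit vector $u \in S^{n-1}$ let $\pi_u(x) = x - 2\langle x,u\rangle u$ be the reflection with respect to the hyperplane through the origin orthogonal to $u$. The Minkowski symmetrization of a convex body $K$ with respect to $u$ is $\tau_u(K) = \frac{K + \pi_u(K)}{2}$, where $A+B=\{a+b : a\in A, b\in B\}$ is the Minkowski sum. The supporting functional of $K$ is $h_K(u) = \sup_{x\in K}\langle x,u\rangle$, and $M^*(K) = \int_{S^{n-1}} h_K(u)\, d\sigma(u)$, where $\sigma$ is the rotation invariant probability measure on $S^{n-1}$. A numerical constant is one independent of $n$, $\varepsilon$ and $K$. *)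

theory Defs
  imports "HOL-Probability.Probability"
begin

text \<open>
  The constant of the theorem must not depend on the dimension, so the dimension is a natural
  number and not a type. The space \<open>R^n\<close> is the library's \<^const>\<open>Euclidean_space\<close>, whose points are
  the functions \<open>nat \<Rightarrow> real\<close> that vanish at all indices \<open>i \<ge> n\<close>.
\<close>

abbreviation Rn :: "nat \<Rightarrow> (nat \<Rightarrow> real) set" where
  "Rn n \<equiv> topspace (Euclidean_space n)"

definition dot :: "nat \<Rightarrow> (nat \<Rightarrow> real) \<Rightarrow> (nat \<Rightarrow> real) \<Rightarrow> real" where
  "dot n x y = (\<Sum>i<n. x i * y i)"

definition enorm :: "nat \<Rightarrow> (nat \<Rightarrow> real) \<Rightarrow> real" where
  "enorm n x = sqrt (dot n x x)"

definition unit_ball :: "nat \<Rightarrow> (nat \<Rightarrow> real) set" where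
  "unit_ball n = {x \<in> Rn n. enorm n x \<le> 1}"

definition unit_sphere :: "nat \<Rightarrow> (nat \<Rightarrow> real) set" where
  "unit_sphere n = {x \<in> Rn n. enorm n x = 1}"

definition dilate :: "real \<Rightarrow> (nat \<Rightarrow> real) set \<Rightarrow> (nat \<Rightarrow> real) set" where
  "dilate t A = (\<lambda>x i. t * x i) ` A"

definition minkowski_sum ::
    "(nat \<Rightarrow> real) set \<Rightarrow> (nat \<Rightarrow> real) set \<Rightarrow> (nat \<Rightarrow> real) set" where
  "minkowski_sum A B = {(\<lambda>i. a i + b i) | a b. a \<in> A \<and> b \<in> B}"

text \<open>The type \<open>nat \<Rightarrow> real\<close> is not an instance of \<^class>\<open>real_vector\<close>, so convexity is spelled out
  pointwise.\<close>

definition convex_in_Rn :: "(nat \<Rightarrow> real) set \<Rightarrow> bool" where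
  "convex_in_Rn K \<longleftrightarrow>
     (\<forall>x\<in>K. \<forall>y\<in>K. \<forall>s\<ge>0. \<forall>t\<ge>0. s + t = 1 \<longrightarrow> (\<lambda>i. s * x i + t * y i) \<in> K)"

definition convex_body :: "nat \<Rightarrow> (nat \<Rightarrow> real) set \<Rightarrow> bool" where
  "convex_body n K \<longleftrightarrow>
     compactin (Euclidean_space n) K \<and> convex_in_Rn K \<and> Euclidean_space n interior_of K \<noteq> {}"

definition reflection :: "nat \<Rightarrow> (nat \<Rightarrow> real) \<Rightarrow> (nat \<Rightarrow> real) \<Rightarrow> (nat \<Rightarrow> real)" where
  "reflection n u x = (\<lambda>i. x i - 2 * dot n x u * u i)"

definition minkowski_symmetrization ::
    "nat \<Rightarrow> (nat \<Rightarrow> real) \<Rightarrow> (nat \<Rightarrow> real) set \<Rightarrow> (nat \<Rightarrow> real) set" where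
  "minkowski_symmetrization n u K = dilate (1/2) (minkowski_sum K (reflection n u ` K))"

definition support_fun :: "nat \<Rightarrow> (nat \<Rightarrow> real) set \<Rightarrow> (nat \<Rightarrow> real) \<Rightarrow> real" where
  "support_fun n K u = (SUP x\<in>K. dot n x u)"

text \<open>A map of \<open>R^n\<close> into itself that preserves the scalar product is automatically linear and
  bijective, so these are exactly the elements of \<open>O(n)\<close>.\<close>

definition orthogonal_map :: "nat \<Rightarrow> ((nat \<Rightarrow> real) \<Rightarrow> (nat \<Rightarrow> real)) \<Rightarrow> bool" where
  "orthogonal_map n T \<longleftrightarrow>
     T \<in> Rn n \<rightarrow> Rn n \<and> (\<forall>x\<in>Rn n. \<forall>y\<in>Rn n. dot n (T x) (T y) = dot n x y)"

text \<open>The Borel probability measures on the sphere that are invariant under \<open>O(n)\<close>; for \<open>n \<ge> 1\<close>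
  there is exactly one. The topology on \<open>nat \<Rightarrow> real\<close> is the product topology, which induces the
  Euclidean one on the sphere.\<close>

definition rotation_invariant_prob :: "nat \<Rightarrow> (nat \<Rightarrow> real) measure \<Rightarrow> bool" where
  "rotation_invariant_prob n \<sigma> \<longleftrightarrow>
     prob_space \<sigma> \<and> sets \<sigma> = sets (restrict_space borel (unit_sphere n)) \<and>
     (\<forall>T. orthogonal_map n T \<longrightarrow> distr \<sigma> \<sigma> T = \<sigma>)"

definition Mstar :: "nat \<Rightarrow> (nat \<Rightarrow> real) measure \<Rightarrow> (nat \<Rightarrow> real) set \<Rightarrow> real" where
  "Mstar n \<sigma> K = (\<integral>u. support_fun n K u \<partial>\<sigma>)"

end

theory Submission
imports Defs "HOL-Computational_Algebra.Polynomial"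
begin

text \<open>
  In terms of support functions, a Minkowski symmetrization replaces \<open>h\<close> by the mean of \<open>h\<close> and its
  reflection. The mean of \<open>h\<close> over the sphere is preserved, and the task is to make \<open>h\<close> uniformly close
  to this mean. The symmetrizations are performed in batches of \<open>n\<close>, along the vectors of an orthonormal
  frame; the reflections of a frame commute, and a batch averages \<open>h\<close> over all \<open>2^n\<close> sign changes with
  respect to the frame (\<open>energy_batch\<close>). About \<open>ln (1 / \<epsilon>)\<close> batches suffice.

  The size of the degree \<open>k\<close> part of a function \<open>f\<close> on the sphere is measured by its energy, the double
  integral of \<open>p <x, y> * f x * f y\<close>, where \<open>p = orth k\<close> is the monic polynomial of degree \<open>k\<close> orthogonal
  with respect to the law of a coordinate (a multiple of a Gegenbauer polynomial). For a uniformly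
  distributed random frame, the expected energy after a batch is exactly \<open>contraction k\<close> times the
  energy before it: averaging over the frame commutes with all zonal operators, whose common
  eigenfunctions are the \<open>orth k\<close> (\<open>avg_orth\<close>). Hence there are always frames that do at least as well as
  the average, and \<open>m\<close> batches multiply the energies by \<open>contraction k ^ m\<close> in a weighted sum over \<open>k\<close>
  (\<open>exists_good_frames\<close>).

  The contraction factors vanish in odd degrees. In even degrees they are bounded, by convexity, by
  the mean over all signs and all \<open>x\<close> of the \<open>k\<close>-th power of the form with diagonal entries \<open>1\<close> and \<open>- 1\<close>
  (\<open>contraction_even\<close>). Integration by parts on the sphere yields a recursion for these means
  (\<open>sgn_moment_Suc\<close>), from which they are at most \<open>3 / n\<close>, and at most \<open>(9 / 10) ^ j\<close> in degree \<open>2 * j\<close> as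
  long as \<open>j\<close> is at most \<open>n / 4\<close>. In higher degrees they stay below the last of these bounds, which is
  exponentially small in \<open>n\<close>.

  To pass from energies to uniform bounds, \<open>h\<close> is smoothed with the kernel \<open><x, y>^(2 * d)\<close> where \<open>d\<close> is of
  order \<open>n / \<epsilon>\<^sup>2\<close>. This changes an even Lipschitz function by a multiple of \<open>\<epsilon>\<close> only (\<open>smooth_approx\<close>), and
  the smoothed function is controlled by the energies of degree at most \<open>2 * d\<close>, with weights
  (\<open>exists_frames_smooth_small\<close>). For low degrees two batches compensate for the weight up to a factor
  exponential in \<open>k\<close>, which a bounded number of further batches beats; for high degrees the weight is at
  most exponential in \<open>n * ln (1 / \<epsilon>)\<close>, and \<open>m\<close> proportional to \<open>ln (1 / \<epsilon>)\<close> is enough because every batch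
  contracts exponentially in \<open>n\<close> (\<open>weight_contraction_le\<close>).

  A first batch along the coordinate axes makes \<open>h\<close> even. Then the largest norm of a point of the body
  is at most \<open>n\<close> times the mean of \<open>h\<close> (\<open>radius_le_mean_width\<close>), so that the estimate is relative to this
  mean, and a body with nearly constant support function is close to a ball (\<open>near_ball_of_smooth\<close>).
\<close>

section \<open>Vectors and reflections\<close>

definition lincomb :: "real \<Rightarrow> (nat \<Rightarrow> real) \<Rightarrow> real \<Rightarrow> (nat \<Rightarrow> real) \<Rightarrow> nat \<Rightarrow> real" where
  "lincomb a x c y = (\<lambda>i. a * x i + c * y i)"

definition unit_vec :: "nat \<Rightarrow> nat \<Rightarrow> real" where
  "unit_vec i = (\<lambda>j. if j = i then 1 else 0)"

lemma Rn_iff: "x \<in> Rn n \<longleftrightarrow> (\<forall>i\<ge>n. x i = 0)"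
  by (simp add: topspace_Euclidean_space)

lemma dot_commute: "dot n x y = dot n y x"
  by (simp add: dot_def mult.commute)

lemma dot_lincomb_left: "dot n (lincomb a x c y) z = a * dot n x z + c * dot n y z"
  by (simp add: dot_def lincomb_def algebra_simps sum.distrib sum_distrib_left)

lemma dot_lincomb_right: "dot n z (lincomb a x c y) = a * dot n z x + c * dot n z y"
  by (simp add: dot_commute[of n z] dot_lincomb_left)

lemma dot_minus_left: "dot n (\<lambda>i. x i - y i) z = dot n x z - dot n y z"
  and dot_minus_right: "dot n z (\<lambda>i. x i - y i) = dot n z x - dot n z y"
  by (simp_all add: dot_def algebra_simps sum_subtractf)

lemma dot_add_left: "dot n (\<lambda>i. x i + y i) z = dot n x z + dot n y z"
  and dot_add_right: "dot n z (\<lambda>i. x i + y i) = dot n z x + dot n z y"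
  by (simp_all add: dot_def algebra_simps sum.distrib)

lemma dot_scale_left: "dot n (\<lambda>i. a * x i) z = a * dot n x z"
  and dot_scale_right: "dot n z (\<lambda>i. a * x i) = a * dot n z x"
  by (simp_all add: dot_def algebra_simps sum_distrib_left)

lemma dot_uminus_left: "dot n (\<lambda>i. - x i) z = - dot n x z"
  and dot_uminus_right: "dot n z (\<lambda>i. - x i) = - dot n z x"
  by (simp_all add: dot_def sum_negf)

lemma dot_sum_right: "dot n z (\<lambda>i. \<Sum>j\<in>J. a j * v j i) = (\<Sum>j\<in>J. a j * dot n z (v j))"
  by (simp add: dot_def sum_distrib_left, subst sum.swap, simp add: mult_ac)

lemma dot_unit_vec: "i < n \<Longrightarrow> dot n x (unit_vec i) = x i"
  by (simp add: dot_def unit_vec_def if_distrib[of "\<lambda>c. _ * c"] cong: if_cong)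

lemma dot_unit_vec_left: "i < n \<Longrightarrow> dot n (unit_vec i) x = x i"
  by (simp add: dot_commute[of n "unit_vec i"] dot_unit_vec)

lemma unit_vec_Rn: "i < n \<Longrightarrow> unit_vec i \<in> Rn n"
  by (simp add: Rn_iff unit_vec_def)

lemma dot_self_nonneg: "0 \<le> dot n x x"
  by (simp add: dot_def sum_nonneg)

lemma enorm_nonneg: "0 \<le> enorm n x"
  by (simp add: enorm_def dot_self_nonneg)

lemma enorm_sq: "(enorm n x)\<^sup>2 = dot n x x"
  by (simp add: enorm_def dot_self_nonneg)

lemma dot_self_0: "dot n x x = 0 \<longleftrightarrow> (\<forall>i<n. x i = 0)"
  by (auto simp: dot_def sum_nonneg_eq_0_iff)

lemma Rn_eqI: "x \<in> Rn n \<Longrightarrow> y \<in> Rn n \<Longrightarrow> (\<And>i. i < n \<Longrightarrow> x i = y i) \<Longrightarrow> x = y"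
  by (auto simp: Rn_iff fun_eq_iff) (metis not_le_imp_less)

lemma dot_Cauchy_Schwarz: "\<bar>dot n x y\<bar> \<le> enorm n x * enorm n y"
proof -
  have "(dot n x y)\<^sup>2 \<le> dot n x x * dot n y y"
    using Cauchy_Schwarz_ineq_sum[of x y "{..<n}"] by (simp add: dot_def power2_eq_square)
  then have "sqrt ((dot n x y)\<^sup>2) \<le> sqrt (dot n x x * dot n y y)" by (rule real_sqrt_le_mono)
  then show ?thesis by (simp add: enorm_def real_sqrt_mult)
qed

lemma sphere_iff: "x \<in> unit_sphere n \<longleftrightarrow> x \<in> Rn n \<and> dot n x x = 1"
  by (simp add: unit_sphere_def enorm_def)

lemma unit_vec_sphere: "i < n \<Longrightarrow> unit_vec i \<in> unit_sphere n"
  by (simp add: sphere_iff unit_vec_Rn dot_unit_vec) (simp add: unit_vec_def)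

lemma sphere_dot_le: "x \<in> unit_sphere n \<Longrightarrow> y \<in> unit_sphere n \<Longrightarrow> \<bar>dot n x y\<bar> \<le> 1"
  using dot_Cauchy_Schwarz[of n x y] by (simp add: unit_sphere_def)

lemma sphere_coord_le: assumes "x \<in> unit_sphere n" shows "\<bar>x i\<bar> \<le> 1"
proof (cases "i < n")
  case True
  then show ?thesis using sphere_dot_le[OF assms unit_vec_sphere[OF True]] by (simp add: dot_unit_vec)
next
  case False then show ?thesis using assms by (simp add: sphere_iff Rn_iff)
qed

lemma lincomb_Rn: "x \<in> Rn n \<Longrightarrow> y \<in> Rn n \<Longrightarrow> lincomb a x c y \<in> Rn n"
  by (simp add: Rn_iff lincomb_def)

lemma reflection_lincomb: "reflection n u x = lincomb 1 x (- 2 * dot n x u) u"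
  by (simp add: reflection_def lincomb_def)

lemma dot_reflection_left: "dot n (reflection n u x) y = dot n x y - 2 * dot n x u * dot n u y"
  by (simp add: reflection_lincomb dot_lincomb_left)

lemma dot_reflection_right: "dot n y (reflection n u x) = dot n y x - 2 * dot n x u * dot n y u"
  by (simp add: reflection_lincomb dot_lincomb_right)

lemma dot_reflection_swap: "dot n (reflection n u x) y = dot n x (reflection n u y)"
  by (simp add: dot_reflection_left dot_reflection_right dot_commute)

lemma dot_reflection_reflection:
  "u \<in> unit_sphere n \<Longrightarrow> dot n (reflection n u x) (reflection n u y) = dot n x y"
  by (simp add: dot_reflection_left dot_reflection_right sphere_iff algebra_simps dot_commute)

lemma reflection_Rn: "u \<in> unit_sphere n \<Longrightarrow> x \<in> Rn n \<Longrightarrow> reflection n u x \<in> Rn n"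
  by (simp add: reflection_lincomb lincomb_Rn sphere_iff)

lemma reflection_sphere: "u \<in> unit_sphere n \<Longrightarrow> x \<in> unit_sphere n \<Longrightarrow> reflection n u x \<in> unit_sphere n"
  by (simp add: sphere_iff[of "reflection n u x"] dot_reflection_reflection reflection_Rn)
     (simp add: sphere_iff reflection_Rn)

lemma reflection_involution: "u \<in> unit_sphere n \<Longrightarrow> reflection n u (reflection n u x) = x"
  by (simp add: reflection_def[of n u "reflection n u x"] dot_reflection_left sphere_iff)
     (simp add: reflection_def)

lemma reflection_orthogonal_map: "u \<in> unit_sphere n \<Longrightarrow> orthogonal_map n (reflection n u)"
  by (simp add: orthogonal_map_def reflection_Rn dot_reflection_reflection)

lemma orthogonal_map_sphere: "orthogonal_map n T \<Longrightarrow> x \<in> unit_sphere n \<Longrightarrow> T x \<in> unit_sphere n"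
  by (auto simp: orthogonal_map_def sphere_iff)

text \<open>The mirror is the hyperplane halfway between the two points.\<close>
lemma reflection_exchange:
  assumes "x \<in> unit_sphere n" "y \<in> unit_sphere n" "x \<noteq> y"
  shows "\<exists>u\<in>unit_sphere n. reflection n u x = y \<and>
    (\<forall>z. dot n z x = dot n z y \<longrightarrow> reflection n u z = z)"
proof -
  define d where "d = (\<lambda>i. x i - y i)"
  define r where "r = dot n d d"
  have dR: "d \<in> Rn n" using assms by (simp add: d_def sphere_iff Rn_iff)
  have r_eq: "r = 2 - 2 * dot n x y"
    using assms by (simp add: r_def d_def dot_minus_left dot_minus_right sphere_iff dot_commute)
  have "r \<noteq> 0"
  proof
    assume "r = 0"
    then have "\<forall>i<n. x i = y i" by (simp add: r_def dot_self_0 d_def)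
    then show False using assms Rn_eqI by (auto simp: sphere_iff)
  qed
  then have r: "r > 0" using dot_self_nonneg[of n d] by (simp add: r_def)
  define u where "u = (\<lambda>i. (1 / sqrt r) * d i)"
  have u: "u \<in> unit_sphere n"
  proof -
    have "dot n u u = 1 / sqrt r * (1 / sqrt r * r)"
      unfolding u_def dot_scale_left dot_scale_right r_def ..
    also have "\<dots> = 1" using r by (simp add: field_simps)
    finally show ?thesis using dR by (simp add: sphere_iff Rn_iff u_def)
  qed
  have refl: "reflection n u z = (\<lambda>i. z i - 2 * dot n z d / r * d i)" for z
  proof -
    have "2 * dot n z u * u i = 2 * dot n z d / r * d i" for i
      unfolding u_def dot_scale_right using r by (simp add: field_simps)
    then show ?thesis by (simp add: reflection_def)
  qed
  have "2 * dot n x d / r = 1" using r assms r_eq by (simp add: d_def dot_minus_right sphere_iff)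
  then have "reflection n u x = y" unfolding refl by (simp only:) (simp add: d_def)
  moreover have "reflection n u z = z" if "dot n z x = dot n z y" for z
    using that unfolding refl by (simp add: d_def dot_minus_right)
  ultimately show ?thesis using u by blast
qed

text \<open>Two reflections carry any pair of unit vectors to any other pair with the same scalar
  product.\<close>
lemma reflection_invariant_zonal:
  assumes inv: "\<And>u x y. u \<in> unit_sphere n \<Longrightarrow> x \<in> unit_sphere n \<Longrightarrow> y \<in> unit_sphere n \<Longrightarrow>
      F (reflection n u x) (reflection n u y) = F x y"
    and S: "x \<in> unit_sphere n" "y \<in> unit_sphere n" "x' \<in> unit_sphere n" "y' \<in> unit_sphere n"
    and dots: "dot n x y = dot n x' y'"
  shows "F x y = F x' y'"
proof -
  have fixed: "F x' y = F x' y'" if y: "y \<in> unit_sphere n" "dot n x' y = dot n x' y'" for y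
  proof (cases "y = y'")
    case False
    obtain u where "u \<in> unit_sphere n \<and> reflection n u y = y' \<and>
        (\<forall>z. dot n z y = dot n z y' \<longrightarrow> reflection n u z = z)"
      using reflection_exchange[OF y(1) S(4) False] unfolding Bex_def ..
    note u = conjunct1[OF this] conjunct2[OF this, THEN conjunct1]
      conjunct2[OF this, THEN conjunct2, THEN spec, THEN mp]
    have "reflection n u x' = x'" by (rule u(3)[OF y(2)])
    then show ?thesis using inv[OF u(1) S(3) y(1)] u(2) by simp
  qed simp
  show ?thesis
  proof (cases "x = x'")
    case True
    then show ?thesis using fixed[OF S(2)] dots by blast
  next
    case False
    obtain u where "u \<in> unit_sphere n \<and> reflection n u x = x' \<and>
        (\<forall>z. dot n z x = dot n z x' \<longrightarrow> reflection n u z = z)"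
      using reflection_exchange[OF S(1,3) False] unfolding Bex_def ..
    note u = conjunct1[OF this] conjunct2[OF this, THEN conjunct1]
    have "dot n x' (reflection n u y) = dot n x' y'"
      using dots u(2) dot_reflection_reflection[OF u(1), of x y] by simp
    then have "F x' (reflection n u y) = F x' y'"
      by (rule fixed[OF reflection_sphere[OF u(1) S(2)]])
    then show ?thesis using inv[OF u(1) S(1,2)] u(2) by simp
  qed
qed

section \<open>Integration on the sphere\<close>

locale sphere_measure =
  fixes n :: nat and \<sigma> :: "(nat \<Rightarrow> real) measure"
  assumes n2: "2 \<le> n" and rot: "rotation_invariant_prob n \<sigma>"

sublocale sphere_measure \<subseteq> prob_space \<sigma>
  using rot by (simp add: rotation_invariant_prob_def)

context sphere_measure
begin

lemma sets_\<sigma>: "sets \<sigma> = sets (restrict_space borel (unit_sphere n))"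
  using rot by (simp add: rotation_invariant_prob_def)

lemma space_\<sigma>: "space \<sigma> = unit_sphere n"
  using sets_eq_imp_space_eq[OF sets_\<sigma>] by (simp add: space_restrict_space)

lemma n_pos: "0 < n" "Suc 0 < n" "1 < n"
  using n2 by auto

lemma measurable_into_sphere:
  assumes "\<And>i. (\<lambda>\<omega>. f \<omega> i) \<in> borel_measurable M" "\<And>\<omega>. \<omega> \<in> space M \<Longrightarrow> f \<omega> \<in> unit_sphere n"
  shows "f \<in> measurable M \<sigma>"
proof -
  have "f \<in> measurable M (restrict_space borel (unit_sphere n))"
    using assms by (intro measurable_restrict_space2 measurable_coordinatewise_then_product) auto
  then show ?thesis by (simp add: measurable_cong_sets[OF refl sets_\<sigma>])
qed

lemma continuous_sphere_measurable:
  fixes f :: "(nat \<Rightarrow> real) \<Rightarrow> real"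
  assumes "continuous_on UNIV f" shows "f \<in> borel_measurable \<sigma>"
  unfolding measurable_cong_sets[OF sets_\<sigma> refl]
  by (intro measurable_restrict_space1 borel_measurable_continuous_onI assms)

lemma coord_measurable: "(\<lambda>x. x i) \<in> borel_measurable \<sigma>"
  by (intro continuous_sphere_measurable continuous_on_product_coordinates)

lemma coord_measurable_raw [measurable (raw)]:
  "f \<in> measurable M \<sigma> \<Longrightarrow> (\<lambda>\<omega>. f \<omega> i) \<in> borel_measurable M"
  using measurable_compose[OF _ coord_measurable] .

lemma dot_measurable [measurable (raw)]:
  "f \<in> measurable M \<sigma> \<Longrightarrow> g \<in> measurable M \<sigma> \<Longrightarrow> (\<lambda>\<omega>. dot n (f \<omega>) (g \<omega>)) \<in> borel_measurable M"
  unfolding dot_def by (intro borel_measurable_sum borel_measurable_times coord_measurable_raw)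

lemma const_measurable: "x \<in> unit_sphere n \<Longrightarrow> (\<lambda>_. x) \<in> measurable M \<sigma>"
  by (simp add: space_\<sigma>)

lemma integrable_sphere:
  fixes F :: "_ \<Rightarrow> real"
  assumes "F \<in> borel_measurable \<sigma>" "\<And>x. x \<in> unit_sphere n \<Longrightarrow> \<bar>F x\<bar> \<le> C"
  shows "integrable \<sigma> F"
  using assms by (intro integrable_const_bound[where B = C] AE_I2) (auto simp: space_\<sigma>)

lemma integral_sphere_abs_le:
  fixes F :: "_ \<Rightarrow> real"
  assumes "F \<in> borel_measurable \<sigma>" "\<And>x. x \<in> unit_sphere n \<Longrightarrow> \<bar>F x\<bar> \<le> C"
  shows "\<bar>\<integral>x. F x \<partial>\<sigma>\<bar> \<le> C"
proof -
  have "\<bar>\<integral>x. F x \<partial>\<sigma>\<bar> \<le> (\<integral>x. \<bar>F x\<bar> \<partial>\<sigma>)" by (rule integral_abs_bound)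
  also have "\<dots> \<le> (\<integral>x. C \<partial>\<sigma>)"
  proof (rule integral_mono)
    show "integrable \<sigma> (\<lambda>x. \<bar>F x\<bar>)" by (intro integrable_abs integrable_sphere[OF assms])
    show "\<bar>F x\<bar> \<le> C" if "x \<in> space \<sigma>" for x using that by (simp add: space_\<sigma> assms(2))
  qed simp
  finally show ?thesis by (simp add: prob_space)
qed

lemma orthogonal_map_measurable:
  assumes "orthogonal_map n T" "\<And>i. (\<lambda>x. T x i) \<in> borel_measurable \<sigma>"
  shows "T \<in> measurable \<sigma> \<sigma>"
  using assms by (intro measurable_into_sphere) (auto simp: space_\<sigma> orthogonal_map_sphere)

lemma integral_orthogonal:
  fixes F :: "_ \<Rightarrow> real"
  assumes "orthogonal_map n T" "T \<in> measurable \<sigma> \<sigma>" "F \<in> borel_measurable \<sigma>"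
  shows "(\<integral>x. F (T x) \<partial>\<sigma>) = (\<integral>x. F x \<partial>\<sigma>)"
proof -
  have "(\<integral>x. F x \<partial>\<sigma>) = (\<integral>x. F x \<partial>distr \<sigma> \<sigma> T)"
    using rot assms(1) by (simp add: rotation_invariant_prob_def)
  also have "\<dots> = (\<integral>x. F (T x) \<partial>\<sigma>)" by (rule integral_distr[OF assms(2,3)])
  finally show ?thesis ..
qed

lemma reflection_measurable [measurable]:
  assumes "u \<in> unit_sphere n" shows "reflection n u \<in> measurable \<sigma> \<sigma>"
proof (rule orthogonal_map_measurable[OF reflection_orthogonal_map[OF assms]])
  have [measurable]: "(\<lambda>_. u) \<in> measurable \<sigma> \<sigma>" by (rule const_measurable[OF assms])
  show "(\<lambda>x. reflection n u x i) \<in> borel_measurable \<sigma>" for i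
    unfolding reflection_def by measurable
qed

lemma integral_reflection:
  fixes F :: "_ \<Rightarrow> real"
  assumes "u \<in> unit_sphere n" "F \<in> borel_measurable \<sigma>"
  shows "(\<integral>x. F (reflection n u x) \<partial>\<sigma>) = (\<integral>x. F x \<partial>\<sigma>)"
  using assms by (intro integral_orthogonal reflection_orthogonal_map reflection_measurable)

text \<open>By transitivity, the law of a linear functional does not depend on the unit vector.\<close>
lemma integral_dot:
  fixes f :: "real \<Rightarrow> real"
  assumes [measurable]: "f \<in> borel_measurable borel" and x: "x \<in> unit_sphere n"
  shows "(\<integral>z. f (dot n x z) \<partial>\<sigma>) = (\<integral>z. f (z 0) \<partial>\<sigma>)"
proof -
  have e: "unit_vec 0 \<in> unit_sphere n" by (rule unit_vec_sphere[OF n_pos(1)])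
  have "(\<integral>z. f (dot n x z) \<partial>\<sigma>) = (\<integral>z. f (dot n (unit_vec 0) z) \<partial>\<sigma>)"
  proof (rule reflection_invariant_zonal[where F = "\<lambda>x y. \<integral>z. f (dot n x z) \<partial>\<sigma>"
        and y = x and y' = "unit_vec 0"])
    fix u x y assume u: "u \<in> unit_sphere n" and x: "x \<in> unit_sphere n"
    have [measurable]: "(\<lambda>z. f (dot n x z)) \<in> borel_measurable \<sigma>"
      using const_measurable[OF x] by measurable
    show "(\<integral>z. f (dot n (reflection n u x) z) \<partial>\<sigma>) = (\<integral>z. f (dot n x z) \<partial>\<sigma>)"
      unfolding dot_reflection_swap by (rule integral_reflection[OF u]) measurable
  qed (use x e in \<open>auto simp: sphere_iff\<close>)
  then show ?thesis by (simp add: dot_unit_vec_left n_pos)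
qed

subsection \<open>Infinitesimal rotations and moments\<close>

definition plane_rot :: "nat \<Rightarrow> nat \<Rightarrow> real \<Rightarrow> (nat \<Rightarrow> real) \<Rightarrow> nat \<Rightarrow> real" where
  "plane_rot i j s x = (\<lambda>k. if k = i then cos s * x i - sin s * x j
     else if k = j then sin s * x i + cos s * x j else x k)"

lemma plane_rot_orthogonal:
  assumes "i < n" "j < n" "i \<noteq> j" shows "orthogonal_map n (plane_rot i j s)"
proof -
  have split: "dot n x y = x i * y i + (x j * y j + (\<Sum>k\<in>{..<n} - {i} - {j}. x k * y k))" for x y
    unfolding dot_def using assms by (subst sum.remove[of _ i], simp, simp, subst sum.remove[of _ j]) auto
  have "dot n (plane_rot i j s x) (plane_rot i j s y) = dot n x y" for x y
  proof -
    have "(\<Sum>k\<in>{..<n} - {i} - {j}. plane_rot i j s x k * plane_rot i j s y k)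
        = (\<Sum>k\<in>{..<n} - {i} - {j}. x k * y k)"
      by (rule sum.cong) (auto simp: plane_rot_def)
    moreover have "(c * a - d * b) * (c * a' - d * b') + (d * a + c * b) * (d * a' + c * b') = a * a' + b * b'"
      if "c\<^sup>2 + d\<^sup>2 = 1" for a b a' b' c d :: real
    proof -
      have "(c * a - d * b) * (c * a' - d * b') + (d * a + c * b) * (d * a' + c * b')
          = (c\<^sup>2 + d\<^sup>2) * (a * a' + b * b')" by algebra
      then show ?thesis using that by simp
    qed
    from this[OF cos_squared_eq[THEN eq_diff_eq[THEN iffD1], of s], of "x i" "x j" "y i" "y j"]
    have "plane_rot i j s x i * plane_rot i j s y i + plane_rot i j s x j * plane_rot i j s y j
        = x i * y i + x j * y j"
      using assms by (simp add: plane_rot_def)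
    ultimately show ?thesis by (simp add: split)
  qed
  then show ?thesis using assms by (auto simp: orthogonal_map_def Rn_iff plane_rot_def)
qed

lemma plane_rot_derivative:
  assumes "i \<noteq> j"
  shows "((\<lambda>s. plane_rot i j s x k) has_real_derivative
    (if k = i then - plane_rot i j s x j else if k = j then plane_rot i j s x i else 0)) (at s)"
  using assms by (auto simp: plane_rot_def intro!: derivative_eq_intros)

text \<open>Differentiating the invariance under rotations of a coordinate plane: the generator of these
  rotations annihilates the integral.\<close>
lemma integral_generator_0:
  fixes F DF :: "(nat \<Rightarrow> real) \<Rightarrow> real"
  assumes ij: "i < n" "j < n" "i \<noteq> j"
    and [measurable]: "F \<in> borel_measurable \<sigma>" "DF \<in> borel_measurable \<sigma>"
    and F: "\<And>x. x \<in> unit_sphere n \<Longrightarrow> \<bar>F x\<bar> \<le> C"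
    and DF: "\<And>x. x \<in> unit_sphere n \<Longrightarrow> \<bar>DF x\<bar> \<le> C"
    and deriv: "\<And>x s. x \<in> unit_sphere n \<Longrightarrow>
      ((\<lambda>s. F (plane_rot i j s x)) has_real_derivative DF (plane_rot i j s x)) (at s)"
  shows "(\<integral>x. DF x \<partial>\<sigma>) = 0"
proof -
  note orth = plane_rot_orthogonal[OF ij]
  have [measurable]: "plane_rot i j s \<in> measurable \<sigma> \<sigma>" for s
    by (rule orthogonal_map_measurable[OF orth]) (simp add: plane_rot_def split: if_splits)
  have rot0: "plane_rot i j 0 x = x" for x by (simp add: plane_rot_def fun_eq_iff)
  \<comment> \<open>Difference quotients at the angle \<open>1 / (m + 1)\<close>: each of them integrates to
    zero by invariance.\<close>
  define q where "q m x = (F (plane_rot i j (1 / real (Suc m)) x) - F x) * real (Suc m)" for m x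
  have int_q: "(\<integral>x. q m x \<partial>\<sigma>) = 0" for m
  proof -
    have "(\<integral>x. F (plane_rot i j (1 / real (Suc m)) x) - F x \<partial>\<sigma>)
        = (\<integral>x. F (plane_rot i j (1 / real (Suc m)) x) \<partial>\<sigma>) - (\<integral>x. F x \<partial>\<sigma>)"
      using F orthogonal_map_sphere[OF orth]
      by (intro Bochner_Integration.integral_diff integrable_sphere[of _ C]) auto
    also have "\<dots> = 0" by (simp add: integral_orthogonal[OF orth])
    finally show ?thesis by (simp add: q_def)
  qed
  have "(\<lambda>m. \<integral>x. q m x \<partial>\<sigma>) \<longlonglongrightarrow> (\<integral>x. DF x \<partial>\<sigma>)"
  proof (rule integral_dominated_convergence[where w = "\<lambda>_. C"])
    show "AE x in \<sigma>. (\<lambda>m. q m x) \<longlonglongrightarrow> DF x"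
    proof (intro AE_I2)
      fix x assume "x \<in> space \<sigma>"
      then have x: "x \<in> unit_sphere n" by (simp add: space_\<sigma>)
      have "((\<lambda>h. (F (plane_rot i j (0 + h) x) - F (plane_rot i j 0 x)) / h) \<longlongrightarrow> DF (plane_rot i j 0 x)) (at 0)"
        using deriv[OF x, of 0] by (simp only: DERIV_def)
      then have "((\<lambda>h. (F (plane_rot i j h x) - F x) / h) \<longlongrightarrow> DF x) (at 0)" by (simp add: rot0)
      moreover have "filterlim (\<lambda>m. 1 / real (Suc m)) (at 0) sequentially"
        using LIMSEQ_Suc[OF lim_1_over_n] by (auto simp: filterlim_at)
      ultimately have "((\<lambda>m. (F (plane_rot i j (1 / real (Suc m)) x) - F x) / (1 / real (Suc m))) \<longlongrightarrow> DF x) sequentially"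
        by (rule filterlim_compose)
      then show "(\<lambda>m. q m x) \<longlonglongrightarrow> DF x" by (simp add: q_def)
    qed
    show "AE x in \<sigma>. norm (q m x) \<le> C" for m
    proof (intro AE_I2)
      fix x assume "x \<in> space \<sigma>"
      then have x: "x \<in> unit_sphere n" by (simp add: space_\<sigma>)
      have "norm (F (plane_rot i j (1 / real (Suc m)) x) - F (plane_rot i j 0 x)) \<le> C * norm (1 / real (Suc m) - 0)"
        using deriv[OF x] DF orthogonal_map_sphere[OF orth x]
        by (intro field_differentiable_bound[of UNIV _ "\<lambda>s. DF (plane_rot i j s x)"]) auto
      then have "\<bar>F (plane_rot i j (1 / real (Suc m)) x) - F x\<bar> \<le> C / real (Suc m)" by (simp add: rot0)
      then show "norm (q m x) \<le> C"
        unfolding q_def real_norm_def abs_mult by (simp only: pos_le_divide_eq of_nat_0_less_iff abs_of_nat zero_less_Suc)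
    qed
  qed (auto simp: q_def)
  then show ?thesis by (simp add: int_q LIMSEQ_const_iff)
qed

end

lemma abs_power_le_1: "\<bar>a\<bar> \<le> (1::real) \<Longrightarrow> \<bar>a ^ k\<bar> \<le> 1"
  by (simp add: power_abs power_le_one)

lemma abs_mult_le_1: "\<bar>a\<bar> \<le> (1::real) \<Longrightarrow> \<bar>b\<bar> \<le> 1 \<Longrightarrow> \<bar>a * b\<bar> \<le> 1"
  by (simp add: abs_mult mult_le_one)

context sphere_measure
begin

definition coord_moment :: "nat \<Rightarrow> real" where
  "coord_moment k = (\<integral>x. x 0 ^ k \<partial>\<sigma>)"

lemma coord_moment_0: "coord_moment 0 = 1"
  by (simp add: coord_moment_def prob_space)

lemma sphere_sum_sq: "x \<in> unit_sphere n \<Longrightarrow> (\<Sum>i<n. (x i)\<^sup>2) = 1"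
  by (simp add: sphere_iff dot_def power2_eq_square)

text \<open>Rotating the plane of coordinates \<open>0\<close> and \<open>j\<close> and integrating the derivative of
  \<open>(x 0)^(2 * d + 1) * x j\<close> relates the mixed moments to the pure ones; the sum over \<open>j\<close> of the mixed
  moments is known because the squared coordinates add up to one.\<close>
lemma coord_moment_Suc:
  "coord_moment (2 * d + 2) * (real n + 2 * real d) = (2 * real d + 1) * coord_moment (2 * d)"
proof -
  have int: "integrable \<sigma> (\<lambda>x. x i ^ k * x j ^ l)" for i j k l
  proof (rule integrable_sphere[of _ 1])
    show "\<bar>x i ^ k * x j ^ l\<bar> \<le> 1" if x: "x \<in> unit_sphere n" for x
      by (intro abs_mult_le_1 abs_power_le_1 sphere_coord_le[OF x])
  qed measurable
  have mixed: "(2 * real d + 1) * (\<integral>x. x 0 ^ (2 * d) * x j ^ 2 \<partial>\<sigma>) = coord_moment (2 * d + 2)"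
    if j: "j < n" "j \<noteq> 0" for j
  proof -
    have "(\<integral>x. x 0 ^ (2 * d + 2) * x j ^ 0 - (2 * real d + 1) * (x 0 ^ (2 * d) * x j ^ 2) \<partial>\<sigma>) = 0"
    proof (rule integral_generator_0[where i = 0 and j = j and C = "2 * real d + 2"
          and F = "\<lambda>x. x 0 ^ (2 * d + 1) * x j ^ 1"])
      fix x assume x: "x \<in> unit_sphere n"
      have le1: "\<bar>x 0 ^ a * x j ^ b\<bar> \<le> 1" for a b
        by (intro abs_mult_le_1 abs_power_le_1 sphere_coord_le[OF x])
      show "\<bar>x 0 ^ (2 * d + 1) * x j ^ 1\<bar> \<le> 2 * real d + 2" using le1[of "2 * d + 1" 1] by linarith
      have le2: "\<bar>(2 * real d + 1) * (x 0 ^ (2 * d) * x j ^ 2)\<bar> \<le> (2 * real d + 1) * 1"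
        unfolding abs_mult[of "2 * real d + 1"] using le1[of "2 * d" 2] by (intro mult_mono) auto
      show "\<bar>x 0 ^ (2 * d + 2) * x j ^ 0 - (2 * real d + 1) * (x 0 ^ (2 * d) * x j ^ 2)\<bar> \<le> 2 * real d + 2"
        using add_mono[OF le1[of "2 * d + 2" 0] le2]
        by (intro order_trans[OF abs_triangle_ineq4]) simp
      show "((\<lambda>s. plane_rot 0 j s x 0 ^ (2 * d + 1) * plane_rot 0 j s x j ^ 1) has_real_derivative
         plane_rot 0 j s x 0 ^ (2 * d + 2) * plane_rot 0 j s x j ^ 0
          - (2 * real d + 1) * (plane_rot 0 j s x 0 ^ (2 * d) * plane_rot 0 j s x j ^ 2)) (at s)" for s
      proof -
        have d0: "((\<lambda>s. plane_rot 0 j s x 0) has_real_derivative - plane_rot 0 j s x j) (at s)"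
          and dj: "((\<lambda>s. plane_rot 0 j s x j) has_real_derivative plane_rot 0 j s x 0) (at s)"
          using plane_rot_derivative[of 0 j x 0 s] plane_rot_derivative[of 0 j x j s] j by simp_all
        show ?thesis unfolding power_one_right
          by (rule DERIV_cong[OF DERIV_mult[OF DERIV_power[OF d0] dj]])
             (simp add: power2_eq_square algebra_simps)
      qed
    qed (use j n_pos in auto)
    then show ?thesis
      using int[of 0 "2 * d + 2" j 0] int[of 0 "2 * d" j 2] by (simp add: coord_moment_def)
  qed
  have "(\<Sum>j\<in>{..<n} - {0}. (\<integral>x. x 0 ^ (2 * d) * x j ^ 2 \<partial>\<sigma>))
      = (\<integral>x. (\<Sum>j\<in>{..<n} - {0}. x 0 ^ (2 * d) * x j ^ 2) \<partial>\<sigma>)"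
    by (rule Bochner_Integration.integral_sum[symmetric]) (rule int)
  also have "\<dots> = (\<integral>x. x 0 ^ (2 * d) - x 0 ^ (2 * d + 2) \<partial>\<sigma>)"
  proof (rule Bochner_Integration.integral_cong[OF refl])
    fix x assume "x \<in> space \<sigma>"
    then have "(\<Sum>j\<in>{..<n} - {0}. (x j)\<^sup>2) = 1 - (x 0)\<^sup>2"
      using sphere_sum_sq[of x] n_pos by (simp add: space_\<sigma> sum_diff1)
    then show "(\<Sum>j\<in>{..<n} - {0}. x 0 ^ (2 * d) * x j ^ 2) = x 0 ^ (2 * d) - x 0 ^ (2 * d + 2)"
      unfolding sum_distrib_left[symmetric] power_add[of _ "2 * d" 2] by (simp only: right_diff_distrib mult_1_right)
  qed
  also have "\<dots> = coord_moment (2 * d) - coord_moment (2 * d + 2)"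
    using int[of 0 "2 * d" 0 0] int[of 0 "2 * d + 2" 0 0] by (simp add: coord_moment_def)
  finally have "(2 * real d + 1) * (coord_moment (2 * d) - coord_moment (2 * d + 2))
      = (\<Sum>j\<in>{..<n} - {0}. (2 * real d + 1) * (\<integral>x. x 0 ^ (2 * d) * x j ^ 2 \<partial>\<sigma>))"
    by (simp only: sum_distrib_left[symmetric])
  also have "\<dots> = (\<Sum>j\<in>{..<n} - {0}. coord_moment (2 * d + 2))"
    using mixed by (intro sum.cong) auto
  also have "\<dots> = (real n - 1) * coord_moment (2 * d + 2)" using n_pos by simp
  finally show ?thesis by (simp add: algebra_simps)
qed

lemma coord_moment_even: "coord_moment (2 * d) = (\<Prod>i<d. (2 * real i + 1) / (real n + 2 * real i))"
proof (induction d)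
  case (Suc d)
  have "real n + 2 * real d > 0" using n_pos by simp
  then show ?case using coord_moment_Suc[of d] Suc by (simp add: field_simps)
qed (simp add: coord_moment_0)

lemma coord_moment_pos: "0 < coord_moment (2 * d)"
  unfolding coord_moment_even using n_pos by (intro prod_pos) auto

lemma coord_moment_2: "coord_moment 2 = 1 / real n"
  using coord_moment_even[of 1] by simp

subsection \<open>Moments of diagonal forms with random signs\<close>

definition sgn_of :: "nat set \<Rightarrow> nat \<Rightarrow> real" where
  "sgn_of I l = (if l \<in> I then - 1 else 1)"

definition sgn_form :: "nat set \<Rightarrow> (nat \<Rightarrow> real) \<Rightarrow> real" where
  "sgn_form I x = (\<Sum>l<n. sgn_of I l * (x l)\<^sup>2)"

lemma sgn_of_sq: "sgn_of I l * sgn_of I l = 1"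
  by (simp add: sgn_of_def)

lemma sgn_form_measurable [measurable]: "sgn_form I \<in> borel_measurable \<sigma>"
  unfolding sgn_form_def by measurable

lemma sgn_form_le: assumes "x \<in> unit_sphere n" shows "\<bar>sgn_form I x\<bar> \<le> 1"
proof -
  have "\<bar>sgn_form I x\<bar> \<le> (\<Sum>l<n. \<bar>sgn_of I l * (x l)\<^sup>2\<bar>)" unfolding sgn_form_def by (rule sum_abs)
  also have "\<dots> = (\<Sum>l<n. (x l)\<^sup>2)" by (intro sum.cong) (auto simp: sgn_of_def abs_mult)
  finally show ?thesis using sphere_sum_sq[OF assms] by simp
qed

text \<open>The same integration by parts, now with \<open>x i * x j * sgn_form I x ^ (N + 1)\<close> in the plane of the
  coordinates \<open>i\<close> and \<open>j\<close>.\<close>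
lemma sgn_form_recursion:
  "(real n + 2 * real (Suc N)) * (\<integral>x. sgn_form I x ^ (N + 2) \<partial>\<sigma>)
    = (\<integral>x. (\<Sum>l<n. sgn_of I l) * sgn_form I x ^ Suc N \<partial>\<sigma>) + 2 * real (Suc N) * (\<integral>x. sgn_form I x ^ N \<partial>\<sigma>)"
proof -
  let ?e = "sgn_of I" and ?T = "sgn_form I"
  define DF where "DF i j x = ((x i)\<^sup>2 - (x j)\<^sup>2) * ?T x ^ Suc N
      + 2 * real (Suc N) * (?e j - ?e i) * (x i)\<^sup>2 * (x j)\<^sup>2 * ?T x ^ N" for i j x
  have [measurable]: "DF i j \<in> borel_measurable \<sigma>" for i j unfolding DF_def by measurable
  have DF_le: "\<bar>DF i j x\<bar> \<le> 2 + 4 * real (Suc N)" if x: "x \<in> unit_sphere n" for i j x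
  proof -
    have a: "\<bar>(x k)\<^sup>2\<bar> \<le> 1" "\<bar>?T x ^ k\<bar> \<le> 1" for k
      by (intro abs_power_le_1 sphere_coord_le[OF x] sgn_form_le[OF x])+
    have "\<bar>(x i)\<^sup>2 - (x j)\<^sup>2\<bar> \<le> 2"
      using a(1)[of i] a(1)[of j] abs_triangle_ineq4[of "(x i)\<^sup>2" "(x j)\<^sup>2"] by linarith
    then have "\<bar>((x i)\<^sup>2 - (x j)\<^sup>2) * ?T x ^ Suc N\<bar> \<le> 2 * 1"
      unfolding abs_mult[of _ "?T x ^ Suc N"] using a(2)[of "Suc N"] by (intro mult_mono) auto
    moreover have "\<bar>2 * real (Suc N) * (?e j - ?e i) * ((x i)\<^sup>2 * ((x j)\<^sup>2 * ?T x ^ N))\<bar> \<le> (2 * real (Suc N) * 2) * 1"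
      unfolding abs_mult[of _ "(x i)\<^sup>2 * ((x j)\<^sup>2 * ?T x ^ N)"]
      by (intro mult_mono abs_mult_le_1 a) (auto simp: sgn_of_def abs_mult)
    moreover have "DF i j x = ((x i)\<^sup>2 - (x j)\<^sup>2) * ?T x ^ Suc N
        + 2 * real (Suc N) * (?e j - ?e i) * ((x i)\<^sup>2 * ((x j)\<^sup>2 * ?T x ^ N))"
      by (simp add: DF_def mult_ac)
    ultimately show ?thesis by linarith
  qed
  have DF_0: "(\<integral>x. DF i j x \<partial>\<sigma>) = 0" if ij: "i < n" "j < n" for i j
  proof (cases "i = j")
    case False
    show ?thesis
    proof (rule integral_generator_0[OF ij False, where C = "2 + 4 * real (Suc N)"
          and F = "\<lambda>x. x i * x j * ?T x ^ Suc N"])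
      fix x assume x: "x \<in> unit_sphere n"
      have "\<bar>x i * x j * ?T x ^ Suc N\<bar> \<le> 1"
        by (intro abs_mult_le_1 abs_power_le_1 sphere_coord_le[OF x] sgn_form_le[OF x])
      then show "\<bar>x i * x j * ?T x ^ Suc N\<bar> \<le> 2 + 4 * real (Suc N)" by linarith
      show "((\<lambda>s. plane_rot i j s x i * plane_rot i j s x j * ?T (plane_rot i j s x) ^ Suc N)
          has_real_derivative DF i j (plane_rot i j s x)) (at s)" for s
      proof -
        let ?y = "plane_rot i j s x"
        note d = plane_rot_derivative[OF False]
        have di: "((\<lambda>s. plane_rot i j s x i) has_real_derivative - ?y j) (at s)"
          and dj: "((\<lambda>s. plane_rot i j s x j) has_real_derivative ?y i) (at s)"
          using d[of x i s] d[of x j s] False by simp_all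
        have dT: "((\<lambda>s. ?T (plane_rot i j s x)) has_real_derivative 2 * (?e j - ?e i) * ?y i * ?y j) (at s)"
        proof -
          have "((\<lambda>s. ?T (plane_rot i j s x)) has_real_derivative
              (\<Sum>l<n. ?e l * (2 * ?y l * (if l = i then - ?y j else if l = j then ?y i else 0)))) (at s)"
            unfolding sgn_form_def
            by (intro DERIV_sum DERIV_cmult DERIV_cong[OF DERIV_power[OF d]]) simp
          also have "(\<Sum>l<n. ?e l * (2 * ?y l * (if l = i then - ?y j else if l = j then ?y i else 0)))
              = (\<Sum>l<n. (if l = i then - (2 * ?e i * ?y i * ?y j) else 0) + (if l = j then 2 * ?e j * ?y i * ?y j else 0))"
            using False by (intro sum.cong) auto
          also have "\<dots> = 2 * (?e j - ?e i) * ?y i * ?y j"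
            using ij by (simp add: sum.distrib algebra_simps)
          finally show ?thesis .
        qed
        show ?thesis
          by (rule DERIV_cong[OF DERIV_mult[OF DERIV_mult[OF di dj] DERIV_power[OF dT]]])
             (simp add: DF_def power2_eq_square algebra_simps)
      qed
    qed (use DF_le in auto)
  qed (simp add: DF_def)
  have int_DF: "integrable \<sigma> (DF i j)" for i j by (rule integrable_sphere[OF _ DF_le]) auto
  have int_T: "integrable \<sigma> (\<lambda>x. ?T x ^ k)" for k
  proof (rule integrable_sphere[of _ 1])
    show "\<bar>?T x ^ k\<bar> \<le> 1" if x: "x \<in> unit_sphere n" for x by (rule abs_power_le_1[OF sgn_form_le[OF x]])
  qed measurable
  \<comment> \<open>Weighted with the sign of \<open>i\<close>, the sum over all planes only involves the
    sum of the squared coordinates, which is \<open>1\<close>, and their signed sum, which is the form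
    itself.\<close>
  have "0 = (\<Sum>i<n. \<Sum>j<n. ?e i * (\<integral>x. DF i j x \<partial>\<sigma>))" using DF_0 by simp
  also have "\<dots> = (\<integral>x. (\<Sum>i<n. \<Sum>j<n. ?e i * DF i j x) \<partial>\<sigma>)"
    using int_DF by (simp add: Bochner_Integration.integral_sum)
  also have "\<dots> = (\<integral>x. (real n + 2 * real (Suc N)) * ?T x ^ (N + 2) - (\<Sum>l<n. ?e l) * ?T x ^ Suc N
      - 2 * real (Suc N) * ?T x ^ N \<partial>\<sigma>)"
  proof (rule Bochner_Integration.integral_cong[OF refl])
    fix x assume "x \<in> space \<sigma>"
    then have one: "(\<Sum>j<n. (x j)\<^sup>2) = 1" by (simp add: space_\<sigma> sphere_sum_sq)
    have inner: "(\<Sum>j<n. ?e i * DF i j x) = (real n * (?e i * (x i)\<^sup>2) - ?e i) * ?T x ^ Suc N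
        + 2 * real (Suc N) * (?e i * (x i)\<^sup>2 * ?T x - (x i)\<^sup>2) * ?T x ^ N" for i
    proof -
      have "(\<Sum>j<n. ?e i * DF i j x) = (\<Sum>j<n. (?e i * (x i)\<^sup>2 - ?e i * (x j)\<^sup>2) * ?T x ^ Suc N
          + 2 * real (Suc N) * (?e i * (x i)\<^sup>2 * (?e j * (x j)\<^sup>2) - ?e i * ?e i * (x i)\<^sup>2 * (x j)\<^sup>2) * ?T x ^ N)"
        by (intro sum.cong) (auto simp: DF_def algebra_simps)
      also have "\<dots> = (real n * (?e i * (x i)\<^sup>2) - ?e i * (\<Sum>j<n. (x j)\<^sup>2)) * ?T x ^ Suc N
          + 2 * real (Suc N) * (?e i * (x i)\<^sup>2 * ?T x - ?e i * ?e i * (x i)\<^sup>2 * (\<Sum>j<n. (x j)\<^sup>2)) * ?T x ^ N"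
        by (simp only: sum.distrib sum_subtractf sum_distrib_left[symmetric] sum_distrib_right[symmetric]
            sgn_form_def[symmetric] sum_constant card_lessThan mult.assoc) (simp only: mult_ac)
      finally show ?thesis by (simp add: one sgn_of_sq)
    qed
    have "(\<Sum>i<n. \<Sum>j<n. ?e i * DF i j x) = (\<Sum>i<n. (real n * (?e i * (x i)\<^sup>2) - ?e i) * ?T x ^ Suc N
        + 2 * real (Suc N) * (?e i * (x i)\<^sup>2 * ?T x - (x i)\<^sup>2) * ?T x ^ N)"
      by (simp only: inner)
    also have "\<dots> = (real n * ?T x - (\<Sum>l<n. ?e l)) * ?T x ^ Suc N
        + 2 * real (Suc N) * (?T x * ?T x - 1) * ?T x ^ N"
      by (simp only: sum.distrib sum_subtractf sum_distrib_left[symmetric] sum_distrib_right[symmetric]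
            sgn_form_def[symmetric] one)
    finally have "(\<Sum>i<n. \<Sum>j<n. ?e i * DF i j x) = (real n * ?T x - (\<Sum>l<n. ?e l)) * ?T x ^ Suc N
        + 2 * real (Suc N) * (?T x * ?T x - 1) * ?T x ^ N" .
    then show "(\<Sum>i<n. \<Sum>j<n. ?e i * DF i j x) = (real n + 2 * real (Suc N)) * ?T x ^ (N + 2)
        - (\<Sum>l<n. ?e l) * ?T x ^ Suc N - 2 * real (Suc N) * ?T x ^ N"
      by (simp add: algebra_simps)
  qed
  also have "\<dots> = (real n + 2 * real (Suc N)) * (\<integral>x. ?T x ^ (N + 2) \<partial>\<sigma>)
      - (\<integral>x. (\<Sum>l<n. ?e l) * ?T x ^ Suc N \<partial>\<sigma>) - 2 * real (Suc N) * (\<integral>x. ?T x ^ N \<partial>\<sigma>)"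
    using int_T[of "N + 2"] int_T[of "Suc N"] int_T[of N] by simp
  finally show ?thesis by simp
qed

text \<open>The Hermite--Hadamard inequality for the convex function \<open>t \<mapsto> t^m\<close>: its mean over an interval is at
  most the mean of its values at the end points.\<close>
lemma power_symmetric_diff_le:
  fixes u a :: real
  assumes m: "even m" and a: "0 \<le> a"
  shows "(u + a) ^ Suc m - (u - a) ^ Suc m \<le> real (Suc m) * a * ((u + a) ^ m + (u - a) ^ m)"
proof -
  define x y where "x = u + a" and "y = u - a"
  define S where "S = (\<Sum>i<Suc m. x ^ i * y ^ (m - i))"
  have "S = (\<Sum>i<Suc m. x ^ (m - i) * y ^ (m - (m - i)))"
    unfolding S_def by (subst sum.nat_diff_reindex[symmetric]) simp
  then have "2 * S = (\<Sum>i<Suc m. x ^ i * y ^ (m - i) + x ^ (m - i) * y ^ i)"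
    by (simp add: S_def sum.distrib)
  also have "\<dots> \<le> (\<Sum>i<Suc m. x ^ m + y ^ m)"
  proof (rule sum_mono)
    fix i assume "i \<in> {..<Suc m}"
    then have m_eq: "i + (m - i) = m" by simp
    have "0 \<le> (\<bar>x\<bar> ^ i - \<bar>y\<bar> ^ i) * (\<bar>x\<bar> ^ (m - i) - \<bar>y\<bar> ^ (m - i))"
    proof (cases "\<bar>x\<bar> \<le> \<bar>y\<bar>")
      case True then show ?thesis by (intro mult_nonpos_nonpos) (simp_all add: power_mono)
    next
      case False then show ?thesis by (intro mult_nonneg_nonneg) (simp_all add: power_mono)
    qed
    then have "\<bar>x\<bar> ^ i * \<bar>y\<bar> ^ (m - i) + \<bar>x\<bar> ^ (m - i) * \<bar>y\<bar> ^ i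
        \<le> \<bar>x\<bar> ^ i * \<bar>x\<bar> ^ (m - i) + \<bar>y\<bar> ^ i * \<bar>y\<bar> ^ (m - i)"
      by (simp add: algebra_simps)
    also have "\<dots> = x ^ m + y ^ m"
      using m m_eq by (simp add: power_add[symmetric] power_even_abs)
    finally have "\<bar>x ^ i * y ^ (m - i)\<bar> + \<bar>x ^ (m - i) * y ^ i\<bar> \<le> x ^ m + y ^ m"
      by (simp add: abs_mult power_abs)
    then show "x ^ i * y ^ (m - i) + x ^ (m - i) * y ^ i \<le> x ^ m + y ^ m" by linarith
  qed
  also have "\<dots> = real (Suc m) * (x ^ m + y ^ m)" by simp
  finally have "a * (2 * S) \<le> a * (real (Suc m) * (x ^ m + y ^ m))"
    using a by (rule mult_left_mono)
  moreover have "x ^ Suc m - y ^ Suc m = (x - y) * S"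
    unfolding S_def by (rule diff_power_eq_sum)
  moreover have "x - y = 2 * a" by (simp add: x_def y_def)
  ultimately show ?thesis by (simp add: x_def y_def mult_ac)
qed

definition toggle :: "nat \<Rightarrow> nat set \<Rightarrow> nat set" where
  "toggle l I = (if l \<in> I then I - {l} else insert l I)"

lemma sgn_of_toggle: "sgn_of (toggle l I) k = (if k = l then - sgn_of I k else sgn_of I k)"
  by (cases "k = l") (simp_all add: sgn_of_def toggle_def)

lemma sgn_form_toggle:
  assumes "l < n" shows "sgn_form (toggle l I) x = sgn_form I x - 2 * sgn_of I l * (x l)\<^sup>2"
proof -
  have "sgn_form (toggle l I) x = (\<Sum>k<n. sgn_of I k * (x k)\<^sup>2 - (if k = l then 2 * sgn_of I l * (x l)\<^sup>2 else 0))"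
    unfolding sgn_form_def by (intro sum.cong) (auto simp: sgn_of_toggle)
  then show ?thesis using assms by (simp add: sum_subtractf sgn_form_def)
qed

lemma sum_toggle:
  assumes "l < n" shows "(\<Sum>I\<in>Pow {..<n}. F (toggle l I)) = (\<Sum>I\<in>Pow {..<n}. F I)"
  using assms
  by (intro sum.reindex_bij_witness[of _ "toggle l" "toggle l"]) (auto simp: toggle_def)

text \<open>Flipping the sign at \<open>l\<close> moves the form by \<open>2 * (x l)\<^sup>2\<close>. Averaging over this sign turns the power with
  the factor \<open>sgn_of I l\<close> into a symmetric difference, which costs the factor \<open>(x l)\<^sup>2\<close>; these factors
  add up to one.\<close>
lemma sgn_form_sign_average:
  assumes x: "x \<in> unit_sphere n" and m: "even m"
  shows "(\<Sum>I\<in>Pow {..<n}. (\<Sum>l<n. sgn_of I l) * sgn_form I x ^ Suc m)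
    \<le> real (Suc m) * (\<Sum>I\<in>Pow {..<n}. sgn_form I x ^ m)"
proof -
  let ?T = "\<lambda>I. sgn_form I x"
  have coord: "(\<Sum>I\<in>Pow {..<n}. sgn_of I l * ?T I ^ Suc m) \<le> real (Suc m) * (x l)\<^sup>2 * (\<Sum>I\<in>Pow {..<n}. ?T I ^ m)"
    if l: "l < n" for l
  proof -
    let ?a = "(x l)\<^sup>2"
    have "(\<Sum>I\<in>Pow {..<n}. sgn_of I l * ?T I ^ Suc m) = (\<Sum>I\<in>Pow {..<n}. - (sgn_of I l * ?T (toggle l I) ^ Suc m))"
      by (subst sum_toggle[OF l, symmetric]) (simp add: sgn_of_toggle)
    then have "2 * (\<Sum>I\<in>Pow {..<n}. sgn_of I l * ?T I ^ Suc m)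
        = (\<Sum>I\<in>Pow {..<n}. sgn_of I l * (?T I ^ Suc m - ?T (toggle l I) ^ Suc m))"
      by (simp add: sum_subtractf right_diff_distrib sum_negf)
    also have "\<dots> \<le> (\<Sum>I\<in>Pow {..<n}. real (Suc m) * ?a * (?T I ^ m + ?T (toggle l I) ^ m))"
    proof (rule sum_mono)
      fix I
      show "sgn_of I l * (?T I ^ Suc m - ?T (toggle l I) ^ Suc m) \<le> real (Suc m) * ?a * (?T I ^ m + ?T (toggle l I) ^ m)"
      proof (cases "l \<in> I")
        case True
        have tog: "?T (toggle l I) = ?T I + ?a + ?a" using sgn_form_toggle[OF l, of I x] True by (simp add: sgn_of_def)
        have "?T (toggle l I) ^ Suc m - ?T I ^ Suc m \<le> real (Suc m) * ?a * (?T (toggle l I) ^ m + ?T I ^ m)"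
          using power_symmetric_diff_le[OF m zero_le_power2, of "?T I + ?a" "x l"]
          unfolding tog[symmetric] add_diff_cancel_right' .
        then show ?thesis using True by (simp add: sgn_of_def add.commute)
      next
        case False
        have tog: "?T (toggle l I) = ?T I - ?a - ?a" using sgn_form_toggle[OF l, of I x] False by (simp add: sgn_of_def)
        have "?T I ^ Suc m - ?T (toggle l I) ^ Suc m \<le> real (Suc m) * ?a * (?T I ^ m + ?T (toggle l I) ^ m)"
          using power_symmetric_diff_le[OF m zero_le_power2, of "?T I - ?a" "x l"]
          unfolding tog[symmetric] diff_add_cancel .
        then show ?thesis using False by (simp add: sgn_of_def)
      qed
    qed
    also have "\<dots> = real (Suc m) * ?a * ((\<Sum>I\<in>Pow {..<n}. ?T I ^ m) + (\<Sum>I\<in>Pow {..<n}. ?T (toggle l I) ^ m))"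
      by (simp only: sum_distrib_left[symmetric] sum.distrib)
    also have "\<dots> = 2 * (real (Suc m) * ?a * (\<Sum>I\<in>Pow {..<n}. ?T I ^ m))"
      by (subst sum_toggle[OF l, of "\<lambda>I. ?T I ^ m"]) simp
    finally show ?thesis by simp
  qed
  have "(\<Sum>I\<in>Pow {..<n}. (\<Sum>l<n. sgn_of I l) * ?T I ^ Suc m) = (\<Sum>l<n. \<Sum>I\<in>Pow {..<n}. sgn_of I l * ?T I ^ Suc m)"
    unfolding sum_distrib_right by (rule sum.swap)
  also have "\<dots> \<le> (\<Sum>l<n. real (Suc m) * (x l)\<^sup>2 * (\<Sum>I\<in>Pow {..<n}. ?T I ^ m))"
    by (rule sum_mono) (use coord in simp)
  also have "\<dots> = real (Suc m) * (\<Sum>l<n. (x l)\<^sup>2) * (\<Sum>I\<in>Pow {..<n}. ?T I ^ m)"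
    unfolding sum_distrib_left sum_distrib_right by (rule sum.swap)
  finally show ?thesis by (simp only: sphere_sum_sq[OF x] mult_1_right)
qed

definition sgn_moment :: "nat \<Rightarrow> real" where
  "sgn_moment k = (\<Sum>I\<in>Pow {..<n}. \<integral>x. sgn_form I x ^ k \<partial>\<sigma>) / 2 ^ n"

lemma integrable_sgn_form: "integrable \<sigma> (\<lambda>x. sgn_form I x ^ k)"
proof (rule integrable_sphere[of _ 1])
  show "\<bar>sgn_form I x ^ k\<bar> \<le> 1" if x: "x \<in> unit_sphere n" for x by (rule abs_power_le_1[OF sgn_form_le[OF x]])
qed measurable

lemma sgn_moment_0: "sgn_moment 0 = 1"
  by (simp add: sgn_moment_def prob_space card_Pow)

lemma sgn_moment_nonneg: "0 \<le> sgn_moment (2 * j)"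
  unfolding sgn_moment_def by (intro divide_nonneg_pos sum_nonneg Bochner_Integration.integral_nonneg) auto

lemma sgn_moment_decreasing: "sgn_moment (2 * j + 2) \<le> sgn_moment (2 * j)"
proof -
  have "(\<integral>x. sgn_form I x ^ (2 * j + 2) \<partial>\<sigma>) \<le> (\<integral>x. sgn_form I x ^ (2 * j) \<partial>\<sigma>)" for I
  proof (rule integral_mono[OF integrable_sgn_form integrable_sgn_form])
    fix x assume "x \<in> space \<sigma>"
    then have "(sgn_form I x)\<^sup>2 \<le> 1" by (simp add: space_\<sigma> sgn_form_le abs_square_le_1)
    then have "(sgn_form I x ^ (2 * j)) * (sgn_form I x)\<^sup>2 \<le> (sgn_form I x ^ (2 * j)) * 1"
      by (intro mult_left_mono) auto
    then show "sgn_form I x ^ (2 * j + 2) \<le> sgn_form I x ^ (2 * j)" by (simp only: power_add mult_1_right)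
  qed
  then show ?thesis unfolding sgn_moment_def by (intro divide_right_mono sum_mono) auto
qed

text \<open>In the average over all signs, the trace term of the recursion is at most half the last one. The
  resulting ratio of consecutive even moments is of order \<open>j / n\<close> for \<open>j\<close> below \<open>n\<close>; this is the source
  of the geometric decay of the contraction factors.\<close>
lemma sgn_moment_Suc:
  "(real n + 4 * real j + 2) * sgn_moment (2 * j + 2) \<le> 3 * (2 * real j + 1) * sgn_moment (2 * j)"
proof -
  let ?T = "sgn_form" and ?N = "2 * j"
  have int: "integrable \<sigma> (\<lambda>x. (\<Sum>l<n. sgn_of I l) * ?T I x ^ Suc ?N)" for I
    by (intro integrable_mult_right integrable_sgn_form)
  have "(\<Sum>I\<in>Pow {..<n}. \<integral>x. (\<Sum>l<n. sgn_of I l) * ?T I x ^ Suc ?N \<partial>\<sigma>)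
      = (\<integral>x. (\<Sum>I\<in>Pow {..<n}. (\<Sum>l<n. sgn_of I l) * ?T I x ^ Suc ?N) \<partial>\<sigma>)"
    by (rule Bochner_Integration.integral_sum[symmetric]) (rule int)
  also have "\<dots> \<le> (\<integral>x. real (Suc ?N) * (\<Sum>I\<in>Pow {..<n}. ?T I x ^ ?N) \<partial>\<sigma>)"
  proof (rule integral_mono)
    fix x assume "x \<in> space \<sigma>"
    then show "(\<Sum>I\<in>Pow {..<n}. (\<Sum>l<n. sgn_of I l) * ?T I x ^ Suc ?N) \<le> real (Suc ?N) * (\<Sum>I\<in>Pow {..<n}. ?T I x ^ ?N)"
      by (intro sgn_form_sign_average) (auto simp: space_\<sigma>)
  qed (intro Bochner_Integration.integrable_sum integrable_mult_right integrable_sgn_form; simp)+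
  also have "\<dots> = real (Suc ?N) * (\<Sum>I\<in>Pow {..<n}. \<integral>x. ?T I x ^ ?N \<partial>\<sigma>)"
    using integrable_sgn_form by (simp add: Bochner_Integration.integral_sum)
  finally have avg: "(\<Sum>I\<in>Pow {..<n}. \<integral>x. (\<Sum>l<n. sgn_of I l) * ?T I x ^ Suc ?N \<partial>\<sigma>)
      \<le> real (Suc ?N) * (\<Sum>I\<in>Pow {..<n}. \<integral>x. ?T I x ^ ?N \<partial>\<sigma>)" .
  have "(real n + 2 * real (Suc ?N)) * (\<Sum>I\<in>Pow {..<n}. \<integral>x. ?T I x ^ (?N + 2) \<partial>\<sigma>)
      = (\<Sum>I\<in>Pow {..<n}. \<integral>x. (\<Sum>l<n. sgn_of I l) * ?T I x ^ Suc ?N \<partial>\<sigma>)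
        + 2 * real (Suc ?N) * (\<Sum>I\<in>Pow {..<n}. \<integral>x. ?T I x ^ ?N \<partial>\<sigma>)"
    unfolding sum_distrib_left sgn_form_recursion sum.distrib ..
  also have "\<dots> \<le> 3 * real (Suc ?N) * (\<Sum>I\<in>Pow {..<n}. \<integral>x. ?T I x ^ ?N \<partial>\<sigma>)"
    using avg by (simp add: algebra_simps)
  finally have "(real n + 2 * real (Suc ?N)) * (\<Sum>I\<in>Pow {..<n}. \<integral>x. ?T I x ^ (?N + 2) \<partial>\<sigma>) / 2 ^ n
     \<le> 3 * real (Suc ?N) * (\<Sum>I\<in>Pow {..<n}. \<integral>x. ?T I x ^ ?N \<partial>\<sigma>) / 2 ^ n"
    by (rule divide_right_mono) simp
  moreover have "real n + 2 * real (Suc ?N) = real n + 4 * real j + 2" "3 * real (Suc ?N) = 3 * (2 * real j + 1)"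
    by simp_all
  ultimately show ?thesis by (simp only: sgn_moment_def times_divide_eq_right)
qed

subsection \<open>Hyperplanes are null sets\<close>

text \<open>Equality \<open>x 0 = 0\<close> has the same probability as \<open>x 0 + k * x j = 0\<close> for every slope \<open>k\<close>, and for
  different slopes these events meet only where both coordinates vanish. Since there are
  infinitely many slopes, \<open>x 0 = 0\<close> forces almost surely all coordinates to vanish.\<close>
lemma AE_coord_nonzero: "AE x in \<sigma>. x 0 \<noteq> 0"
proof -
  have imp: "AE x in \<sigma>. x 0 = 0 \<longrightarrow> x j = 0" if j: "j < n" "j \<noteq> 0" for j
  proof -
    define g where "g x = indicator {0} (x 0) - (indicator {0} (x 0) * indicator {0} (x j) :: real)" for x :: "nat \<Rightarrow> real"
    define c where "c = (\<integral>x. indicator {0} (x 0) \<partial>\<sigma> :: real)"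
    define d where "d = (\<integral>x. indicator {0} (x 0) * indicator {0} (x j) \<partial>\<sigma> :: real)"
    have int: "integrable \<sigma> (\<lambda>x. indicator {0} (x 0) * indicator {0} (x j) :: real)"
      "integrable \<sigma> (\<lambda>x. indicator {0} (x 0) :: real)"
      by (rule integrable_sphere[of _ 1]; auto simp: indicator_def)+
    have slope: "(\<integral>x. indicator {0} (x 0 + real k * x j) \<partial>\<sigma>) = c" for k
    proof -
      define r where "r = 1 / sqrt (1 + (real k)\<^sup>2)"
      have r: "r > 0" "r\<^sup>2 * (1 + (real k)\<^sup>2) = 1"
        by (auto simp: r_def power_divide add_pos_nonneg add_nonneg_eq_0_iff)
      define v where "v = lincomb r (unit_vec 0) (r * real k) (unit_vec j)"
      have dv: "dot n v x = r * (x 0 + real k * x j)" for x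
        using j by (simp add: v_def dot_lincomb_left dot_unit_vec_left algebra_simps n_pos)
      have "v 0 = r" "v j = r * real k" using j by (simp_all add: v_def lincomb_def unit_vec_def)
      then have "dot n v v = r\<^sup>2 * (1 + (real k)\<^sup>2)" by (simp add: dv power2_eq_square algebra_simps)
      then have "v \<in> unit_sphere n"
        using j r by (simp add: sphere_iff v_def lincomb_Rn unit_vec_Rn n_pos)
      then have "(\<integral>x. indicator {0} (dot n v x) \<partial>\<sigma>) = c"
        unfolding c_def by (intro integral_dot) auto
      moreover have "indicator {0} (dot n v x) = (indicator {0} (x 0 + real k * x j) :: real)" for x
        using r by (simp add: dv indicator_def)
      ultimately show ?thesis by simp
    qed
    have "real N * (c - d) \<le> 1" for N
    proof -
      have "real N * c = (\<Sum>k<N. \<integral>x. indicator {0} (x 0 + real k * x j) \<partial>\<sigma>)" by (simp add: slope)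
      also have "\<dots> = (\<integral>x. (\<Sum>k<N. indicator {0} (x 0 + real k * x j)) \<partial>\<sigma>)"
        by (rule Bochner_Integration.integral_sum[symmetric], rule integrable_sphere[of _ 1]) (auto simp: indicator_def)
      also have "\<dots> \<le> (\<integral>x. 1 + real N * (indicator {0} (x 0) * indicator {0} (x j)) \<partial>\<sigma>)"
      proof (rule integral_mono)
        show "integrable \<sigma> (\<lambda>x. \<Sum>k<N. indicator {0} (x 0 + real k * x j) :: real)"
          by (intro Bochner_Integration.integrable_sum integrable_sphere[of _ 1]) (auto simp: indicator_def)
        show "integrable \<sigma> (\<lambda>x. 1 + real N * (indicator {0} (x 0) * indicator {0} (x j)))" using int by simp
        fix x :: "nat \<Rightarrow> real"
        show "(\<Sum>k<N. indicator {0} (x 0 + real k * x j)) \<le> 1 + real N * (indicator {0} (x 0) * indicator {0} (x j) :: real)"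
        proof (cases "x j = 0")
          case True then show ?thesis by (simp add: indicator_def)
        next
          case False
          have "(\<Sum>k<N. indicator {0} (x 0 + real k * x j) :: real) = real (card {k\<in>{..<N}. x 0 + real k * x j = 0})"
            by (simp add: indicator_def sum.If_cases Int_def)
          also have "card {k\<in>{..<N}. x 0 + real k * x j = 0} \<le> 1"
          proof (rule card_le_Suc0_iff_eq[THEN iffD2, unfolded One_nat_def[symmetric]])
            show "\<forall>a\<in>{k\<in>{..<N}. x 0 + real k * x j = 0}. \<forall>b\<in>{k\<in>{..<N}. x 0 + real k * x j = 0}. a = b"
              using False by (auto simp: add_eq_0_iff) (metis mult_cancel_right of_nat_eq_iff)
          qed simp
          finally show ?thesis using False by simp
        qed
      qed
      also have "\<dots> = 1 + real N * d" using int by (simp add: d_def prob_space)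
      finally show ?thesis by (simp add: algebra_simps)
    qed
    then have "c - d \<le> 0"
      using reals_Archimedean3[of "c - d"] by (meson not_less)
    moreover have "(\<integral>x. g x \<partial>\<sigma>) = c - d" unfolding g_def c_def d_def using int by simp
    moreover have "0 \<le> g x" for x by (simp add: g_def indicator_def)
    moreover have "integrable \<sigma> g" unfolding g_def using int by simp
    ultimately have "integral\<^sup>L \<sigma> g = 0" "integrable \<sigma> g" "AE x in \<sigma>. 0 \<le> g x"
      using Bochner_Integration.integral_nonneg[of \<sigma> g] by auto
    then have "AE x in \<sigma>. g x = 0"
      using integral_nonneg_eq_0_iff_AE by blast
    then show ?thesis by eventually_elim (auto simp: g_def indicator_def split: if_splits)
  qed
  have "AE x in \<sigma>. \<forall>j\<in>{..<n}. x 0 = 0 \<longrightarrow> x j = 0"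
    by (rule AE_finite_allI[OF finite_lessThan]) (use imp in \<open>case_tac "s = 0", auto\<close>)
  then show ?thesis
  proof (rule AE_mp, intro AE_I2 impI)
    fix x assume "x \<in> space \<sigma>" and z: "\<forall>j\<in>{..<n}. x 0 = 0 \<longrightarrow> x j = 0"
    then have "(\<Sum>i<n. (x i)\<^sup>2) = 1" by (simp add: space_\<sigma> sphere_sum_sq)
    then show "x 0 \<noteq> 0" using z by auto
  qed
qed

lemma AE_dot_nonzero: assumes v: "v \<in> unit_sphere n" shows "AE x in \<sigma>. dot n v x \<noteq> 0"
proof -
  have [measurable]: "(\<lambda>x. dot n v x) \<in> borel_measurable \<sigma>" using const_measurable[OF v] by measurable
  have "(\<integral>x. indicator {0} (dot n v x) \<partial>\<sigma>) = (\<integral>x. indicator {0} (x 0) \<partial>\<sigma> :: real)"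
    by (rule integral_dot[OF _ v]) auto
  also have "\<dots> = (\<integral>x. 0 \<partial>\<sigma>)"
    by (rule integral_cong_AE) (use AE_coord_nonzero in \<open>auto simp: indicator_def\<close>)
  finally have "(\<integral>x. indicator {0} (dot n v x) \<partial>\<sigma>) = (0::real)" by simp
  moreover have "integrable \<sigma> (\<lambda>x. indicator {0} (dot n v x) :: real)"
    by (rule integrable_sphere[of _ 1]) (auto simp: indicator_def)
  ultimately have "AE x in \<sigma>. indicator {0} (dot n v x) = (0::real)"
    by (subst (asm) integral_nonneg_eq_0_iff_AE) auto
  then show ?thesis by eventually_elim (simp add: indicator_def split: if_splits)
qed

end

section \<open>Zonal polynomials\<close>

lemma bounded_Fubini:
  fixes F :: "'a \<Rightarrow> 'b \<Rightarrow> real"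
  assumes "prob_space M" "prob_space N"
    and meas: "(\<lambda>p. F (fst p) (snd p)) \<in> borel_measurable (M \<Otimes>\<^sub>M N)"
    and bound: "\<And>x y. x \<in> space M \<Longrightarrow> y \<in> space N \<Longrightarrow> \<bar>F x y\<bar> \<le> C"
  shows "(\<integral>x. (\<integral>y. F x y \<partial>N) \<partial>M) = (\<integral>y. (\<integral>x. F x y \<partial>M) \<partial>N)"
proof -
  interpret M: prob_space M by fact
  interpret N: prob_space N by fact
  interpret MN: pair_prob_space M N ..
  have "integrable (M \<Otimes>\<^sub>M N) (case_prod F)"
  proof (rule MN.integrable_const_bound[where B = C])
    show "AE p in M \<Otimes>\<^sub>M N. norm (case_prod F p) \<le> C"
      using bound by (intro AE_I2) (auto simp: space_pair_measure)
    show "case_prod F \<in> borel_measurable (M \<Otimes>\<^sub>M N)" using meas by (simp add: case_prod_unfold)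
  qed
  then show ?thesis by (rule MN.Fubini_integral[symmetric])
qed

lemma integral_Cauchy_Schwarz:
  fixes a b :: "'a \<Rightarrow> real"
  assumes "integrable M (\<lambda>x. (a x)\<^sup>2)" "integrable M (\<lambda>x. (b x)\<^sup>2)" "integrable M (\<lambda>x. a x * b x)"
  shows "(\<integral>x. a x * b x \<partial>M)\<^sup>2 \<le> (\<integral>x. (a x)\<^sup>2 \<partial>M) * (\<integral>x. (b x)\<^sup>2 \<partial>M)"
proof -
  define A B C where "A = (\<integral>x. (a x)\<^sup>2 \<partial>M)" and "B = (\<integral>x. (b x)\<^sup>2 \<partial>M)" and "C = (\<integral>x. a x * b x \<partial>M)"
  have quad: "0 \<le> s\<^sup>2 * A - 2 * (s * t) * C + t\<^sup>2 * B" for s t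
  proof -
    have "0 \<le> (\<integral>x. (s * a x - t * b x)\<^sup>2 \<partial>M)" by (rule Bochner_Integration.integral_nonneg) simp
    also have "\<dots> = (\<integral>x. s\<^sup>2 * (a x)\<^sup>2 - 2 * (s * t) * (a x * b x) + t\<^sup>2 * (b x)\<^sup>2 \<partial>M)"
      by (intro Bochner_Integration.integral_cong) (auto simp: power2_eq_square algebra_simps)
    also have "\<dots> = s\<^sup>2 * A - 2 * (s * t) * C + t\<^sup>2 * B"
      using assms by (simp add: A_def B_def C_def)
    finally show ?thesis .
  qed
  have "0 \<le> B" unfolding B_def by (rule Bochner_Integration.integral_nonneg) simp
  show ?thesis
  proof (cases "B = 0")
    case True
    have "C = 0"
    proof (rule ccontr)
      assume "C \<noteq> 0"
      have "2 * (1 * ((A + 1) / (2 * C))) * C = A + 1" using \<open>C \<noteq> 0\<close> by simp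
      then show False using quad[of 1 "(A + 1) / (2 * C)"] True by simp
    qed
    then show ?thesis using True by (simp add: A_def[symmetric] B_def[symmetric] C_def[symmetric])
  next
    case False
    then have "0 < B" using \<open>0 \<le> B\<close> by simp
    have "0 \<le> B * (B * A - C\<^sup>2)"
      using quad[of B C] by (simp add: power2_eq_square algebra_simps)
    then have "0 \<le> B * A - C\<^sup>2" using \<open>0 < B\<close> by (simp add: zero_le_mult_iff)
    then show ?thesis by (simp add: A_def[symmetric] B_def[symmetric] C_def[symmetric] mult.commute)
  qed
qed

lemma poly_measurable [measurable]: "poly (p :: real poly) \<in> borel_measurable borel"
  by (intro borel_measurable_continuous_onI continuous_intros)

definition poly_bound :: "real poly \<Rightarrow> real" where
  "poly_bound p = (\<Sum>i\<le>degree p. \<bar>coeff p i\<bar>)"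

lemma poly_bound_nonneg: "0 \<le> poly_bound p"
  by (simp add: poly_bound_def sum_nonneg)

lemma poly_abs_le: assumes "\<bar>t\<bar> \<le> 1" shows "\<bar>poly p t\<bar> \<le> poly_bound p"
proof -
  have "\<bar>poly p t\<bar> \<le> (\<Sum>i\<le>degree p. \<bar>coeff p i * t ^ i\<bar>)" unfolding poly_altdef by (rule sum_abs)
  also have "\<dots> \<le> (\<Sum>i\<le>degree p. \<bar>coeff p i\<bar>)"
    using assms by (intro sum_mono) (auto simp: abs_mult power_abs intro!: mult_left_le power_le_one)
  finally show ?thesis by (simp add: poly_bound_def)
qed

lemma poly_eq_on_interval:
  fixes p q :: "real poly"
  assumes "\<And>t. -1 \<le> t \<Longrightarrow> t \<le> 1 \<Longrightarrow> poly p t = poly q t" shows "p = q"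
proof (rule ccontr)
  assume "p \<noteq> q"
  then have "finite {t. poly (p - q) t = 0}" by (intro poly_roots_finite) simp
  moreover have "{-1..1::real} \<subseteq> {t. poly (p - q) t = 0}" using assms by auto
  ultimately have "finite {-1..1::real}" by (rule rev_finite_subset)
  then show False using infinite_Icc[of "-1::real" 1] by simp
qed

subsection \<open>Random quadratic forms\<close>

text \<open>As a polynomial in \<open>t\<close>, the expectation of \<open>(d * t + e)^k\<close> for random \<open>d\<close> and \<open>e\<close>.\<close>
definition form_poly :: "'a measure \<Rightarrow> ('a \<Rightarrow> real) \<Rightarrow> ('a \<Rightarrow> real) \<Rightarrow> nat \<Rightarrow> real poly" where
  "form_poly M d e k = (\<Sum>i\<le>k. monom (real (k choose i) * (\<integral>\<omega>. d \<omega> ^ i * e \<omega> ^ (k - i) \<partial>M)) i)"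

lemma coeff_form_poly: "coeff (form_poly M d e k) i = (if i \<le> k then real (k choose i) * (\<integral>\<omega>. d \<omega> ^ i * e \<omega> ^ (k - i) \<partial>M) else 0)"
  by (simp add: form_poly_def coeff_sum)

lemma coeff_form_poly_top: "coeff (form_poly M d e k) k = (\<integral>\<omega>. d \<omega> ^ k \<partial>M)"
  by (simp add: coeff_form_poly)

lemma poly_form_poly:
  assumes "prob_space M" and [measurable]: "d \<in> borel_measurable M" "e \<in> borel_measurable M"
    and bound: "\<And>\<omega>. \<omega> \<in> space M \<Longrightarrow> \<bar>d \<omega>\<bar> \<le> 1 \<and> \<bar>e \<omega>\<bar> \<le> 1"
  shows "poly (form_poly M d e k) t = (\<integral>\<omega>. (d \<omega> * t + e \<omega>) ^ k \<partial>M)"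
proof -
  interpret prob_space M by fact
  have int: "integrable M (\<lambda>\<omega>. d \<omega> ^ i * e \<omega> ^ j)" for i j
    using bound by (intro integrable_const_bound[where B = 1] AE_I2)
      (auto simp del: abs_mult intro!: abs_mult_le_1 abs_power_le_1)
  have "(\<integral>\<omega>. (d \<omega> * t + e \<omega>) ^ k \<partial>M) = (\<integral>\<omega>. (\<Sum>i\<le>k. (real (k choose i) * t ^ i) * (d \<omega> ^ i * e \<omega> ^ (k - i))) \<partial>M)"
    by (simp add: binomial_ring power_mult_distrib mult_ac)
  also have "\<dots> = (\<Sum>i\<le>k. \<integral>\<omega>. (real (k choose i) * t ^ i) * (d \<omega> ^ i * e \<omega> ^ (k - i)) \<partial>M)"
    by (rule Bochner_Integration.integral_sum) (intro integrable_mult_right int)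
  also have "\<dots> = poly (form_poly M d e k) t"
    by (simp add: form_poly_def poly_sum poly_monom mult_ac)
  finally show ?thesis by simp
qed

context sphere_measure
begin

abbreviation e0 :: "nat \<Rightarrow> real" where "e0 \<equiv> unit_vec 0"
abbreviation e1 :: "nat \<Rightarrow> real" where "e1 \<equiv> unit_vec (Suc 0)"

lemma e_sphere: "e0 \<in> unit_sphere n" "e1 \<in> unit_sphere n"
  using unit_vec_sphere n_pos by auto

lemma dot_e: "dot n e0 x = x 0" "dot n x e0 = x 0" "dot n e1 x = x (Suc 0)" "dot n x e1 = x (Suc 0)"
  using n_pos by (simp_all add: dot_unit_vec dot_unit_vec_left)

lemma e_apply: "e0 0 = 1" "e1 0 = 0" "e0 (Suc 0) = 0" "e1 (Suc 0) = 1"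
  by (auto simp: unit_vec_def)

lemma lincomb_sphere: "c\<^sup>2 + d\<^sup>2 = 1 \<Longrightarrow> lincomb c e0 d e1 \<in> unit_sphere n"
  using e_sphere by (simp add: sphere_iff lincomb_Rn dot_lincomb_left dot_lincomb_right)
    (simp add: dot_e e_apply power2_eq_square)

lemma dot_lincomb_e: "dot n (lincomb c e0 d e1) z = c * z 0 + d * z (Suc 0)" "dot n z (lincomb c e0 d e1) = c * z 0 + d * z (Suc 0)"
  by (simp_all add: dot_lincomb_left dot_lincomb_right dot_e)

text \<open>By invariance only the scalar product \<open>t\<close> of the two points matters, so that the pair can be chosen
  symmetric about \<open>e0\<close>. For such a pair a symmetric bilinear form is affine in \<open>t\<close>, whence the
  expectation of its \<open>k\<close>-th power is a polynomial of degree \<open>k\<close> with a known leading coefficient.\<close>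
lemma random_form_zonal:
  fixes s :: "'a \<Rightarrow> (nat \<Rightarrow> real) \<Rightarrow> (nat \<Rightarrow> real) \<Rightarrow> real"
  assumes M: "prob_space M"
    and meas: "(\<lambda>\<omega>. s \<omega> e0 e0) \<in> borel_measurable M" "(\<lambda>\<omega>. s \<omega> e1 e1) \<in> borel_measurable M"
    and bound: "\<And>\<omega> x. \<omega> \<in> space M \<Longrightarrow> x \<in> unit_sphere n \<Longrightarrow> \<bar>s \<omega> x x\<bar> \<le> 1"
    and bilin: "\<And>\<omega> c d. \<omega> \<in> space M \<Longrightarrow>
      s \<omega> (lincomb c e0 d e1) (lincomb c e0 (- d) e1) = c\<^sup>2 * s \<omega> e0 e0 - d\<^sup>2 * s \<omega> e1 e1"
    and inv: "\<And>u x y. u \<in> unit_sphere n \<Longrightarrow> x \<in> unit_sphere n \<Longrightarrow> y \<in> unit_sphere n \<Longrightarrow>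
      (\<integral>\<omega>. s \<omega> (reflection n u x) (reflection n u y) ^ k \<partial>M) = (\<integral>\<omega>. s \<omega> x y ^ k \<partial>M)"
    and xy: "x \<in> unit_sphere n" "y \<in> unit_sphere n"
  shows "(\<integral>\<omega>. s \<omega> x y ^ k \<partial>M) =
    poly (form_poly M (\<lambda>\<omega>. (s \<omega> e0 e0 + s \<omega> e1 e1) / 2) (\<lambda>\<omega>. (s \<omega> e0 e0 - s \<omega> e1 e1) / 2) k) (dot n x y)"
proof -
  define t where "t = dot n x y"
  have t: "- 1 \<le> t" "t \<le> 1" using sphere_dot_le[OF xy] by (auto simp: t_def)
  \<comment> \<open>Cosine and sine of half the angle between the two points.\<close>
  define c d where "c = sqrt ((1 + t) / 2)" and "d = sqrt ((1 - t) / 2)"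
  have cd: "c\<^sup>2 = (1 + t) / 2" "d\<^sup>2 = (1 - t) / 2" using t by (simp_all add: c_def d_def)
  have S: "lincomb c e0 d e1 \<in> unit_sphere n" "lincomb c e0 (- d) e1 \<in> unit_sphere n"
    by (intro lincomb_sphere; simp add: cd add_divide_distrib[symmetric])+
  have "dot n (lincomb c e0 d e1) (lincomb c e0 (- d) e1) = c\<^sup>2 - d\<^sup>2"
    unfolding dot_lincomb_e by (simp add: lincomb_def e_apply power2_eq_square)
  also have "\<dots> = t" by (simp add: cd field_simps)
  finally have "(\<integral>\<omega>. s \<omega> x y ^ k \<partial>M) = (\<integral>\<omega>. s \<omega> (lincomb c e0 d e1) (lincomb c e0 (- d) e1) ^ k \<partial>M)"
    by (intro reflection_invariant_zonal[where F = "\<lambda>x y. \<integral>\<omega>. s \<omega> x y ^ k \<partial>M", OF inv xy S]) (simp_all add: t_def)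
  also have "\<dots> = (\<integral>\<omega>. ((s \<omega> e0 e0 + s \<omega> e1 e1) / 2 * t + (s \<omega> e0 e0 - s \<omega> e1 e1) / 2) ^ k \<partial>M)"
    by (intro Bochner_Integration.integral_cong refl arg_cong[of _ _ "\<lambda>a. a ^ k"]) (simp add: bilin cd field_simps)
  also have "\<dots> = poly (form_poly M (\<lambda>\<omega>. (s \<omega> e0 e0 + s \<omega> e1 e1) / 2) (\<lambda>\<omega>. (s \<omega> e0 e0 - s \<omega> e1 e1) / 2) k) t"
  proof (rule poly_form_poly[OF M, symmetric])
    fix \<omega> assume w: "\<omega> \<in> space M"
    show "\<bar>(s \<omega> e0 e0 + s \<omega> e1 e1) / 2\<bar> \<le> 1 \<and> \<bar>(s \<omega> e0 e0 - s \<omega> e1 e1) / 2\<bar> \<le> 1"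
      using bound[OF w e_sphere(1)] bound[OF w e_sphere(2)] by (auto simp: abs_le_iff)
  qed (use meas in measurable)
  finally show ?thesis by (simp add: t_def)
qed

subsection \<open>Convolution of zonal polynomials\<close>

text \<open>The polynomial \<open>t \<mapsto> \<integral> p (z 0) * (t * z 0 + sqrt (1 - t\<^sup>2) * z 1)^j\<close>: the odd powers of the square root
  come with odd moments of \<open>z 1\<close>, which vanish.\<close>
definition conv_power :: "real poly \<Rightarrow> nat \<Rightarrow> real poly" where
  "conv_power p j = (\<Sum>r\<le>j. if even r
     then smult (real (j choose r) * (\<integral>z. poly p (z 0) * (z 0 ^ (j - r) * z (Suc 0) ^ r) \<partial>\<sigma>))
       (monom 1 (j - r) * [:1, 0, -1:] ^ (r div 2)) else 0)"

text \<open>Composition of integral operators with kernels \<open>p <x, y>\<close> and \<open>q <x, y>\<close>, as an operation on the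
  polynomials.\<close>
definition conv :: "real poly \<Rightarrow> real poly \<Rightarrow> real poly" where
  "conv p q = (\<Sum>j\<le>degree q. smult (coeff q j) (conv_power p j))"

lemma poly_kernel_measurable [measurable (raw)]:
  "f \<in> measurable M \<sigma> \<Longrightarrow> g \<in> measurable M \<sigma> \<Longrightarrow> (\<lambda>\<omega>. poly p (dot n (f \<omega>) (g \<omega>))) \<in> borel_measurable M"
  by measurable

lemma poly_kernel_le: "x \<in> unit_sphere n \<Longrightarrow> y \<in> unit_sphere n \<Longrightarrow> \<bar>poly p (dot n x y)\<bar> \<le> poly_bound p"
  by (intro poly_abs_le sphere_dot_le)

lemma conv_invariant:
  assumes u: "u \<in> unit_sphere n" and xy: "x \<in> unit_sphere n" "y \<in> unit_sphere n"
  shows "(\<integral>z. poly p (dot n (reflection n u x) z) * poly q (dot n z (reflection n u y)) \<partial>\<sigma>)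
    = (\<integral>z. poly p (dot n x z) * poly q (dot n z y) \<partial>\<sigma>)"
proof -
  have [measurable]: "(\<lambda>_. x) \<in> measurable \<sigma> \<sigma>" "(\<lambda>_. y) \<in> measurable \<sigma> \<sigma>"
    by (intro const_measurable xy)+
  show ?thesis
    unfolding dot_reflection_swap[of n u x] dot_reflection_swap[of n u _ y, symmetric]
    by (rule integral_reflection[OF u, where F = "\<lambda>z. poly p (dot n x z) * poly q (dot n z y)"]) measurable
qed

definition flip1 :: "(nat \<Rightarrow> real) \<Rightarrow> nat \<Rightarrow> real" where "flip1 = reflection n e1"

lemma flip1_apply: "flip1 z 0 = z 0" "flip1 z (Suc 0) = - z (Suc 0)"
  by (simp_all add: flip1_def reflection_def dot_e e_apply)

lemma conv_power_eval:
  assumes t: "- 1 \<le> t" "t \<le> 1"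
  shows "poly (conv_power p j) t = (\<integral>z. poly p (z 0) * (t * z 0 + sqrt (1 - t\<^sup>2) * z (Suc 0)) ^ j \<partial>\<sigma>)"
proof -
  define m where "m r = (\<integral>z. poly p (z 0) * (z 0 ^ (j - r) * z (Suc 0) ^ r) \<partial>\<sigma>)" for r
  have m_odd: "m r = 0" if "odd r" for r
  proof -
    have "m r = (\<integral>z. poly p (flip1 z 0) * (flip1 z 0 ^ (j - r) * flip1 z (Suc 0) ^ r) \<partial>\<sigma>)"
      unfolding m_def flip1_def
      by (rule integral_reflection[OF e_sphere(2), where F = "\<lambda>z. poly p (z 0) * (z 0 ^ (j - r) * z (Suc 0) ^ r)", symmetric]) measurable
    also have "\<dots> = - m r" using that by (simp add: flip1_apply m_def)
    finally show ?thesis by simp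
  qed
  have int: "integrable \<sigma> (\<lambda>z. poly p (z 0) * (z 0 ^ a * z (Suc 0) ^ b))" for a b
  proof (rule integrable_sphere[of _ "poly_bound p * 1"])
    show "\<bar>poly p (z 0) * (z 0 ^ a * z (Suc 0) ^ b)\<bar> \<le> poly_bound p * 1" if z: "z \<in> unit_sphere n" for z
      unfolding abs_mult[of "poly p (z 0)"]
      by (intro mult_mono poly_abs_le abs_mult_le_1 abs_power_le_1 sphere_coord_le[OF z] poly_bound_nonneg) simp
  qed measurable
  have "(\<integral>z. poly p (z 0) * (t * z 0 + sqrt (1 - t\<^sup>2) * z (Suc 0)) ^ j \<partial>\<sigma>)
      = (\<integral>z. poly p (z 0) * (sqrt (1 - t\<^sup>2) * z (Suc 0) + t * z 0) ^ j \<partial>\<sigma>)" by (simp add: add.commute)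
  also have "\<dots> = (\<integral>z. (\<Sum>r\<le>j. (real (j choose r) * (t ^ (j - r) * sqrt (1 - t\<^sup>2) ^ r)) * (poly p (z 0) * (z 0 ^ (j - r) * z (Suc 0) ^ r))) \<partial>\<sigma>)"
    unfolding binomial_ring sum_distrib_left
    by (intro Bochner_Integration.integral_cong refl sum.cong) (simp add: power_mult_distrib mult_ac)
  also have "\<dots> = (\<Sum>r\<le>j. \<integral>z. (real (j choose r) * (t ^ (j - r) * sqrt (1 - t\<^sup>2) ^ r)) * (poly p (z 0) * (z 0 ^ (j - r) * z (Suc 0) ^ r)) \<partial>\<sigma>)"
    by (rule Bochner_Integration.integral_sum) (intro integrable_mult_right int)
  also have "\<dots> = (\<Sum>r\<le>j. (real (j choose r) * (t ^ (j - r) * sqrt (1 - t\<^sup>2) ^ r)) * m r)"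
    by (simp add: m_def)
  also have "\<dots> = poly (conv_power p j) t"
    unfolding conv_power_def poly_sum
  proof (rule sum.cong[OF refl])
    fix r
    have "sqrt (1 - t\<^sup>2) ^ r = (1 - t\<^sup>2) ^ (r div 2)" if "even r"
    proof -
      have "1 - t\<^sup>2 \<ge> 0" using t abs_square_le_1[of t] by (simp add: abs_le_iff)
      have "sqrt (1 - t\<^sup>2) ^ r = (sqrt (1 - t\<^sup>2) ^ 2) ^ (r div 2)" using that by (simp only: power_mult[symmetric]) simp
      then show ?thesis using \<open>1 - t\<^sup>2 \<ge> 0\<close> by simp
    qed
    moreover have "poly [:1, 0, -1:] t = 1 - t\<^sup>2" by (simp add: power2_eq_square)
    ultimately show "(real (j choose r) * (t ^ (j - r) * sqrt (1 - t\<^sup>2) ^ r)) * m r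
      = poly (if even r then smult (real (j choose r) * (\<integral>z. poly p (z 0) * (z 0 ^ (j - r) * z (Suc 0) ^ r) \<partial>\<sigma>))
          (monom 1 (j - r) * [:1, 0, -1:] ^ (r div 2)) else 0) t"
      unfolding m_def[symmetric]
      by (cases "even r") (simp_all add: m_odd poly_monom poly_power mult_ac del: poly_pCons)
  qed
  finally show ?thesis by simp
qed

lemma poly_conv:
  assumes xy: "x \<in> unit_sphere n" "y \<in> unit_sphere n"
  shows "poly (conv p q) (dot n x y) = (\<integral>z. poly p (dot n x z) * poly q (dot n z y) \<partial>\<sigma>)"
proof -
  define t where "t = dot n x y"
  have t: "- 1 \<le> t" "t \<le> 1" using sphere_dot_le[OF xy] by (auto simp: t_def)
  have t2: "t\<^sup>2 \<le> 1" using t abs_square_le_1[of t] by (simp add: abs_le_iff)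
  \<comment> \<open>The pair is moved to \<open>e0\<close> and a point in the plane of the first two
    coordinates.\<close>
  define y' where "y' = lincomb t e0 (sqrt (1 - t\<^sup>2)) e1"
  have y': "y' \<in> unit_sphere n" unfolding y'_def using t2 by (intro lincomb_sphere) simp
  have dy: "dot n z y' = t * z 0 + sqrt (1 - t\<^sup>2) * z (Suc 0)" for z by (simp add: y'_def dot_lincomb_e)
  have "dot n e0 y' = t" by (simp add: dy e_apply)
  then have "(\<integral>z. poly p (dot n x z) * poly q (dot n z y) \<partial>\<sigma>) = (\<integral>z. poly p (dot n e0 z) * poly q (dot n z y') \<partial>\<sigma>)"
    by (intro reflection_invariant_zonal[where F = "\<lambda>x y. \<integral>z. poly p (dot n x z) * poly q (dot n z y) \<partial>\<sigma>",
          OF conv_invariant xy e_sphere(1) y']) (simp_all add: t_def)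
  also have "\<dots> = (\<integral>z. (\<Sum>j\<le>degree q. coeff q j * (poly p (z 0) * (t * z 0 + sqrt (1 - t\<^sup>2) * z (Suc 0)) ^ j)) \<partial>\<sigma>)"
    by (simp add: dot_e dy poly_altdef[of q] sum_distrib_left mult_ac)
  also have "\<dots> = (\<Sum>j\<le>degree q. \<integral>z. coeff q j * (poly p (z 0) * (t * z 0 + sqrt (1 - t\<^sup>2) * z (Suc 0)) ^ j) \<partial>\<sigma>)"
  proof (rule Bochner_Integration.integral_sum)
    fix j
    show "integrable \<sigma> (\<lambda>z. coeff q j * (poly p (z 0) * (t * z 0 + sqrt (1 - t\<^sup>2) * z (Suc 0)) ^ j))"
    proof (intro integrable_mult_right integrable_sphere[of _ "poly_bound p * 1"])
      show "\<bar>poly p (z 0) * (t * z 0 + sqrt (1 - t\<^sup>2) * z (Suc 0)) ^ j\<bar> \<le> poly_bound p * 1" if z: "z \<in> unit_sphere n" for z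
        unfolding abs_mult[of "poly p (z 0)"] dy[symmetric]
        by (intro mult_mono poly_abs_le abs_power_le_1 sphere_coord_le[OF z] sphere_dot_le[OF z y'] poly_bound_nonneg) simp
    qed measurable
  qed
  also have "\<dots> = poly (conv p q) t"
    by (simp add: conv_def poly_sum conv_power_eval[OF t])
  finally show ?thesis by (simp add: t_def)
qed

lemma zonal_point:
  assumes "- 1 \<le> t" "t \<le> 1" obtains y where "y \<in> unit_sphere n" "dot n e0 y = t"
proof
  have "t\<^sup>2 \<le> 1" using assms abs_square_le_1[of t] by (simp add: abs_le_iff)
  then show "lincomb t e0 (sqrt (1 - t\<^sup>2)) e1 \<in> unit_sphere n" by (intro lincomb_sphere) simp
  show "dot n e0 (lincomb t e0 (sqrt (1 - t\<^sup>2)) e1) = t" by (simp add: dot_lincomb_e e_apply)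
qed

lemma zonal_poly_eqI:
  assumes "\<And>x y. x \<in> unit_sphere n \<Longrightarrow> y \<in> unit_sphere n \<Longrightarrow> poly p (dot n x y) = poly q (dot n x y)"
  shows "p = q"
  by (rule poly_eq_on_interval) (metis assms zonal_point e_sphere(1))

lemma conv_commute: "conv p q = conv q p"
proof (rule zonal_poly_eqI)
  fix x y assume xy: "x \<in> unit_sphere n" "y \<in> unit_sphere n"
  have "poly (conv p q) (dot n x y) = (\<integral>z. poly p (dot n x z) * poly q (dot n z y) \<partial>\<sigma>)"
    by (rule poly_conv[OF xy])
  also have "\<dots> = (\<integral>z. poly q (dot n y z) * poly p (dot n z x) \<partial>\<sigma>)"
    by (simp only: dot_commute[of n x] dot_commute[of n y] mult.commute[of "poly p _"])
  also have "\<dots> = poly (conv q p) (dot n x y)"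
    unfolding dot_commute[of n x y] by (rule poly_conv[OF xy(2,1), symmetric])
  finally show "poly (conv p q) (dot n x y) = poly (conv q p) (dot n x y)" .
qed

lemma integrable_conv:
  assumes xy: "x \<in> unit_sphere n" "y \<in> unit_sphere n"
  shows "integrable \<sigma> (\<lambda>z. poly p (dot n x z) * poly q (dot n z y))"
proof (rule integrable_sphere[of _ "poly_bound p * poly_bound q"])
  have [measurable]: "(\<lambda>_. x) \<in> measurable \<sigma> \<sigma>" "(\<lambda>_. y) \<in> measurable \<sigma> \<sigma>" by (intro const_measurable xy)+
  show "(\<lambda>z. poly p (dot n x z) * poly q (dot n z y)) \<in> borel_measurable \<sigma>" by measurable
  show "\<bar>poly p (dot n x z) * poly q (dot n z y)\<bar> \<le> poly_bound p * poly_bound q" if z: "z \<in> unit_sphere n" for z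
    unfolding abs_mult by (intro mult_mono poly_kernel_le xy z poly_bound_nonneg) simp
qed

lemma conv_diff_right: "conv p (q - r) = conv p q - conv p r"
  by (rule zonal_poly_eqI) (simp add: poly_conv right_diff_distrib integrable_conv)

lemma conv_add_right: "conv p (q + r) = conv p q + conv p r"
  by (rule zonal_poly_eqI) (simp add: poly_conv distrib_left integrable_conv)

lemma conv_smult_right: "conv p (smult a q) = smult a (conv p q)"
  by (rule zonal_poly_eqI) (simp add: poly_conv mult.left_commute)

lemma conv_diff_left: "conv (q - r) p = conv q p - conv r p"
  by (simp add: conv_commute[of _ p] conv_diff_right)

lemma conv_smult_left: "conv (smult a q) p = smult a (conv q p)"
  by (simp add: conv_commute[of _ p] conv_smult_right)

definition poly_inner :: "real poly \<Rightarrow> real poly \<Rightarrow> real" where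
  "poly_inner p q = (\<integral>z. poly p (z 0) * poly q (z 0) \<partial>\<sigma>)"

lemma poly_inner_conv: "x \<in> unit_sphere n \<Longrightarrow> poly_inner p q = (\<integral>z. poly p (dot n x z) * poly q (dot n z x) \<partial>\<sigma>)"
  using integral_dot[of "\<lambda>t. poly p t * poly q t" x] by (simp add: poly_inner_def dot_commute)

lemma poly_inner_eq: "poly_inner p q = poly (conv p q) 1"
  using poly_inner_conv[OF e_sphere(1), of p q] poly_conv[OF e_sphere(1) e_sphere(1), of p q]
  by (simp add: dot_e e_apply)

lemma poly_inner_commute: "poly_inner p q = poly_inner q p"
  by (simp add: poly_inner_eq conv_commute[of p q])

lemma poly_inner_diff_right: "poly_inner p (q - r) = poly_inner p q - poly_inner p r"
  and poly_inner_smult_right: "poly_inner p (smult a q) = a * poly_inner p q"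
  by (simp_all add: poly_inner_eq conv_diff_right conv_smult_right)

lemma poly_inner_diff_left: "poly_inner (q - r) p = poly_inner q p - poly_inner r p"
  and poly_inner_smult_left: "poly_inner (smult a q) p = a * poly_inner q p"
  by (simp_all add: poly_inner_eq conv_diff_left conv_smult_left)

lemma poly_inner_sum_right: "poly_inner p (\<Sum>i\<in>I. q i) = (\<Sum>i\<in>I. poly_inner p (q i))"
proof (induction I rule: infinite_finite_induct)
  case (insert i I)
  have "poly_inner p (q i + (\<Sum>i\<in>I. q i)) = poly_inner p (q i) + poly_inner p (\<Sum>i\<in>I. q i)"
    by (simp add: poly_inner_eq conv_add_right)
  then show ?case using insert by simp
qed (simp_all add: poly_inner_def)

text \<open>Self-adjointness of the zonal operators.\<close>
lemma poly_inner_assoc: "poly_inner (conv p q) r = poly_inner p (conv q r)"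
proof -
  note e = e_sphere(1)
  have [measurable]: "(\<lambda>_. e0) \<in> measurable M \<sigma>" for M :: "'a measure" by (rule const_measurable[OF e])
  have "poly_inner (conv p q) r = (\<integral>y. poly (conv p q) (dot n e0 y) * poly r (dot n y e0) \<partial>\<sigma>)"
    by (rule poly_inner_conv[OF e])
  also have "\<dots> = (\<integral>y. (\<integral>z. poly p (dot n e0 z) * poly q (dot n z y) * poly r (dot n y e0) \<partial>\<sigma>) \<partial>\<sigma>)"
    using integrable_conv[OF e] by (intro Bochner_Integration.integral_cong refl) (simp add: poly_conv[OF e] space_\<sigma>)
  also have "\<dots> = (\<integral>z. (\<integral>y. poly p (dot n e0 z) * poly q (dot n z y) * poly r (dot n y e0) \<partial>\<sigma>) \<partial>\<sigma>)"
  proof (rule bounded_Fubini[OF prob_space_axioms prob_space_axioms, where C = "poly_bound p * poly_bound q * poly_bound r"])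
    show "\<bar>poly p (dot n e0 z) * poly q (dot n z y) * poly r (dot n y e0)\<bar> \<le> poly_bound p * poly_bound q * poly_bound r"
      if "y \<in> space \<sigma>" "z \<in> space \<sigma>" for y z
      using that unfolding abs_mult
      by (intro mult_mono poly_kernel_le e poly_bound_nonneg mult_nonneg_nonneg) (auto simp: space_\<sigma>)
  qed measurable
  also have "\<dots> = (\<integral>z. poly p (dot n e0 z) * poly (conv q r) (dot n z e0) \<partial>\<sigma>)"
    by (intro Bochner_Integration.integral_cong refl) (simp add: poly_conv[OF _ e] space_\<sigma> mult.assoc)
  also have "\<dots> = poly_inner p (conv q r)" by (rule poly_inner_conv[OF e, symmetric])
  finally show ?thesis .
qed

subsection \<open>Degrees and leading coefficients of convolutions\<close>

definition low_degree :: "nat \<Rightarrow> real poly \<Rightarrow> bool" where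
  "low_degree k p \<longleftrightarrow> (\<forall>i\<ge>k. coeff p i = 0)"

lemma low_degree_0: "low_degree k 0"
  and low_degree_diff: "low_degree k p \<Longrightarrow> low_degree k q \<Longrightarrow> low_degree k (p - q)"
  and low_degree_add: "low_degree k p \<Longrightarrow> low_degree k q \<Longrightarrow> low_degree k (p + q)"
  and low_degree_smult: "low_degree k p \<Longrightarrow> low_degree k (smult a p)"
  by (simp_all add: low_degree_def)

lemma low_degree_sum: "(\<And>i. i \<in> I \<Longrightarrow> low_degree k (p i)) \<Longrightarrow> low_degree k (\<Sum>i\<in>I. p i)"
  by (simp add: low_degree_def coeff_sum)

lemma low_degree_mono: "low_degree k p \<Longrightarrow> k \<le> l \<Longrightarrow> low_degree l p"
  by (simp add: low_degree_def)

lemma low_degree_degree: "low_degree (Suc (degree p)) p"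
  by (simp add: low_degree_def coeff_eq_0)

lemma low_degree_0_iff: "low_degree 0 p \<longleftrightarrow> p = 0"
  by (simp add: low_degree_def poly_eq_iff)

lemma low_degreeD: "low_degree k p \<Longrightarrow> p = 0 \<or> degree p < k"
  by (metis low_degree_def leading_coeff_0_iff not_le)

lemma low_degree_Suc_reduce:
  assumes "low_degree (Suc k) p" "low_degree (Suc k) q" "coeff q k = 1"
  shows "low_degree k (p - smult (coeff p k) q)"
  unfolding low_degree_def
proof (intro allI impI)
  fix i assume "k \<le> i"
  then consider "i = k" | "Suc k \<le> i" by linarith
  then show "coeff (p - smult (coeff p k) q) i = 0"
    using assms by cases (simp_all add: low_degree_def)
qed

lemma low_degree_conv_power: "low_degree (Suc j) (conv_power p j)"
  unfolding conv_power_def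
proof (rule low_degree_sum)
  fix r assume "r \<in> {..j}"
  have "degree (monom (1::real) (j - r) * [:1, 0, -1:] ^ (r div 2)) \<le> j" if "even r"
  proof -
    have "degree ([:1, 0, -1::real:] ^ (r div 2)) \<le> 2 * (r div 2)"
      by (rule order_trans[OF degree_power_le]) simp
    then have "degree (monom (1::real) (j - r) * [:1, 0, -1:] ^ (r div 2)) \<le> (j - r) + 2 * (r div 2)"
      by (intro order_trans[OF degree_mult_le] add_mono degree_monom_le)
    then show ?thesis using \<open>r \<in> {..j}\<close> that by simp
  qed
  then have "low_degree (Suc j) (monom (1::real) (j - r) * [:1, 0, -1:] ^ (r div 2))" if "even r"
    using low_degree_mono[OF low_degree_degree] that by simp
  then show "low_degree (Suc j) (if even r then smult (real (j choose r) * (\<integral>z. poly p (z 0) * (z 0 ^ (j - r) * z (Suc 0) ^ r) \<partial>\<sigma>))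
       (monom 1 (j - r) * [:1, 0, -1:] ^ (r div 2)) else 0)"
    by (auto intro: low_degree_smult low_degree_0)
qed

lemma low_degree_conv: assumes "low_degree k q" shows "low_degree k (conv p q)"
proof (cases "q = 0")
  case True then show ?thesis by (simp add: conv_def low_degree_0)
next
  case False
  then have "degree q < k" using low_degreeD[OF assms] by simp
  then show ?thesis unfolding conv_def
    by (intro low_degree_sum low_degree_smult low_degree_mono[OF low_degree_conv_power]) auto
qed

lemma low_degree_conv': "low_degree k p \<Longrightarrow> low_degree k (conv p q)"
  using low_degree_conv[of k p q] by (simp add: conv_commute)

text \<open>Both the leading coefficient of \<open>conv (monom 1 k) (monom 1 k)\<close> and the eigenvalue of the operator with
  kernel \<open>orth k\<close> on its own degree.\<close>
definition tau :: "nat \<Rightarrow> real" where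
  "tau k = (\<integral>z. (((z 0)\<^sup>2 + (z (Suc 0))\<^sup>2) / 2) ^ k \<partial>\<sigma>)"

lemma coord_sq_le: "z \<in> unit_sphere n \<Longrightarrow> (z i)\<^sup>2 \<le> 1"
  using sphere_coord_le[of z n i] by (simp add: abs_square_le_1)

lemma tau_ge: "coord_moment (2 * k) / 2 ^ k \<le> tau k"
proof -
  have "(\<integral>z. z 0 ^ (2 * k) / 2 ^ k \<partial>\<sigma>) \<le> tau k"
    unfolding tau_def
  proof (rule integral_mono)
    show "integrable \<sigma> (\<lambda>z. z 0 ^ (2 * k) / 2 ^ k)"
    proof (intro integrable_divide integrable_sphere[of _ 1])
      show "\<bar>z 0 ^ (2 * k)\<bar> \<le> 1" if z: "z \<in> unit_sphere n" for z
        by (rule abs_power_le_1[OF sphere_coord_le[OF z]])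
    qed measurable
    show "integrable \<sigma> (\<lambda>z. (((z 0)\<^sup>2 + (z (Suc 0))\<^sup>2) / 2) ^ k)"
    proof (intro integrable_sphere[of _ 1])
      show "\<bar>(((z 0)\<^sup>2 + (z (Suc 0))\<^sup>2) / 2) ^ k\<bar> \<le> 1" if z: "z \<in> unit_sphere n" for z
        using coord_sq_le[OF z, of 0] coord_sq_le[OF z, of "Suc 0"] by (intro abs_power_le_1) simp
    qed measurable
    fix z :: "nat \<Rightarrow> real"
    have "((z 0)\<^sup>2 / 2) ^ k \<le> (((z 0)\<^sup>2 + (z (Suc 0))\<^sup>2) / 2) ^ k" by (intro power_mono divide_right_mono) auto
    then show "z 0 ^ (2 * k) / 2 ^ k \<le> (((z 0)\<^sup>2 + (z (Suc 0))\<^sup>2) / 2) ^ k" by (simp only: power_divide power_mult)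
  qed
  then show ?thesis by (simp add: coord_moment_def)
qed

lemma tau_pos: "0 < tau k"
  by (rule less_le_trans[OF _ tau_ge]) (simp add: coord_moment_pos)

text \<open>The convolution of two monomials is the moment of order \<open>k\<close> of the random rank one form
  \<open><x, z> * <z, y>\<close>.\<close>
lemma coeff_conv_monom: "coeff (conv (monom 1 k) (monom 1 k)) k = tau k"
proof -
  let ?s = "\<lambda>z x y. dot n x z * dot n z y"
  let ?f = "form_poly \<sigma> (\<lambda>z. (?s z e0 e0 + ?s z e1 e1) / 2) (\<lambda>z. (?s z e0 e0 - ?s z e1 e1) / 2) k"
  have "conv (monom 1 k) (monom 1 k) = ?f"
  proof (rule zonal_poly_eqI)
    fix x y assume xy: "x \<in> unit_sphere n" "y \<in> unit_sphere n"
    have "(\<integral>z. ?s z x y ^ k \<partial>\<sigma>) = poly ?f (dot n x y)"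
    proof (rule random_form_zonal[OF prob_space_axioms _ _ _ _ _ xy, where s = ?s])
      show "\<bar>dot n x z * dot n z x\<bar> \<le> 1" if "z \<in> space \<sigma>" "x \<in> unit_sphere n" for x z
        using that sphere_dot_le by (intro abs_mult_le_1) (auto simp: space_\<sigma>)
      show "dot n (lincomb c e0 d e1) z * dot n z (lincomb c e0 (- d) e1)
          = c\<^sup>2 * (dot n e0 z * dot n z e0) - d\<^sup>2 * (dot n e1 z * dot n z e1)" for c d z
        unfolding dot_lincomb_e dot_e by (simp add: power2_eq_square algebra_simps)
      show "(\<integral>z. (dot n (reflection n u x) z * dot n z (reflection n u y)) ^ k \<partial>\<sigma>)
          = (\<integral>z. (dot n x z * dot n z y) ^ k \<partial>\<sigma>)"
        if "u \<in> unit_sphere n" "x \<in> unit_sphere n" "y \<in> unit_sphere n" for u x y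
        using conv_invariant[OF that, of "monom 1 k" "monom 1 k"] by (simp add: poly_monom power_mult_distrib)
    qed (simp_all add: dot_e)
    then show "poly (conv (monom 1 k) (monom 1 k)) (dot n x y) = poly ?f (dot n x y)"
      by (simp add: poly_conv[OF xy] poly_monom power_mult_distrib)
  qed
  then show ?thesis
    by (simp only: coeff_form_poly_top tau_def dot_e) (simp add: power2_eq_square)
qed

lemma coeff_conv:
  assumes p: "low_degree (Suc k) p" and q: "low_degree (Suc k) q"
  shows "coeff (conv p q) k = coeff p k * coeff q k * tau k"
proof -
  have m: "low_degree (Suc k) (monom (1::real) k)" "coeff (monom (1::real) k) k = 1"
    by (simp_all add: low_degree_def)
  note red = low_degree_Suc_reduce[OF _ m]
  have "low_degree k (conv (p - smult (coeff p k) (monom 1 k)) q)"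
    by (rule low_degree_conv'[OF red[OF p]])
  then have "coeff (conv p q) k = coeff p k * coeff (conv (monom 1 k) q) k"
    by (simp add: conv_diff_left conv_smult_left low_degree_def)
  moreover have "low_degree k (conv (monom 1 k) (q - smult (coeff q k) (monom 1 k)))"
    by (rule low_degree_conv[OF red[OF q]])
  then have "coeff (conv (monom 1 k) q) k = coeff q k * tau k"
    by (simp add: conv_diff_right conv_smult_right low_degree_def coeff_conv_monom)
  ultimately show ?thesis by simp
qed

lemma poly_inner_nonneg: "0 \<le> poly_inner p p"
  unfolding poly_inner_def by (rule Bochner_Integration.integral_nonneg) simp

text \<open>The convolution square of \<open>p\<close> would vanish as well, although its leading coefficient is that of \<open>p\<close>
  squared times \<open>tau\<close>.\<close>
lemma poly_inner_self_0: assumes "poly_inner p p = 0" shows "p = 0"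
proof (rule ccontr)
  assume "p \<noteq> 0"
  have "conv p p = 0"
  proof (rule zonal_poly_eqI)
    fix x y assume xy: "x \<in> unit_sphere n" "y \<in> unit_sphere n"
    have "(\<integral>z. poly p (dot n x z) * poly p (dot n z x) \<partial>\<sigma>) = 0"
      using assms poly_inner_conv[OF xy(1), of p p] by simp
    then have "AE z in \<sigma>. poly p (dot n x z) * poly p (dot n z x) = 0"
      using integrable_conv[OF xy(1) xy(1), of p p]
      by (subst (asm) integral_nonneg_eq_0_iff_AE) (auto simp: dot_commute[of n _ x])
    then have "AE z in \<sigma>. poly p (dot n x z) * poly p (dot n z y) = 0"
      by eventually_elim (auto simp: dot_commute[of n _ x])
    then have "(\<integral>z. poly p (dot n x z) * poly p (dot n z y) \<partial>\<sigma>) = 0"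
      by (rule integral_eq_zero_AE)
    then show "poly (conv p p) (dot n x y) = poly 0 (dot n x y)" by (simp add: poly_conv[OF xy])
  qed
  then have "lead_coeff p * lead_coeff p * tau (degree p) = 0"
    using coeff_conv[OF low_degree_degree low_degree_degree, of p] by simp
  then show False using \<open>p \<noteq> 0\<close> tau_pos[of "degree p"] by simp
qed

subsection \<open>Orthogonal polynomials\<close>

\<comment> \<open>Shows the termination proofs of \<open>orth\<close> and \<open>gram\<close> that the summation index stays below the bound.\<close>
declare sum.cong [fundef_cong]

fun orth :: "nat \<Rightarrow> real poly" where
  "orth k = monom 1 k - (\<Sum>i<k. smult (poly_inner (monom 1 k) (orth i) / poly_inner (orth i) (orth i)) (orth i))"

declare orth.simps [simp del]

lemma low_degree_orth: "low_degree (Suc k) (orth k)"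
proof (induction k rule: less_induct)
  case (less k)
  have "low_degree (Suc k) (\<Sum>i<k. smult (poly_inner (monom 1 k) (orth i) / poly_inner (orth i) (orth i)) (orth i))"
    by (intro low_degree_sum low_degree_smult low_degree_mono[OF less]) auto
  moreover have "low_degree (Suc k) (monom (1::real) k)" by (simp add: low_degree_def)
  ultimately show ?case by (subst orth.simps) (rule low_degree_diff)
qed

lemma coeff_orth: "coeff (orth k) k = 1"
proof -
  have "low_degree k (\<Sum>i<k. smult (poly_inner (monom 1 k) (orth i) / poly_inner (orth i) (orth i)) (orth i))"
    by (intro low_degree_sum low_degree_smult low_degree_mono[OF low_degree_orth]) auto
  then show ?thesis by (subst orth.simps) (simp add: low_degree_def)
qed

lemma orth_nonzero: "orth k \<noteq> 0"
  using coeff_orth[of k] by auto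

lemma orth_norm_pos: "0 < poly_inner (orth k) (orth k)"
  using poly_inner_nonneg[of "orth k"] poly_inner_self_0 orth_nonzero by (metis less_eq_real_def)

lemma orth_orthogonal_less: "i < k \<Longrightarrow> poly_inner (orth k) (orth i) = 0"
proof (induction k arbitrary: i rule: less_induct)
  case (less k)
  have "poly_inner (orth i) (orth k) = poly_inner (orth i) (monom 1 k)
      - (\<Sum>j<k. poly_inner (monom 1 k) (orth j) / poly_inner (orth j) (orth j) * poly_inner (orth i) (orth j))"
    by (subst orth.simps[of k]) (simp add: poly_inner_diff_right poly_inner_sum_right poly_inner_smult_right)
  also have "(\<Sum>j<k. poly_inner (monom 1 k) (orth j) / poly_inner (orth j) (orth j) * poly_inner (orth i) (orth j))
      = (\<Sum>j<k. if j = i then poly_inner (monom 1 k) (orth i) else 0)"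
  proof (rule sum.cong[OF refl])
    fix j assume "j \<in> {..<k}"
    then show "poly_inner (monom 1 k) (orth j) / poly_inner (orth j) (orth j) * poly_inner (orth i) (orth j)
        = (if j = i then poly_inner (monom 1 k) (orth i) else 0)"
      using less orth_norm_pos[of i] less.IH[of i j] less.IH[of j i] poly_inner_commute[of "orth i" "orth j"]
      by (cases i j rule: linorder_cases) auto
  qed
  also have "\<dots> = poly_inner (monom 1 k) (orth i)" using less by simp
  finally show ?case
    using poly_inner_commute[of "orth i" "orth k"] poly_inner_commute[of "monom 1 k" "orth i"] by linarith
qed

lemma orth_orthogonal: "i \<noteq> k \<Longrightarrow> poly_inner (orth k) (orth i) = 0"
  using orth_orthogonal_less[of i k] orth_orthogonal_less[of k i] poly_inner_commute[of "orth i" "orth k"]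
  by (cases i k rule: linorder_cases) auto

lemma orth_span: "low_degree N q \<Longrightarrow> \<exists>c. q = (\<Sum>k<N. smult (c k) (orth k))"
proof (induction N arbitrary: q)
  case 0 then show ?case by (simp add: low_degree_0_iff)
next
  case (Suc N)
  obtain c where "q - smult (coeff q N) (orth N) = (\<Sum>k<N. smult (c k) (orth k))"
    using Suc.IH[OF low_degree_Suc_reduce[OF Suc.prems low_degree_orth coeff_orth]] by blast
  then have "q = (\<Sum>k<Suc N. smult ((c(N := coeff q N)) k) (orth k))"
    by (simp add: algebra_simps)
  then show ?case by blast
qed

lemma orth_expansion:
  assumes "low_degree N q"
  shows "q = (\<Sum>k<N. smult (poly_inner q (orth k) / poly_inner (orth k) (orth k)) (orth k))"
proof -
  obtain c where c: "q = (\<Sum>k<N. smult (c k) (orth k))" using orth_span[OF assms] by blast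
  have "poly_inner (orth k) q = c k * poly_inner (orth k) (orth k)" if "k < N" for k
  proof -
    have "poly_inner (orth k) q = (\<Sum>j<N. c j * poly_inner (orth k) (orth j))"
      by (simp add: c poly_inner_sum_right poly_inner_smult_right)
    also have "\<dots> = (\<Sum>j<N. if j = k then c k * poly_inner (orth k) (orth k) else 0)"
      by (intro sum.cong) (auto simp: orth_orthogonal)
    finally show ?thesis using that by simp
  qed
  then have "(\<Sum>k<N. smult (poly_inner q (orth k) / poly_inner (orth k) (orth k)) (orth k)) = (\<Sum>k<N. smult (c k) (orth k))"
    by (intro sum.cong) (use orth_norm_pos in \<open>auto simp: poly_inner_commute[of q] less_imp_neq[THEN not_sym]\<close>)
  then show ?thesis using c by simp
qed

lemma orth_low_degree_orthogonal: assumes "low_degree k r" shows "poly_inner (orth k) r = 0"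
proof -
  have "poly_inner (orth k) r = poly_inner (orth k) (\<Sum>j<k. smult (poly_inner r (orth j) / poly_inner (orth j) (orth j)) (orth j))"
    using orth_expansion[OF assms] by simp
  also have "\<dots> = 0" by (simp add: poly_inner_sum_right poly_inner_smult_right orth_orthogonal)
  finally show ?thesis .
qed

lemma conv_orth_low_degree: assumes "low_degree k r" shows "conv (orth k) r = 0"
proof (rule poly_inner_self_0)
  have "low_degree k (conv r (conv (orth k) r))" by (rule low_degree_conv'[OF assms])
  then show "poly_inner (conv (orth k) r) (conv (orth k) r) = 0"
    by (simp add: poly_inner_assoc orth_low_degree_orthogonal)
qed

definition eig :: "real poly \<Rightarrow> nat \<Rightarrow> real" where
  "eig f k = coeff (conv f (orth k)) k"

text \<open>The part of degree below \<open>k\<close> of the convolution is orthogonal to itself: by self-adjointness it is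
  paired with a polynomial of degree below \<open>k\<close>, to which \<open>orth k\<close> is orthogonal.\<close>
lemma conv_orth: "conv f (orth k) = smult (eig f k) (orth k)"
proof -
  define r where "r = conv f (orth k) - smult (eig f k) (orth k)"
  have r: "low_degree k r"
    unfolding r_def eig_def by (rule low_degree_Suc_reduce[OF low_degree_conv[OF low_degree_orth] low_degree_orth coeff_orth])
  have "poly_inner r r = poly_inner (conv f (orth k)) r - eig f k * poly_inner (orth k) r"
    using arg_cong[OF r_def, of "\<lambda>q. poly_inner q r"] by (simp add: poly_inner_diff_left poly_inner_smult_left)
  also have "\<dots> = 0"
    using r by (simp add: poly_inner_assoc conv_orth_low_degree orth_low_degree_orthogonal) (simp add: poly_inner_def)
  finally show ?thesis using poly_inner_self_0[of r] by (simp add: r_def)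
qed

lemma eig_orth: "eig (orth k) k = tau k"
  by (simp add: eig_def coeff_conv low_degree_orth coeff_orth)

lemma orth_norm: "poly_inner (orth k) (orth k) = tau k * poly (orth k) 1"
  by (simp add: poly_inner_eq conv_orth eig_orth)

lemma orth_1_pos: "0 < poly (orth k) 1"
  using orth_norm_pos[of k] tau_pos[of k] by (simp add: orth_norm zero_less_mult_iff)

lemma poly_inner_orth: "poly_inner f (orth k) = eig f k * poly (orth k) 1"
  by (simp add: poly_inner_eq conv_orth)

text \<open>Up to the factor \<open>tau k\<close>, \<open>orth k\<close> is its own convolution square, that is, a correlation function;
  by the Cauchy--Schwarz inequality it is largest at coinciding points.\<close>
lemma orth_abs_le:
  assumes "- 1 \<le> t" "t \<le> 1" shows "\<bar>poly (orth k) t\<bar> \<le> poly (orth k) 1"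
proof -
  obtain y where y: "y \<in> unit_sphere n" "dot n e0 y = t" using zonal_point[OF assms] .
  note e = e_sphere(1)
  let ?p = "poly (orth k)"
  have sq: "(\<integral>z. (?p (dot n x z))\<^sup>2 \<partial>\<sigma>) = tau k * ?p 1" if "x \<in> unit_sphere n" for x
    using poly_inner_conv[OF that, of "orth k" "orth k"]
    by (simp add: orth_norm power2_eq_square dot_commute[of n _ x])
  have int: "integrable \<sigma> (\<lambda>z. (?p (dot n x z))\<^sup>2)" if "x \<in> unit_sphere n" for x
    using integrable_conv[OF that that, of "orth k" "orth k"] by (simp add: power2_eq_square dot_commute[of n _ x])
  have prod: "tau k * ?p t = (\<integral>z. ?p (dot n e0 z) * ?p (dot n y z) \<partial>\<sigma>)"
    using poly_conv[OF e y(1), of "orth k" "orth k"] y(2) by (simp add: conv_orth eig_orth dot_commute[of n _ y])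
  have "(tau k * ?p t)\<^sup>2 \<le> (tau k * ?p 1) * (tau k * ?p 1)"
    using integral_Cauchy_Schwarz[OF int[OF e] int[OF y(1)]] integrable_conv[OF e y(1), of "orth k" "orth k"]
    by (simp add: prod sq[OF e] sq[OF y(1)] dot_commute[of n _ y])
  then have "\<bar>tau k * ?p t\<bar> \<le> \<bar>tau k * ?p 1\<bar>" by (simp only: power2_eq_square[symmetric] abs_le_square_iff)
  then show ?thesis using tau_pos[of k] orth_1_pos[of k] by (simp add: abs_mult)
qed

end

section \<open>Kernel energies and symmetrization\<close>

context sphere_measure
begin

definition bounded_meas :: "((nat \<Rightarrow> real) \<Rightarrow> real) \<Rightarrow> bool" where
  "bounded_meas g \<longleftrightarrow> g \<in> borel_measurable \<sigma> \<and> (\<exists>C. \<forall>x\<in>unit_sphere n. \<bar>g x\<bar> \<le> C)"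

definition kernel :: "((nat \<Rightarrow> real) \<Rightarrow> (nat \<Rightarrow> real) \<Rightarrow> real) \<Rightarrow> bool" where
  "kernel \<kappa> \<longleftrightarrow> (\<lambda>p. \<kappa> (fst p) (snd p)) \<in> borel_measurable (\<sigma> \<Otimes>\<^sub>M \<sigma>) \<and>
     (\<exists>C. \<forall>x\<in>unit_sphere n. \<forall>y\<in>unit_sphere n. \<bar>\<kappa> x y\<bar> \<le> C)"

definition kernel_op :: "((nat \<Rightarrow> real) \<Rightarrow> (nat \<Rightarrow> real) \<Rightarrow> real) \<Rightarrow> ((nat \<Rightarrow> real) \<Rightarrow> real) \<Rightarrow> (nat \<Rightarrow> real) \<Rightarrow> real" where
  "kernel_op \<kappa> g x = (\<integral>y. \<kappa> x y * g y \<partial>\<sigma>)"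

definition energy :: "((nat \<Rightarrow> real) \<Rightarrow> (nat \<Rightarrow> real) \<Rightarrow> real) \<Rightarrow> ((nat \<Rightarrow> real) \<Rightarrow> real) \<Rightarrow> real" where
  "energy \<kappa> g = (\<integral>x. g x * kernel_op \<kappa> g x \<partial>\<sigma>)"

lemma bounded_measD: "bounded_meas g \<Longrightarrow> g \<in> borel_measurable \<sigma>"
  by (simp add: bounded_meas_def)

lemma bounded_meas_bound: assumes "bounded_meas g" shows "\<exists>C\<ge>0. \<forall>x\<in>unit_sphere n. \<bar>g x\<bar> \<le> C"
proof -
  obtain C where "\<forall>x\<in>unit_sphere n. \<bar>g x\<bar> \<le> C" using assms unfolding bounded_meas_def by blast
  then show ?thesis by (intro exI[of _ "max 0 C"]) (simp add: le_max_iff_disj)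
qed

lemma kernel_bound: assumes "kernel \<kappa>"
  shows "\<exists>C\<ge>0. \<forall>x\<in>unit_sphere n. \<forall>y\<in>unit_sphere n. \<bar>\<kappa> x y\<bar> \<le> C"
proof -
  obtain C where "\<forall>x\<in>unit_sphere n. \<forall>y\<in>unit_sphere n. \<bar>\<kappa> x y\<bar> \<le> C" using assms unfolding kernel_def by blast
  then show ?thesis by (intro exI[of _ "max 0 C"]) (simp add: le_max_iff_disj)
qed

lemma integrable_bounded_meas: "bounded_meas g \<Longrightarrow> integrable \<sigma> g"
  by (metis bounded_meas_def integrable_sphere)

lemma bounded_measI: "g \<in> borel_measurable \<sigma> \<Longrightarrow> (\<And>x. x \<in> unit_sphere n \<Longrightarrow> \<bar>g x\<bar> \<le> C) \<Longrightarrow> bounded_meas g"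
  unfolding bounded_meas_def by blast

lemma bounded_meas_add: assumes "bounded_meas f" "bounded_meas g" shows "bounded_meas (\<lambda>x. f x + g x)"
proof -
  obtain C where C0: "0 \<le> C" "\<forall>x\<in>unit_sphere n. \<bar>f x\<bar> \<le> C" using bounded_meas_bound[OF assms(1)] by blast
  then have C: "\<And>x. x \<in> unit_sphere n \<Longrightarrow> \<bar>f x\<bar> \<le> C" by auto
  obtain D where D0: "0 \<le> D" "\<forall>x\<in>unit_sphere n. \<bar>g x\<bar> \<le> D" using bounded_meas_bound[OF assms(2)] by blast
  then have D: "\<And>x. x \<in> unit_sphere n \<Longrightarrow> \<bar>g x\<bar> \<le> D" by auto
  show ?thesis
  proof (rule bounded_measI)
    show "(\<lambda>x. f x + g x) \<in> borel_measurable \<sigma>"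
      using assms[THEN bounded_measD] by (rule borel_measurable_add)
    show "\<bar>f x + g x\<bar> \<le> C + D" if "x \<in> unit_sphere n" for x
      using C[OF that] D[OF that] by linarith
  qed
qed

lemma bounded_meas_mult: assumes "bounded_meas f" "bounded_meas g" shows "bounded_meas (\<lambda>x. f x * g x)"
proof -
  obtain C where C0: "0 \<le> C" "\<forall>x\<in>unit_sphere n. \<bar>f x\<bar> \<le> C" using bounded_meas_bound[OF assms(1)] by blast
  then have C: "0 \<le> C" "\<And>x. x \<in> unit_sphere n \<Longrightarrow> \<bar>f x\<bar> \<le> C" by auto
  obtain D where D0: "0 \<le> D" "\<forall>x\<in>unit_sphere n. \<bar>g x\<bar> \<le> D" using bounded_meas_bound[OF assms(2)] by blast
  then have D: "\<And>x. x \<in> unit_sphere n \<Longrightarrow> \<bar>g x\<bar> \<le> D" by auto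
  show ?thesis
  proof (rule bounded_measI)
    show "(\<lambda>x. f x * g x) \<in> borel_measurable \<sigma>"
      using assms[THEN bounded_measD] by (rule borel_measurable_times)
    show "\<bar>f x * g x\<bar> \<le> C * D" if "x \<in> unit_sphere n" for x
      unfolding abs_mult using C(2)[OF that] D[OF that] C(1) by (intro mult_mono) auto
  qed
qed

lemma bounded_meas_const: "bounded_meas (\<lambda>_. c)"
  by (rule bounded_measI[of _ "\<bar>c\<bar>"]) auto

lemma bounded_meas_cmult: "bounded_meas g \<Longrightarrow> bounded_meas (\<lambda>x. c * g x)"
  by (rule bounded_meas_mult[OF bounded_meas_const])

lemma bounded_meas_coord: "bounded_meas (\<lambda>x. x i)"
proof (rule bounded_measI)
  show "\<bar>x i\<bar> \<le> 1" if "x \<in> unit_sphere n" for x using sphere_coord_le[OF that] .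
qed measurable

lemma bounded_meas_reflection:
  assumes u: "u \<in> unit_sphere n" and g: "bounded_meas g" shows "bounded_meas (\<lambda>x. g (reflection n u x))"
proof -
  obtain C where C0: "0 \<le> C" "\<forall>x\<in>unit_sphere n. \<bar>g x\<bar> \<le> C" using bounded_meas_bound[OF g] by blast
  then have C: "\<And>x. x \<in> unit_sphere n \<Longrightarrow> \<bar>g x\<bar> \<le> C" by auto
  show ?thesis
    by (rule bounded_measI[of _ C])
       (use measurable_compose[OF reflection_measurable[OF u] bounded_measD[OF g]] C reflection_sphere[OF u] in auto)
qed

lemma kernelI: "(\<lambda>p. \<kappa> (fst p) (snd p)) \<in> borel_measurable (\<sigma> \<Otimes>\<^sub>M \<sigma>) \<Longrightarrow>
    (\<And>x y. x \<in> unit_sphere n \<Longrightarrow> y \<in> unit_sphere n \<Longrightarrow> \<bar>\<kappa> x y\<bar> \<le> C) \<Longrightarrow> kernel \<kappa>"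
  unfolding kernel_def by blast

lemma kernel_measD: "kernel \<kappa> \<Longrightarrow> case_prod \<kappa> \<in> borel_measurable (\<sigma> \<Otimes>\<^sub>M \<sigma>)"
  by (simp add: kernel_def case_prod_unfold)

lemma kernel_section:
  assumes k: "kernel \<kappa>" and x: "x \<in> unit_sphere n" shows "bounded_meas (\<kappa> x)"
proof -
  obtain C where C0: "0 \<le> C" "\<forall>x\<in>unit_sphere n. \<forall>y\<in>unit_sphere n. \<bar>\<kappa> x y\<bar> \<le> C" using kernel_bound[OF k] by blast
  then have C: "\<And>x y. x \<in> unit_sphere n \<Longrightarrow> y \<in> unit_sphere n \<Longrightarrow> \<bar>\<kappa> x y\<bar> \<le> C" by auto
  have "(\<lambda>y. case_prod \<kappa> (x, y)) \<in> borel_measurable \<sigma>"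
    by (rule measurable_compose[OF measurable_Pair1' kernel_measD[OF k]]) (simp add: space_\<sigma> x)
  then show ?thesis using C[OF x] by (intro bounded_measI[of _ C]) simp_all
qed

lemma integrable_kernel:
  "kernel \<kappa> \<Longrightarrow> bounded_meas g \<Longrightarrow> x \<in> unit_sphere n \<Longrightarrow> integrable \<sigma> (\<lambda>y. \<kappa> x y * g y)"
  using integrable_bounded_meas[OF bounded_meas_mult[OF kernel_section]] .

lemma bounded_meas_kernel_op:
  assumes k: "kernel \<kappa>" and g: "bounded_meas g" shows "bounded_meas (kernel_op \<kappa> g)"
proof -
  obtain C where C0: "0 \<le> C" "\<forall>x\<in>unit_sphere n. \<forall>y\<in>unit_sphere n. \<bar>\<kappa> x y\<bar> \<le> C" using kernel_bound[OF k] by blast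
  then have C: "0 \<le> C" "\<And>x y. x \<in> unit_sphere n \<Longrightarrow> y \<in> unit_sphere n \<Longrightarrow> \<bar>\<kappa> x y\<bar> \<le> C" by auto
  obtain D where D0: "0 \<le> D" "\<forall>x\<in>unit_sphere n. \<bar>g x\<bar> \<le> D" using bounded_meas_bound[OF g] by blast
  then have D: "\<And>x. x \<in> unit_sphere n \<Longrightarrow> \<bar>g x\<bar> \<le> D" by auto
  note [measurable] = kernel_measD[OF k] bounded_measD[OF g]
  show ?thesis
  proof (rule bounded_measI)
    show "kernel_op \<kappa> g \<in> borel_measurable \<sigma>" unfolding kernel_op_def by measurable
    show "\<bar>kernel_op \<kappa> g x\<bar> \<le> C * D" if x: "x \<in> unit_sphere n" for x
      unfolding kernel_op_def
    proof (rule integral_sphere_abs_le)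
      show "(\<lambda>y. \<kappa> x y * g y) \<in> borel_measurable \<sigma>"
        by (rule borel_measurable_times[OF bounded_measD[OF kernel_section[OF k x]] bounded_measD[OF g]])
      show "\<bar>\<kappa> x y * g y\<bar> \<le> C * D" if "y \<in> unit_sphere n" for y
        unfolding abs_mult using C(2)[OF x that] D[OF that] C(1) by (intro mult_mono) auto
    qed
  qed
qed

lemma integrable_energy: "kernel \<kappa> \<Longrightarrow> bounded_meas f \<Longrightarrow> bounded_meas g \<Longrightarrow> integrable \<sigma> (\<lambda>x. f x * kernel_op \<kappa> g x)"
  using integrable_bounded_meas[OF bounded_meas_mult[OF _ bounded_meas_kernel_op]] .

lemma kernel_cmult: assumes k: "kernel \<kappa>" shows "kernel (\<lambda>x y. c * \<kappa> x y)"
proof -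
  obtain C where C0: "0 \<le> C" "\<forall>x\<in>unit_sphere n. \<forall>y\<in>unit_sphere n. \<bar>\<kappa> x y\<bar> \<le> C" using kernel_bound[OF k] by blast
  then have C: "\<And>x y. x \<in> unit_sphere n \<Longrightarrow> y \<in> unit_sphere n \<Longrightarrow> \<bar>\<kappa> x y\<bar> \<le> C" by auto
  show ?thesis
  proof (rule kernelI)
    show "(\<lambda>p. c * \<kappa> (fst p) (snd p)) \<in> borel_measurable (\<sigma> \<Otimes>\<^sub>M \<sigma>)"
      using k unfolding kernel_def by (intro borel_measurable_times borel_measurable_const) auto
    show "\<bar>c * \<kappa> x y\<bar> \<le> \<bar>c\<bar> * C" if "x \<in> unit_sphere n" "y \<in> unit_sphere n" for x y
      unfolding abs_mult using C[OF that] by (intro mult_left_mono) auto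
  qed
qed

lemma kernel_add: assumes "kernel \<kappa>" "kernel \<kappa>'" shows "kernel (\<lambda>x y. \<kappa> x y + \<kappa>' x y)"
proof -
  obtain C where C0: "0 \<le> C" "\<forall>x\<in>unit_sphere n. \<forall>y\<in>unit_sphere n. \<bar>\<kappa> x y\<bar> \<le> C" using kernel_bound[OF assms(1)] by blast
  then have C: "\<And>x y. x \<in> unit_sphere n \<Longrightarrow> y \<in> unit_sphere n \<Longrightarrow> \<bar>\<kappa> x y\<bar> \<le> C" by auto
  obtain D where D0: "0 \<le> D" "\<forall>x\<in>unit_sphere n. \<forall>y\<in>unit_sphere n. \<bar>\<kappa>' x y\<bar> \<le> D" using kernel_bound[OF assms(2)] by blast
  then have D: "\<And>x y. x \<in> unit_sphere n \<Longrightarrow> y \<in> unit_sphere n \<Longrightarrow> \<bar>\<kappa>' x y\<bar> \<le> D" by auto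
  show ?thesis
  proof (rule kernelI)
    show "(\<lambda>p. \<kappa> (fst p) (snd p) + \<kappa>' (fst p) (snd p)) \<in> borel_measurable (\<sigma> \<Otimes>\<^sub>M \<sigma>)"
      using assms unfolding kernel_def by (intro borel_measurable_add) auto
    show "\<bar>\<kappa> x y + \<kappa>' x y\<bar> \<le> C + D" if "x \<in> unit_sphere n" "y \<in> unit_sphere n" for x y
      using C[OF that] D[OF that] by linarith
  qed
qed

lemma kernel_op_add: "kernel \<kappa> \<Longrightarrow> kernel \<kappa>' \<Longrightarrow> bounded_meas g \<Longrightarrow> x \<in> unit_sphere n \<Longrightarrow>
    kernel_op (\<lambda>x y. \<kappa> x y + \<kappa>' x y) g x = kernel_op \<kappa> g x + kernel_op \<kappa>' g x"
  by (simp add: kernel_op_def distrib_right integrable_kernel)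

lemma kernel_op_cmult: "kernel_op (\<lambda>x y. c * \<kappa> x y) g x = c * kernel_op \<kappa> g x"
  by (simp add: kernel_op_def mult.assoc)

lemma energy_cmult: "energy (\<lambda>x y. c * \<kappa> x y) g = c * energy \<kappa> g"
  by (simp add: energy_def kernel_op_cmult mult.left_commute)

lemma energy_add:
  assumes "kernel \<kappa>" "kernel \<kappa>'" "bounded_meas g"
  shows "energy (\<lambda>x y. \<kappa> x y + \<kappa>' x y) g = energy \<kappa> g + energy \<kappa>' g"
proof -
  have "energy (\<lambda>x y. \<kappa> x y + \<kappa>' x y) g = (\<integral>x. g x * kernel_op \<kappa> g x + g x * kernel_op \<kappa>' g x \<partial>\<sigma>)"
    unfolding energy_def
    by (intro Bochner_Integration.integral_cong refl) (simp add: kernel_op_add[OF assms] space_\<sigma> distrib_left)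
  then show ?thesis using assms by (simp add: energy_def integrable_energy)
qed

lemma kernel_0: "kernel (\<lambda>x y. 0)"
  by (rule kernelI[of _ 0]) auto

lemma kernel_sum:
  "finite S \<Longrightarrow> (\<And>k. k \<in> S \<Longrightarrow> kernel (\<kappa> k)) \<Longrightarrow> kernel (\<lambda>x y. \<Sum>k\<in>S. \<kappa> k x y)"
  by (induction S rule: finite_induct) (auto intro: kernel_add kernel_0)

lemma energy_sum:
  "finite S \<Longrightarrow> (\<And>k. k \<in> S \<Longrightarrow> kernel (\<kappa> k)) \<Longrightarrow> bounded_meas g \<Longrightarrow>
    energy (\<lambda>x y. \<Sum>k\<in>S. \<kappa> k x y) g = (\<Sum>k\<in>S. energy (\<kappa> k) g)"
proof (induction S rule: finite_induct)
  case empty then show ?case by (simp add: energy_def kernel_op_def)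
next
  case (insert k S)
  then show ?case by (simp add: energy_add kernel_sum)
qed

lemma kernel_op_sum:
  "finite S \<Longrightarrow> (\<And>k. k \<in> S \<Longrightarrow> kernel (\<kappa> k)) \<Longrightarrow> bounded_meas g \<Longrightarrow> x \<in> unit_sphere n \<Longrightarrow>
    kernel_op (\<lambda>x y. \<Sum>k\<in>S. \<kappa> k x y) g x = (\<Sum>k\<in>S. kernel_op (\<kappa> k) g x)"
proof (induction S rule: finite_induct)
  case empty then show ?case by (simp add: kernel_op_def)
next
  case (insert k S)
  then show ?case by (simp add: kernel_op_add kernel_sum)
qed

lemma energy_cong:
  assumes "\<And>x y. x \<in> unit_sphere n \<Longrightarrow> y \<in> unit_sphere n \<Longrightarrow> \<kappa> x y = \<kappa>' x y"
  shows "energy \<kappa> g = energy \<kappa>' g"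
  unfolding energy_def kernel_op_def using assms
  by (intro Bochner_Integration.integral_cong refl arg_cong2[of _ _ _ _ "(*)"]) (auto simp: space_\<sigma>)

lemma kernel_poly: "kernel (\<lambda>x y. poly p (dot n x y))"
  by (rule kernelI[of _ "poly_bound p"]) (auto intro: poly_kernel_le)

abbreviation poly_energy :: "real poly \<Rightarrow> ((nat \<Rightarrow> real) \<Rightarrow> real) \<Rightarrow> real" where
  "poly_energy p g \<equiv> energy (\<lambda>x y. poly p (dot n x y)) g"

abbreviation poly_op :: "real poly \<Rightarrow> ((nat \<Rightarrow> real) \<Rightarrow> real) \<Rightarrow> (nat \<Rightarrow> real) \<Rightarrow> real" where
  "poly_op p g x \<equiv> kernel_op (\<lambda>x y. poly p (dot n x y)) g x"

text \<open>The kernel \<open><x, y>\<^sup>N\<close> is a Gram kernel, of the tensor powers of the points; peeling off one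
  tensor factor gives the induction.\<close>
lemma energy_power_nonneg: "bounded_meas g \<Longrightarrow> 0 \<le> energy (\<lambda>x y. dot n x y ^ N) g"
proof (induction N arbitrary: g)
  case 0
  then show ?case by (simp add: energy_def kernel_op_def)
next
  case (Suc N)
  have k: "kernel (\<lambda>x y. dot n x y ^ N)" using kernel_poly[of "monom 1 N"] by (simp add: poly_monom)
  have ki: "kernel (\<lambda>x y. x i * y i * dot n x y ^ N)" for i
  proof (rule kernelI)
    show "\<bar>x i * y i * dot n x y ^ N\<bar> \<le> 1" if "x \<in> unit_sphere n" "y \<in> unit_sphere n" for x y
      by (intro abs_mult_le_1 abs_power_le_1 sphere_coord_le[OF that(1)] sphere_coord_le[OF that(2)] sphere_dot_le[OF that])
  qed measurable
  have "energy (\<lambda>x y. dot n x y ^ Suc N) g = energy (\<lambda>x y. \<Sum>i<n. x i * y i * dot n x y ^ N) g"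
    by (simp add: dot_def sum_distrib_right[symmetric])
  also have "\<dots> = (\<Sum>i<n. energy (\<lambda>x y. x i * y i * dot n x y ^ N) g)"
    by (rule energy_sum) (use ki Suc.prems in auto)
  also have "\<dots> = (\<Sum>i<n. energy (\<lambda>x y. dot n x y ^ N) (\<lambda>x. x i * g x))"
  proof (rule sum.cong[OF refl])
    fix i
    have "kernel_op (\<lambda>x y. x i * y i * dot n x y ^ N) g x = x i * kernel_op (\<lambda>x y. dot n x y ^ N) (\<lambda>y. y i * g y) x" for x
      unfolding kernel_op_def by (subst integral_mult_right_zero[symmetric]) (simp add: mult_ac)
    then show "energy (\<lambda>x y. x i * y i * dot n x y ^ N) g = energy (\<lambda>x y. dot n x y ^ N) (\<lambda>x. x i * g x)"
      by (simp add: energy_def mult_ac)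
  qed
  also have "\<dots> \<ge> 0"
    by (intro sum_nonneg Suc.IH bounded_meas_mult bounded_meas_coord Suc.prems)
  finally show ?case .
qed

text \<open>Up to the factor \<open>tau k\<close>, the orthogonal kernel is its own square, so that its energy is a
  square norm and the Cauchy--Schwarz inequality bounds the values of the operator.\<close>
lemma poly_op_orth_bound:
  assumes g: "bounded_meas g" and x: "x \<in> unit_sphere n"
  shows "(poly_op (orth k) g x)\<^sup>2 \<le> poly (orth k) 1 * poly_energy (orth k) g"
    and poly_energy_orth_nonneg: "0 \<le> poly_energy (orth k) g"
proof -
  let ?p = "poly (orth k)"
  let ?G = "poly_op (orth k) g"
  obtain C where C0: "0 \<le> C" "\<forall>x\<in>unit_sphere n. \<bar>g x\<bar> \<le> C" using bounded_meas_bound[OF g] by blast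
  then have C: "0 \<le> C" "\<And>x. x \<in> unit_sphere n \<Longrightarrow> \<bar>g x\<bar> \<le> C" by auto
  note [measurable] = bounded_measD[OF g]
  have p_le: "\<bar>?p (dot n x y)\<bar> \<le> poly_bound (orth k)" if "x \<in> unit_sphere n" "y \<in> unit_sphere n" for x y
    by (rule poly_kernel_le[OF that])
  have square: "tau k * ?G x = (\<integral>z. ?p (dot n x z) * ?G z \<partial>\<sigma>)" if x: "x \<in> unit_sphere n" for x
  proof -
    have [measurable]: "(\<lambda>_. x) \<in> measurable N \<sigma>" for N :: "'a measure" by (rule const_measurable[OF x])
    have "tau k * ?G x = (\<integral>y. (\<integral>z. ?p (dot n x z) * ?p (dot n z y) * g y \<partial>\<sigma>) \<partial>\<sigma>)"
    proof -
      have "tau k * ?p (dot n x y) * g y = (\<integral>z. ?p (dot n x z) * ?p (dot n z y) * g y \<partial>\<sigma>)" if "y \<in> unit_sphere n" for y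
        using poly_conv[OF x that, of "orth k" "orth k"] integrable_conv[OF x that, of "orth k" "orth k"]
        by (simp add: conv_orth eig_orth)
      then have "(\<integral>y. tau k * ?p (dot n x y) * g y \<partial>\<sigma>) = (\<integral>y. (\<integral>z. ?p (dot n x z) * ?p (dot n z y) * g y \<partial>\<sigma>) \<partial>\<sigma>)"
        by (intro Bochner_Integration.integral_cong refl) (simp add: space_\<sigma>)
      then show ?thesis by (simp add: kernel_op_def mult.assoc)
    qed
    also have "\<dots> = (\<integral>z. (\<integral>y. ?p (dot n x z) * ?p (dot n z y) * g y \<partial>\<sigma>) \<partial>\<sigma>)"
    proof (rule bounded_Fubini[OF prob_space_axioms prob_space_axioms, where C = "poly_bound (orth k) * poly_bound (orth k) * C"])
      show "\<bar>?p (dot n x z) * ?p (dot n z y) * g y\<bar> \<le> poly_bound (orth k) * poly_bound (orth k) * C"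
        if "y \<in> space \<sigma>" "z \<in> space \<sigma>" for y z
        using that x C unfolding abs_mult space_\<sigma>
        by (intro mult_mono p_le mult_nonneg_nonneg poly_bound_nonneg) auto
    qed measurable
    finally show ?thesis by (simp add: kernel_op_def mult.assoc)
  qed
  have intG: "bounded_meas ?G" by (rule bounded_meas_kernel_op[OF kernel_poly g])
  have en: "tau k * poly_energy (orth k) g = (\<integral>z. (?G z)\<^sup>2 \<partial>\<sigma>)"
  proof -
    obtain D where D0: "0 \<le> D" "\<forall>x\<in>unit_sphere n. \<bar>?G x\<bar> \<le> D" using bounded_meas_bound[OF intG] by blast
  then have D: "0 \<le> D" "\<And>x. x \<in> unit_sphere n \<Longrightarrow> \<bar>?G x\<bar> \<le> D" by auto
    note [measurable] = bounded_measD[OF intG]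
    have "tau k * poly_energy (orth k) g = (\<integral>x. g x * (tau k * ?G x) \<partial>\<sigma>)"
      unfolding energy_def integral_mult_right_zero[symmetric] by (simp only: mult.left_commute)
    also have "\<dots> = (\<integral>x. (\<integral>z. g x * (?p (dot n x z) * ?G z) \<partial>\<sigma>) \<partial>\<sigma>)"
      by (intro Bochner_Integration.integral_cong refl) (simp add: square space_\<sigma>)
    also have "\<dots> = (\<integral>z. (\<integral>x. g x * (?p (dot n x z) * ?G z) \<partial>\<sigma>) \<partial>\<sigma>)"
    proof (rule bounded_Fubini[OF prob_space_axioms prob_space_axioms, where C = "C * (poly_bound (orth k) * D)"])
      show "\<bar>g y * (?p (dot n y z) * ?G z)\<bar> \<le> C * (poly_bound (orth k) * D)"
        if "y \<in> space \<sigma>" "z \<in> space \<sigma>" for y z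
        using that C D unfolding abs_mult space_\<sigma>
        by (intro mult_mono p_le mult_nonneg_nonneg poly_bound_nonneg) auto
    qed measurable
    also have "\<dots> = (\<integral>z. (?G z)\<^sup>2 \<partial>\<sigma>)"
    proof (intro Bochner_Integration.integral_cong refl)
      fix z
      have "(\<integral>x. g x * (?p (dot n x z) * ?G z) \<partial>\<sigma>) = (\<integral>x. ?G z * (?p (dot n z x) * g x) \<partial>\<sigma>)"
        by (intro Bochner_Integration.integral_cong refl) (simp add: dot_commute[of n z])
      also have "\<dots> = ?G z * ?G z" by (simp add: kernel_op_def)
      finally show "(\<integral>x. g x * (?p (dot n x z) * ?G z) \<partial>\<sigma>) = (?G z)\<^sup>2" by (simp add: power2_eq_square)
    qed
    finally show ?thesis .
  qed
  have "0 \<le> tau k * poly_energy (orth k) g"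
    unfolding en by (rule Bochner_Integration.integral_nonneg) simp
  then show "0 \<le> poly_energy (orth k) g" using tau_pos[of k] by (simp add: zero_le_mult_iff)
  have sq_p: "(\<integral>z. (?p (dot n x z))\<^sup>2 \<partial>\<sigma>) = tau k * ?p 1"
    using poly_inner_conv[OF x, of "orth k" "orth k"]
    by (simp add: orth_norm power2_eq_square dot_commute[of n _ x])
  have bp: "bounded_meas (\<lambda>z. ?p (dot n x z))" using kernel_section[OF kernel_poly x] .
  have "(tau k * ?G x)\<^sup>2 \<le> (tau k * ?p 1) * (tau k * poly_energy (orth k) g)"
    unfolding square[OF x] en sq_p[symmetric]
  proof (rule integral_Cauchy_Schwarz)
    show "integrable \<sigma> (\<lambda>z. (?p (dot n x z))\<^sup>2)" "integrable \<sigma> (\<lambda>z. (?G z)\<^sup>2)"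
      "integrable \<sigma> (\<lambda>z. ?p (dot n x z) * ?G z)"
      unfolding power2_eq_square
      by (rule integrable_bounded_meas[OF bounded_meas_mult[OF bp bp]]
          integrable_bounded_meas[OF bounded_meas_mult[OF intG intG]]
          integrable_bounded_meas[OF bounded_meas_mult[OF bp intG]])+
  qed
  then have "(tau k)\<^sup>2 * (?G x)\<^sup>2 \<le> (tau k)\<^sup>2 * (?p 1 * poly_energy (orth k) g)"
    by (simp add: power_mult_distrib power2_eq_square mult_ac)
  then show "(?G x)\<^sup>2 \<le> ?p 1 * poly_energy (orth k) g" using tau_pos[of k] by simp
qed

subsection \<open>One symmetrization\<close>

definition sym_fun :: "(nat \<Rightarrow> real) \<Rightarrow> ((nat \<Rightarrow> real) \<Rightarrow> real) \<Rightarrow> (nat \<Rightarrow> real) \<Rightarrow> real" where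
  "sym_fun u g x = (g x + g (reflection n u x)) / 2"

lemma bounded_meas_sym_fun: "u \<in> unit_sphere n \<Longrightarrow> bounded_meas g \<Longrightarrow> bounded_meas (sym_fun u g)"
proof -
  assume "u \<in> unit_sphere n" "bounded_meas g"
  then have "bounded_meas (\<lambda>x. (1/2) * (g x + g (reflection n u x)))"
    by (intro bounded_meas_cmult bounded_meas_add bounded_meas_reflection)
  then show ?thesis by (simp add: sym_fun_def[abs_def])
qed

text \<open>Of the four terms of the quadratic form, the two diagonal and the two mixed ones agree by invariance.\<close>
lemma energy_sym_fun:
  assumes u: "u \<in> unit_sphere n" and k: "kernel \<kappa>" and g: "bounded_meas g"
    and inv: "\<And>x y. x \<in> unit_sphere n \<Longrightarrow> y \<in> unit_sphere n \<Longrightarrow> \<kappa> (reflection n u x) (reflection n u y) = \<kappa> x y"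
  shows "energy \<kappa> (sym_fun u g) = (energy \<kappa> g + energy (\<lambda>x y. \<kappa> x (reflection n u y)) g) / 2"
proof -
  let ?r = "reflection n u" and ?T = "kernel_op \<kappa>"
  define h where "h = (\<lambda>x. g (?r x))"
  have h: "bounded_meas h" unfolding h_def by (rule bounded_meas_reflection[OF u g])
  have shift: "?T h x = ?T g (?r x)" if x: "x \<in> unit_sphere n" for x
  proof -
    have "?T g (?r x) = (\<integral>y. \<kappa> (?r x) (?r y) * g (?r y) \<partial>\<sigma>)" unfolding kernel_op_def
      by (rule integral_reflection[OF u, where F = "\<lambda>y. \<kappa> (?r x) y * g y", symmetric])
         (rule bounded_measD[OF bounded_meas_mult[OF kernel_section[OF k reflection_sphere[OF u x]] g]])
    also have "\<dots> = ?T h x" unfolding kernel_op_def h_def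
      by (intro Bochner_Integration.integral_cong refl) (simp add: inv[OF x] space_\<sigma>)
    finally show ?thesis ..
  qed
  have hh: "(\<integral>x. h x * ?T h x \<partial>\<sigma>) = energy \<kappa> g"
  proof -
    have "(\<integral>x. h x * ?T h x \<partial>\<sigma>) = (\<integral>x. g (?r x) * ?T g (?r x) \<partial>\<sigma>)"
      by (intro Bochner_Integration.integral_cong refl) (simp add: shift space_\<sigma>, simp add: h_def)
    also have "\<dots> = energy \<kappa> g" unfolding energy_def
      by (rule integral_reflection[OF u, where F = "\<lambda>x. g x * ?T g x"])
         (rule bounded_measD[OF bounded_meas_mult[OF g bounded_meas_kernel_op[OF k g]]])
    finally show ?thesis .
  qed
  have hg: "(\<integral>x. h x * ?T g x \<partial>\<sigma>) = (\<integral>x. g x * ?T h x \<partial>\<sigma>)"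
  proof -
    have "(\<integral>x. h x * ?T g x \<partial>\<sigma>) = (\<integral>x. h (?r x) * ?T g (?r x) \<partial>\<sigma>)"
      by (rule integral_reflection[OF u, where F = "\<lambda>x. h x * ?T g x", symmetric])
         (rule bounded_measD[OF bounded_meas_mult[OF h bounded_meas_kernel_op[OF k g]]])
    also have "\<dots> = (\<integral>x. g x * ?T h x \<partial>\<sigma>)"
      by (intro Bochner_Integration.integral_cong refl) (simp add: shift space_\<sigma>, simp add: h_def reflection_involution[OF u])
    finally show ?thesis .
  qed
  have gh: "(\<integral>x. g x * ?T h x \<partial>\<sigma>) = energy (\<lambda>x y. \<kappa> x (?r y)) g"
    unfolding energy_def
  proof (intro Bochner_Integration.integral_cong refl)
    fix x assume "x \<in> space \<sigma>"
    then have x: "x \<in> unit_sphere n" by (simp add: space_\<sigma>)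
    have "?T h x = (\<integral>y. \<kappa> x (?r y) * h (?r y) \<partial>\<sigma>)" unfolding kernel_op_def
      by (rule integral_reflection[OF u, where F = "\<lambda>y. \<kappa> x y * h y", symmetric])
         (rule bounded_measD[OF bounded_meas_mult[OF kernel_section[OF k x] h]])
    then show "g x * ?T h x = g x * kernel_op (\<lambda>x y. \<kappa> x (?r y)) g x"
      by (simp add: kernel_op_def h_def reflection_involution[OF u])
  qed
  have opadd: "?T (sym_fun u g) x = (?T g x + ?T h x) / 2" if x: "x \<in> unit_sphere n" for x
  proof -
    have "?T (sym_fun u g) x = (\<integral>y. (\<kappa> x y * g y + \<kappa> x y * h y) / 2 \<partial>\<sigma>)"
      unfolding kernel_op_def sym_fun_def h_def by (simp add: distrib_left)
    then show ?thesis using integrable_kernel[OF k g x] integrable_kernel[OF k h x] by (simp add: kernel_op_def)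
  qed
  have "energy \<kappa> (sym_fun u g) = (\<integral>x. (g x * ?T g x + g x * ?T h x + h x * ?T g x + h x * ?T h x) / 4 \<partial>\<sigma>)"
    unfolding energy_def
    by (intro Bochner_Integration.integral_cong refl)
       (simp add: opadd space_\<sigma>, simp add: sym_fun_def h_def field_simps)
  also have "\<dots> = ((\<integral>x. g x * ?T g x \<partial>\<sigma>) + (\<integral>x. g x * ?T h x \<partial>\<sigma>) + (\<integral>x. h x * ?T g x \<partial>\<sigma>) + (\<integral>x. h x * ?T h x \<partial>\<sigma>)) / 4"
    using integrable_energy[OF k g g] integrable_energy[OF k g h] integrable_energy[OF k h g] integrable_energy[OF k h h]
    by simp
  also have "\<dots> = (energy \<kappa> g + energy (\<lambda>x y. \<kappa> x (?r y)) g) / 2"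
    unfolding hh hg gh by (simp add: energy_def)
  finally show ?thesis .
qed

subsection \<open>Symmetrization along an orthogonal frame\<close>

text \<open>Zero vectors are admitted because Gram--Schmidt produces them from linearly dependent vectors, and
  the uniform bounds below have to hold for every outcome.\<close>
definition orth_family :: "nat \<Rightarrow> (nat \<Rightarrow> nat \<Rightarrow> real) \<Rightarrow> bool" where
  "orth_family l b \<longleftrightarrow> (\<forall>i<l. b i \<in> Rn n \<and> dot n (b i) (b i) \<in> {0, 1}) \<and>
     (\<forall>i<l. \<forall>j<l. i \<noteq> j \<longrightarrow> dot n (b i) (b j) = 0)"

definition frame :: "(nat \<Rightarrow> nat \<Rightarrow> real) \<Rightarrow> bool" where
  "frame b \<longleftrightarrow> (\<forall>i<n. b i \<in> unit_sphere n) \<and> (\<forall>i<n. \<forall>j<n. i \<noteq> j \<longrightarrow> dot n (b i) (b j) = 0)"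

text \<open>The bilinear form of the product of the reflections along the frame vectors with index in \<open>I\<close>; that
  product is \<open>frame_flip\<close>.\<close>
definition frame_form :: "(nat \<Rightarrow> nat \<Rightarrow> real) \<Rightarrow> nat set \<Rightarrow> (nat \<Rightarrow> real) \<Rightarrow> (nat \<Rightarrow> real) \<Rightarrow> real" where
  "frame_form b I x y = dot n x y - 2 * (\<Sum>i\<in>I. dot n x (b i) * dot n y (b i))"

definition frame_flip :: "(nat \<Rightarrow> nat \<Rightarrow> real) \<Rightarrow> nat set \<Rightarrow> (nat \<Rightarrow> real) \<Rightarrow> nat \<Rightarrow> real" where
  "frame_flip b I y = (\<lambda>j. y j - 2 * (\<Sum>i\<in>I. dot n y (b i) * b i j))"

lemma frame_orth_family: "frame b \<Longrightarrow> orth_family n b"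
  by (auto simp: frame_def orth_family_def sphere_iff)

lemma dot_frame_flip: "dot n x (frame_flip b I y) = frame_form b I x y"
proof -
  have "frame_flip b I y = (\<lambda>j. y j - (\<Sum>i\<in>I. 2 * dot n y (b i) * b i j))"
    by (simp add: frame_flip_def sum_distrib_left mult.assoc)
  then have "dot n x (frame_flip b I y) = dot n x y - (\<Sum>i\<in>I. 2 * dot n y (b i) * dot n x (b i))"
    by (simp only: dot_minus_right dot_sum_right)
  then show ?thesis by (simp add: frame_form_def sum_distrib_left mult_ac)
qed

lemma orth_family_dot_self:
  assumes b: "orth_family l b" and i: "i < l" shows "dot n x (b i) * dot n (b i) (b i) = dot n x (b i)"
proof (cases "dot n (b i) (b i) = 0")
  case True
  then have "\<forall>j<n. b i j = 0" by (simp add: dot_self_0)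
  then have "dot n x (b i) = 0" by (simp add: dot_def)
  then show ?thesis by simp
next
  case False
  then have "dot n (b i) (b i) = 1" using b i unfolding orth_family_def by auto
  then show ?thesis by simp
qed

lemma frame_flip_orthogonal_map:
  assumes b: "orth_family n b" and I: "I \<subseteq> {..<n}" shows "orthogonal_map n (frame_flip b I)"
proof -
  have fin: "finite I" using I finite_subset by blast
  have flip_b: "frame_form b I (b i) x = - dot n (b i) x" if i: "i \<in> I" for i x
  proof -
    have "(\<Sum>k\<in>I. dot n (b i) (b k) * dot n x (b k)) = (\<Sum>k\<in>I. if k = i then dot n x (b i) else 0)"
    proof (rule sum.cong[OF refl])
      fix k assume "k \<in> I"
      then show "dot n (b i) (b k) * dot n x (b k) = (if k = i then dot n x (b i) else 0)"
        using orth_family_dot_self[OF b, of i x] b i I by (auto simp: orth_family_def mult.commute)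
    qed
    then show ?thesis using fin i by (simp add: frame_form_def dot_commute)
  qed
  have "dot n (frame_flip b I x) (frame_flip b I y) = dot n x y" for x y
  proof -
    let ?F = "frame_flip b I"
    have "dot n (?F x) (?F y) = dot n (?F x) y - 2 * (\<Sum>i\<in>I. dot n (?F x) (b i) * dot n y (b i))"
      by (simp only: dot_frame_flip[of "?F x"] frame_form_def)
    also have "dot n (?F x) y = frame_form b I x y"
      unfolding dot_commute[of n "?F x"] dot_frame_flip by (simp add: frame_form_def dot_commute mult.commute)
    also have "(\<Sum>i\<in>I. dot n (?F x) (b i) * dot n y (b i)) = (\<Sum>i\<in>I. - (dot n x (b i) * dot n y (b i)))"
    proof (rule sum.cong[OF refl])
      fix i assume "i \<in> I"
      then have "dot n (?F x) (b i) = - dot n x (b i)"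
        unfolding dot_commute[of n "?F x"] dot_frame_flip dot_commute[of n x] by (rule flip_b)
      then show "dot n (?F x) (b i) * dot n y (b i) = - (dot n x (b i) * dot n y (b i))" by simp
    qed
    also have "\<dots> = - (\<Sum>i\<in>I. dot n x (b i) * dot n y (b i))" by (rule sum_negf)
    finally show ?thesis by (simp add: frame_form_def)
  qed
  moreover have "frame_flip b I x \<in> Rn n" if "x \<in> Rn n" for x
    using that b I by (auto simp: frame_flip_def Rn_iff orth_family_def intro!: sum.neutral)
  ultimately show ?thesis by (simp add: orthogonal_map_def)
qed

lemma frame_flip_sphere:
  "orth_family n b \<Longrightarrow> I \<subseteq> {..<n} \<Longrightarrow> y \<in> unit_sphere n \<Longrightarrow> frame_flip b I y \<in> unit_sphere n"
  by (rule orthogonal_map_sphere[OF frame_flip_orthogonal_map])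

lemma frame_form_le:
  "orth_family n b \<Longrightarrow> I \<subseteq> {..<n} \<Longrightarrow> x \<in> unit_sphere n \<Longrightarrow> y \<in> unit_sphere n \<Longrightarrow> \<bar>frame_form b I x y\<bar> \<le> 1"
  unfolding dot_frame_flip[symmetric] by (intro sphere_dot_le frame_flip_sphere)

lemma kernel_frame_form:
  assumes b: "frame b" and I: "I \<subseteq> {..<n}" shows "kernel (\<lambda>x y. poly p (frame_form b I x y))"
proof (rule kernelI)
  show "\<bar>poly p (frame_form b I x y)\<bar> \<le> poly_bound p" if "x \<in> unit_sphere n" "y \<in> unit_sphere n" for x y
    by (intro poly_abs_le frame_form_le[OF frame_orth_family[OF b] I] that)
  have c: "(\<lambda>_. b i) \<in> measurable M \<sigma>" if "i \<in> I" for M :: "'a measure" and i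
    using b I that by (intro const_measurable) (auto simp: frame_def)
  show "(\<lambda>x. poly p (frame_form b I (fst x) (snd x))) \<in> borel_measurable (\<sigma> \<Otimes>\<^sub>M \<sigma>)"
    unfolding frame_form_def
    by (intro measurable_compose[OF _ poly_measurable] borel_measurable_diff borel_measurable_times
        borel_measurable_sum borel_measurable_const dot_measurable measurable_fst measurable_snd c)
qed

definition batch :: "(nat \<Rightarrow> nat \<Rightarrow> real) \<Rightarrow> ((nat \<Rightarrow> real) \<Rightarrow> real) \<Rightarrow> (nat \<Rightarrow> real) \<Rightarrow> real" where
  "batch b g = fold sym_fun (map b [0..<n]) g"

lemma bounded_meas_fold:
  "set us \<subseteq> unit_sphere n \<Longrightarrow> bounded_meas g \<Longrightarrow> bounded_meas (fold sym_fun us g)"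
  by (induction us arbitrary: g) (auto intro: bounded_meas_sym_fun)

lemma frame_set: "frame b \<Longrightarrow> l \<le> n \<Longrightarrow> set (map b [0..<l]) \<subseteq> unit_sphere n"
  by (auto simp: frame_def)

lemma bounded_meas_batch: "frame b \<Longrightarrow> bounded_meas g \<Longrightarrow> bounded_meas (batch b g)"
  unfolding batch_def by (intro bounded_meas_fold frame_set) auto

text \<open>The reflections along a frame commute, so that the symmetrizations of the two arguments of the
  energy can be moved to one side and multiply out to the average over all sign patterns.\<close>
lemma energy_batch:
  assumes b: "frame b" and g: "bounded_meas g"
  shows "poly_energy p (batch b g) = (\<Sum>I\<in>Pow {..<n}. energy (\<lambda>x y. poly p (frame_form b I x y)) g) / 2 ^ n"
proof -
  let ?K = "\<lambda>I x y. poly p (frame_form b I x y)"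
  have partial: "energy (?K J) (fold sym_fun (map b [0..<l]) g) = (\<Sum>I\<in>Pow {..<l}. energy (?K (J \<union> I)) g) / 2 ^ l"
    if "l \<le> n" "J \<subseteq> {l..<n}" for l J
    using that
  proof (induction l arbitrary: J)
    case 0 then show ?case by simp
  next
    case (Suc l)
    let ?g = "fold sym_fun (map b [0..<l]) g" and ?u = "b l"
    have u: "?u \<in> unit_sphere n" using b Suc.prems by (simp add: frame_def)
    have J: "J \<subseteq> {..<n}" "l \<notin> J" using Suc.prems by auto
    then have "finite J" using finite_subset by blast
    note J = J this
    have g': "bounded_meas ?g" using Suc.prems by (intro bounded_meas_fold frame_set b g) auto
    have other: "dot n (reflection n ?u x) (b i) = dot n x (b i)" if "i \<in> J" for i x
    proof -
      have "dot n ?u (b i) = 0" using b J Suc.prems that by (auto simp: frame_def)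
      then show ?thesis by (simp add: dot_reflection_left)
    qed
    have "energy (?K J) (sym_fun ?u ?g) = (energy (?K J) ?g + energy (\<lambda>x y. ?K J x (reflection n ?u y)) ?g) / 2"
      by (rule energy_sym_fun[OF u kernel_frame_form[OF b J(1)] g'])
         (simp add: frame_form_def other dot_reflection_reflection[OF u])
    moreover have "frame_form b J x (reflection n ?u y) = frame_form b (insert l J) x y" for x y
      using J by (simp add: frame_form_def other dot_reflection_right algebra_simps)
    moreover have "energy (?K J) ?g = (\<Sum>I\<in>Pow {..<l}. energy (?K (J \<union> I)) g) / 2 ^ l"
      by (rule Suc.IH) (use Suc.prems in auto)
    moreover have "energy (?K (insert l J)) ?g = (\<Sum>I\<in>Pow {..<l}. energy (?K (insert l J \<union> I)) g) / 2 ^ l"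
      by (rule Suc.IH) (use Suc.prems in auto)
    moreover have "(\<Sum>I\<in>Pow {..<Suc l}. energy (?K (J \<union> I)) g)
        = (\<Sum>I\<in>Pow {..<l}. energy (?K (J \<union> I)) g) + (\<Sum>I\<in>Pow {..<l}. energy (?K (insert l J \<union> I)) g)"
    proof -
      have inj: "inj_on (insert l) (Pow {..<l})" by (auto simp: inj_on_def)
      have disj: "Pow {..<l} \<inter> insert l ` Pow {..<l} = {}" by auto
      show ?thesis
        unfolding lessThan_Suc Pow_insert
        by (subst sum.union_disjoint) (simp_all add: disj sum.reindex[OF inj])
    qed
    ultimately show ?case by (simp add: field_simps)
  qed
  have "poly_energy p (batch b g) = energy (?K {}) (batch b g)" by (simp add: frame_form_def)
  then show ?thesis using partial[of n "{}"] by (simp add: batch_def)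
qed

end

section \<open>Random orthonormal frames\<close>

context sphere_measure
begin

text \<open>The component orthogonal to the family.\<close>
definition residual :: "nat \<Rightarrow> (nat \<Rightarrow> nat \<Rightarrow> real) \<Rightarrow> (nat \<Rightarrow> real) \<Rightarrow> nat \<Rightarrow> real" where
  "residual l b x = (\<lambda>k. x k - (\<Sum>i<l. dot n x (b i) * b i k))"

lemma dot_residual_right: "dot n y (residual l b x) = dot n y x - (\<Sum>i<l. dot n x (b i) * dot n y (b i))"
  unfolding residual_def dot_minus_right dot_sum_right ..

lemma dot_family_sum:
  assumes b: "orth_family l b" and j: "j < l"
  shows "(\<Sum>i<l. dot n x (b i) * dot n (b j) (b i)) = dot n x (b j)"
proof -
  have "(\<Sum>i<l. dot n x (b i) * dot n (b j) (b i)) = (\<Sum>i<l. if i = j then dot n x (b j) else 0)"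
    using b j by (intro sum.cong) (auto simp: orth_family_dot_self[OF b] orth_family_def)
  then show ?thesis using j by simp
qed

lemma dot_family_residual: "orth_family l b \<Longrightarrow> j < l \<Longrightarrow> dot n (b j) (residual l b x) = 0"
  by (simp add: dot_residual_right dot_family_sum dot_commute[of n "b j" x])

lemma dot_residual_self:
  assumes b: "orth_family l b"
  shows "dot n (residual l b x) (residual l b x) = dot n x x - (\<Sum>i<l. (dot n x (b i))\<^sup>2)"
proof -
  have "dot n (residual l b x) (residual l b x) = dot n (residual l b x) x - (\<Sum>i<l. dot n x (b i) * dot n (residual l b x) (b i))"
    by (rule dot_residual_right)
  also have "(\<Sum>i<l. dot n x (b i) * dot n (residual l b x) (b i)) = 0"
    using dot_family_residual[OF b] by (simp add: dot_commute[of n "residual l b x"])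
  finally show ?thesis
    by (simp add: dot_commute[of n "residual l b x"] dot_residual_right power2_eq_square)
qed

lemma sum_dot_residual_unit_vec:
  assumes b: "orth_family l b"
  shows "(\<Sum>j<n. dot n (residual l b (unit_vec j)) (residual l b (unit_vec j))) = real n - (\<Sum>i<l. dot n (b i) (b i))"
proof -
  have "(\<Sum>j<n. dot n (residual l b (unit_vec j)) (residual l b (unit_vec j))) = (\<Sum>j<n. 1 - (\<Sum>i<l. (b i j)\<^sup>2))"
    by (intro sum.cong refl)
      (simp add: dot_residual_self[OF b] dot_unit_vec_left, simp add: unit_vec_def)
  also have "\<dots> = real n - (\<Sum>i<l. \<Sum>j<n. (b i j)\<^sup>2)"
    by (simp add: sum_subtractf sum.swap[of _ "{..<n}"])
  finally show ?thesis by (simp add: dot_def power2_eq_square)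
qed

text \<open>Fewer than \<open>n\<close> unit vectors leave room: their total square length is less than the trace of
  the identity.\<close>
lemma orth_family_complement:
  assumes b: "orth_family l b" and l: "l < n"
  obtains v where "v \<in> unit_sphere n" "\<forall>i<l. dot n (b i) v = 0"
proof -
  have "(\<Sum>i<l. dot n (b i) (b i)) \<le> (\<Sum>i<l. 1)"
    using b by (intro sum_mono) (auto simp: orth_family_def)
  then have "0 < (\<Sum>j<n. dot n (residual l b (unit_vec j)) (residual l b (unit_vec j)))"
    using l by (simp add: sum_dot_residual_unit_vec[OF b])
  then have "\<not> (\<forall>j\<in>{..<n}. dot n (residual l b (unit_vec j)) (residual l b (unit_vec j)) \<le> 0)"
    using sum_nonpos[of "{..<n}" "\<lambda>j. dot n (residual l b (unit_vec j)) (residual l b (unit_vec j))"] by force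
  then obtain j where j: "j < n" "0 < dot n (residual l b (unit_vec j)) (residual l b (unit_vec j))"
    by force
  define d where "d = residual l b (unit_vec j)"
  define v where "v = (\<lambda>k. (1 / enorm n d) * d k)"
  have pos: "0 < enorm n d" using j by (simp add: enorm_def d_def)
  have "d \<in> Rn n"
    using b j unit_vec_Rn[OF j(1)] by (auto simp: d_def residual_def Rn_iff orth_family_def intro!: sum.neutral)
  then have "v \<in> Rn n" by (simp add: Rn_iff v_def)
  moreover have "dot n v v = 1"
  proof -
    have "dot n v v = 1 / enorm n d * (1 / enorm n d * (enorm n d)\<^sup>2)"
      unfolding v_def dot_scale_left dot_scale_right enorm_sq ..
    then show ?thesis using pos by (simp add: power2_eq_square)
  qed
  moreover have "dot n (b i) v = 0" if "i < l" for i
    using dot_family_residual[OF b that] unfolding v_def dot_scale_right d_def by simp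
  ultimately show ?thesis using that by (simp add: sphere_iff)
qed

lemma frame_Parseval:
  assumes b: "frame b" shows "dot n x y = (\<Sum>i<n. dot n x (b i) * dot n y (b i))"
proof -
  note f = frame_orth_family[OF b]
  have "(\<Sum>i<n. dot n (b i) (b i)) = real n" using b by (simp add: frame_def sphere_iff)
  then have "(\<Sum>j<n. dot n (residual n b (unit_vec j)) (residual n b (unit_vec j))) = 0"
    by (simp add: sum_dot_residual_unit_vec[OF f])
  then have zero: "dot n (residual n b (unit_vec j)) (residual n b (unit_vec j)) = 0" if "j < n" for j
    using that by (subst (asm) sum_nonneg_eq_0_iff) (auto simp: dot_self_nonneg)
  have "x j = (\<Sum>i<n. dot n x (b i) * b i j)" if j: "j < n" for j
  proof -
    have "dot n x (residual n b (unit_vec j)) = 0"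
    proof -
      have "\<forall>k<n. residual n b (unit_vec j) k = 0" using zero[OF j] by (simp only: dot_self_0)
      then show ?thesis by (simp add: dot_def)
    qed
    then show ?thesis
      by (simp add: dot_residual_right dot_unit_vec dot_unit_vec_left j mult.commute)
  qed
  then have "dot n x y = (\<Sum>j<n. (\<Sum>i<n. dot n x (b i) * b i j) * y j)"
    unfolding dot_def[of n x y] by (intro sum.cong) auto
  also have "\<dots> = (\<Sum>i<n. dot n x (b i) * (\<Sum>j<n. y j * b i j))"
    by (simp add: sum_distrib_right sum_distrib_left, subst sum.swap, simp add: mult_ac)
  finally show ?thesis by (simp add: dot_def[of n y])
qed

subsection \<open>The Gram--Schmidt map\<close>

fun gram :: "(nat \<Rightarrow> nat \<Rightarrow> real) \<Rightarrow> nat \<Rightarrow> nat \<Rightarrow> real" where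
  "gram g l = (\<lambda>k. (1 / enorm n (\<lambda>k. g l k - (\<Sum>i<l. dot n (g l) (gram g i) * gram g i k)))
     * (g l k - (\<Sum>i<l. dot n (g l) (gram g i) * gram g i k)))"

declare gram.simps [simp del]

lemma gram_eq: "gram g l = (\<lambda>k. (1 / enorm n (residual l (gram g) (g l))) * residual l (gram g) (g l) k)"
  by (subst gram.simps) (simp add: residual_def)

lemma gram_cong: "(\<And>i. i \<le> l \<Longrightarrow> g i = g' i) \<Longrightarrow> gram g l = gram g' l"
proof (induction l rule: less_induct)
  case (less l)
  have "gram g i = gram g' i" if "i < l" for i using less.prems that by (intro less.IH) auto
  then have "residual l (gram g) (g l) = residual l (gram g') (g' l)"
    using less.prems[of l] by (simp add: residual_def)
  then show ?case by (simp only: gram_eq)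
qed

text \<open>Division by zero yields zero: a linearly dependent vector is mapped to the zero vector.\<close>
lemma orth_family_gram: "(\<And>i. i < l \<Longrightarrow> g i \<in> Rn n) \<Longrightarrow> orth_family l (gram g)"
proof (induction l)
  case 0 then show ?case by (simp add: orth_family_def)
next
  case (Suc l)
  then have IH: "orth_family l (gram g)" by simp
  define r where "r = residual l (gram g) (g l)"
  have gl: "gram g l = (\<lambda>k. (1 / enorm n r) * r k)" by (simp add: gram_eq r_def)
  have "r \<in> Rn n"
    using IH Suc.prems[of l] by (auto simp: r_def residual_def Rn_iff orth_family_def intro!: sum.neutral)
  then have R: "gram g l \<in> Rn n" by (simp add: gl Rn_iff)
  have "dot n (gram g l) (gram g l) = 1 / enorm n r * (1 / enorm n r * (enorm n r)\<^sup>2)"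
    unfolding gl dot_scale_left dot_scale_right enorm_sq ..
  then have norm: "dot n (gram g l) (gram g l) \<in> {0, 1}"
    by (cases "enorm n r = 0") (simp_all add: power2_eq_square)
  have orth: "dot n (gram g j) (gram g l) = 0" if "j < l" for j
    using dot_family_residual[OF IH that, of "g l"] unfolding gl dot_scale_right r_def by simp
  show ?case
    unfolding orth_family_def
  proof (intro conjI allI impI)
    fix i assume "i < Suc l"
    then show "gram g i \<in> Rn n" "dot n (gram g i) (gram g i) \<in> {0, 1}"
      using IH R norm by (cases "i = l"; simp add: orth_family_def)+
  next
    fix i j assume ij: "i < Suc l" "j < Suc l" "i \<noteq> j"
    then consider "i < l" "j < l" | "i = l" "j < l" | "i < l" "j = l" by linarith
    then show "dot n (gram g i) (gram g j) = 0"
    proof cases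
      case 1 then show ?thesis using IH ij by (simp add: orth_family_def)
    next
      case 2 then show ?thesis using orth[of j] by (subst dot_commute) simp
    next
      case 3 then show ?thesis using orth[of i] by simp
    qed
  qed
qed

lemma reflection_residual:
  assumes u: "u \<in> unit_sphere n"
  shows "residual l (\<lambda>i. reflection n u (b i)) (reflection n u x) = reflection n u (residual l b x)"
proof
  fix k
  define A B where "A = (\<Sum>i<l. dot n x (b i) * b i k)" and "B = (\<Sum>i<l. dot n x (b i) * dot n (b i) u)"
  have hB: "dot n (residual l b x) u = dot n x u - B"
    unfolding dot_commute[of n _ u] dot_residual_right B_def ..
  have hA: "(\<Sum>i<l. dot n x (b i) * reflection n u (b i) k) = A - 2 * B * u k"
    unfolding A_def B_def reflection_def by (simp add: right_diff_distrib sum_subtractf sum_distrib_left sum_distrib_right mult_ac)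
  have hr: "residual l b x k = x k - A" by (simp add: residual_def A_def)
  have hl: "residual l (\<lambda>i. reflection n u (b i)) (reflection n u x) k
      = reflection n u x k - (\<Sum>i<l. dot n x (b i) * reflection n u (b i) k)"
    by (simp add: residual_def dot_reflection_reflection[OF u])
  have hx: "reflection n u x k = x k - 2 * dot n x u * u k"
    "reflection n u (residual l b x) k = residual l b x k - 2 * dot n (residual l b x) u * u k"
    by (simp_all add: reflection_def)
  show "residual l (\<lambda>i. reflection n u (b i)) (reflection n u x) k = reflection n u (residual l b x) k"
    unfolding hl hA hx hr hB by (simp add: algebra_simps)
qed

lemma gram_reflection:
  assumes u: "u \<in> unit_sphere n"
  shows "gram (\<lambda>i. reflection n u (g i)) l = reflection n u (gram g l)"
proof (induction l rule: less_induct)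
  case (less l)
  define r where "r = residual l (gram g) (g l)"
  have "residual l (gram (\<lambda>i. reflection n u (g i))) (reflection n u (g l))
      = residual l (\<lambda>i. reflection n u (gram g i)) (reflection n u (g l))"
    unfolding residual_def by (intro ext arg_cong2[of _ _ _ _ "(-)"] refl sum.cong) (simp_all add: less)
  also have "\<dots> = reflection n u r" unfolding r_def by (rule reflection_residual[OF u])
  finally have res: "residual l (gram (\<lambda>i. reflection n u (g i))) (reflection n u (g l)) = reflection n u r" .
  have "enorm n (reflection n u r) = enorm n r" by (simp add: enorm_def dot_reflection_reflection[OF u])
  then have "gram (\<lambda>i. reflection n u (g i)) l = (\<lambda>k. (1 / enorm n r) * reflection n u r k)"
    by (simp add: gram_eq[of "\<lambda>i. reflection n u (g i)"] res)
  also have "\<dots> = reflection n u (\<lambda>k. (1 / enorm n r) * r k)"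
    unfolding reflection_def dot_scale_left by (simp add: algebra_simps)
  also have "\<dots> = reflection n u (gram g l)" by (simp add: gram_eq[of g] r_def)
  finally show ?case .
qed

text \<open>The space of \<open>n\<close> independent uniformly distributed points, from which Gram--Schmidt makes a random
  frame.\<close>
abbreviation \<Omega> :: "(nat \<Rightarrow> nat \<Rightarrow> real) measure" where
  "\<Omega> \<equiv> PiM {..<n} (\<lambda>_. \<sigma>)"

lemma prob_space_\<Omega>: "prob_space \<Omega>"
  by (rule prob_space_PiM) (rule prob_space_axioms)

lemma space_\<Omega>: "\<omega> \<in> space \<Omega> \<Longrightarrow> i < n \<Longrightarrow> \<omega> i \<in> unit_sphere n"
  by (auto simp: space_PiM space_\<sigma>)

lemma gram_measurable: "l < n \<Longrightarrow> (\<lambda>\<omega>. gram \<omega> l k) \<in> borel_measurable \<Omega>"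
proof (induction l arbitrary: k rule: less_induct)
  case (less l)
  have IH: "(\<lambda>\<omega>. gram \<omega> i k) \<in> borel_measurable \<Omega>" if "i < l" for i k
    using less that by simp
  have c: "(\<lambda>\<omega>. \<omega> l k) \<in> borel_measurable \<Omega>" for k
    using less.prems by (intro coord_measurable_raw measurable_component_singleton) simp
  have d: "(\<lambda>\<omega>. dot n (\<omega> l) (gram \<omega> i)) \<in> borel_measurable \<Omega>" if "i < l" for i
    unfolding dot_def by (intro borel_measurable_sum borel_measurable_times c IH that)
  have r: "(\<lambda>\<omega>. residual l (gram \<omega>) (\<omega> l) k) \<in> borel_measurable \<Omega>" for k
    unfolding residual_def
    by (intro borel_measurable_diff borel_measurable_sum borel_measurable_times c d IH) auto
  show ?case unfolding gram_eq[of _ l] enorm_def dot_def[of n "residual _ _ _"]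
    by (intro borel_measurable_times borel_measurable_divide borel_measurable_const
        measurable_compose[OF _ borel_measurable_sqrt] borel_measurable_sum r)
qed

lemma orth_family_gram_\<Omega>: "\<omega> \<in> space \<Omega> \<Longrightarrow> orth_family n (gram \<omega>)"
  by (rule orth_family_gram) (use space_\<Omega> in \<open>auto simp: sphere_iff\<close>)

text \<open>Given the other vectors, the \<open>l\<close>-th one lies in the span of its predecessors only if it lies in
  some fixed hyperplane, which is a null set.\<close>
lemma AE_gram_nonzero:
  assumes l: "l < n" shows "AE \<omega> in \<Omega>. dot n (gram \<omega> l) (gram \<omega> l) \<noteq> 0"
proof -
  interpret P: product_prob_space "\<lambda>_. \<sigma>" "{..<n}" by (rule product_prob_spaceI) (rule prob_space_axioms)
  define N where "N = {\<omega> \<in> space \<Omega>. dot n (gram \<omega> l) (gram \<omega> l) = 0}"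
  have N: "N \<in> sets \<Omega>"
  proof -
    have [measurable]: "(\<lambda>\<omega>. gram \<omega> l k) \<in> borel_measurable \<Omega>" for k by (rule gram_measurable[OF l])
    show ?thesis unfolding N_def dot_def by measurable
  qed
  have ins: "insert l ({..<n} - {l}) = {..<n}" using l by auto
  have "emeasure \<Omega> N = (\<integral>\<^sup>+ \<omega>. indicator N \<omega> \<partial>\<Omega>)" using N by simp
  also have "\<dots> = (\<integral>\<^sup>+ x. (\<integral>\<^sup>+ y. indicator N (x(l := y)) \<partial>\<sigma>) \<partial>PiM ({..<n} - {l}) (\<lambda>_. \<sigma>))"
    using P.product_nn_integral_insert[of "{..<n} - {l}" l "indicator N", unfolded ins] N by simp
  also have "\<dots> = (\<integral>\<^sup>+ x. 0 \<partial>PiM ({..<n} - {l}) (\<lambda>_. \<sigma>))"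
  proof (rule nn_integral_cong)
    fix x assume "x \<in> space (PiM ({..<n} - {l}) (\<lambda>_. \<sigma>))"
    then have x: "x i \<in> unit_sphere n" if "i < n" "i \<noteq> l" for i
      using that by (auto simp: space_PiM space_\<sigma>)
    have fam: "orth_family l (gram x)" by (rule orth_family_gram) (use x l in \<open>auto simp: sphere_iff\<close>)
    obtain v where v: "v \<in> unit_sphere n" "\<forall>i<l. dot n (gram x i) v = 0"
      using orth_family_complement[OF fam l] .
    have "AE y in \<sigma>. indicator N (x(l := y)) = (0::ennreal)"
      using AE_dot_nonzero[OF v(1)]
    proof eventually_elim
      case (elim y)
      have "x(l := y) \<notin> N"
      proof
        assume "x(l := y) \<in> N"
        then have z: "dot n (gram (x(l := y)) l) (gram (x(l := y)) l) = 0" by (simp add: N_def)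
        have "gram (x(l := y)) i = gram x i" if "i < l" for i using that by (intro gram_cong) auto
        then have r: "residual l (gram (x(l := y))) ((x(l := y)) l) = residual l (gram x) y"
          by (simp add: residual_def)
        let ?r = "residual l (gram x) y"
        have g: "gram (x(l := y)) l = (\<lambda>k. (1 / enorm n ?r) * ?r k)"
          using gram_eq[of "x(l := y)" l] unfolding r .
        have "0 = 1 / enorm n ?r * (1 / enorm n ?r * (enorm n ?r)\<^sup>2)"
          using z unfolding g dot_scale_left dot_scale_right enorm_sq ..
        then have "enorm n ?r = 0" by (cases "enorm n ?r = 0") (simp_all add: power2_eq_square)
        then have "dot n ?r ?r = 0" by (simp flip: enorm_sq)
        then have "\<forall>k<n. ?r k = 0" by (simp only: dot_self_0)
        then have "dot n v ?r = 0" by (simp add: dot_def)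
        then have "dot n v y = 0" using v(2) by (simp add: dot_residual_right dot_commute[of n v "gram x _"])
        then show False using elim by simp
      qed
      then show ?case by simp
    qed
    then show "(\<integral>\<^sup>+ y. indicator N (x(l := y)) \<partial>\<sigma>) = 0" by (simp add: nn_integral_0_iff_AE cong: nn_integral_cong_AE)
  qed
  finally have "emeasure \<Omega> N = 0" by simp
  then show ?thesis using N by (intro AE_I[of _ _ N]) (auto simp: N_def)
qed

lemma AE_frame_gram: "AE \<omega> in \<Omega>. frame (gram \<omega>)"
proof -
  have "AE \<omega> in \<Omega>. \<forall>l\<in>{..<n}. dot n (gram \<omega> l) (gram \<omega> l) \<noteq> 0"
    by (rule AE_finite_allI) (use AE_gram_nonzero in auto)
  then show ?thesis
  proof (rule AE_mp, intro AE_I2 impI)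
    fix \<omega> assume "\<omega> \<in> space \<Omega>" and nz: "\<forall>l\<in>{..<n}. dot n (gram \<omega> l) (gram \<omega> l) \<noteq> 0"
    then have "orth_family n (gram \<omega>)" by (intro orth_family_gram_\<Omega>)
    then show "frame (gram \<omega>)" using nz by (auto simp: frame_def orth_family_def sphere_iff)
  qed
qed

text \<open>The law of the frame is rotation invariant because Gram--Schmidt commutes with rotations.\<close>
lemma integral_gram_reflection:
  fixes F :: "(nat \<Rightarrow> nat \<Rightarrow> real) \<Rightarrow> real"
  assumes u: "u \<in> unit_sphere n" and F: "(\<lambda>\<omega>. F (gram \<omega>)) \<in> borel_measurable \<Omega>"
    and local: "\<And>b b'. (\<And>i. i < n \<Longrightarrow> b i = b' i) \<Longrightarrow> F b = F b'"
  shows "(\<integral>\<omega>. F (\<lambda>i. reflection n u (gram \<omega> i)) \<partial>\<Omega>) = (\<integral>\<omega>. F (gram \<omega>) \<partial>\<Omega>)"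
proof -
  let ?c = "compose {..<n} (reflection n u)"
  have inv: "distr \<sigma> \<sigma> (reflection n u) = \<sigma>"
    using rot reflection_orthogonal_map[OF u] by (simp add: rotation_invariant_prob_def)
  have "distr \<Omega> \<Omega> ?c = PiM {..<n} (\<lambda>_. distr \<sigma> \<sigma> (reflection n u))"
    by (rule distr_PiM_finite_prob_space') (use reflection_measurable[OF u] prob_space_axioms in auto)
  then have d: "distr \<Omega> \<Omega> ?c = \<Omega>" by (simp add: inv)
  have meas: "?c \<in> measurable \<Omega> \<Omega>"
    unfolding compose_def
  proof (rule measurable_restrict)
    fix i assume "i \<in> {..<n}"
    then have "(\<lambda>\<omega>. \<omega> i) \<in> measurable \<Omega> \<sigma>" by (rule measurable_component_singleton)
    then show "(\<lambda>\<omega>. reflection n u (\<omega> i)) \<in> measurable \<Omega> \<sigma>"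
      by (rule measurable_compose[OF _ reflection_measurable[OF u]])
  qed
  have "(\<integral>\<omega>. F (gram \<omega>) \<partial>\<Omega>) = (\<integral>\<omega>. F (gram \<omega>) \<partial>distr \<Omega> \<Omega> ?c)" by (simp add: d)
  also have "\<dots> = (\<integral>\<omega>. F (gram (?c \<omega>)) \<partial>\<Omega>)" by (rule integral_distr[OF meas F])
  also have "\<dots> = (\<integral>\<omega>. F (\<lambda>i. reflection n u (gram \<omega> i)) \<partial>\<Omega>)"
  proof (intro Bochner_Integration.integral_cong refl local)
    fix \<omega> :: "nat \<Rightarrow> nat \<Rightarrow> real" and i assume "i < n"
    then have "gram (?c \<omega>) i = gram (\<lambda>i. reflection n u (\<omega> i)) i"
      by (intro gram_cong) (simp add: compose_def)
    then show "gram (?c \<omega>) i = reflection n u (gram \<omega> i)" by (simp add: gram_reflection[OF u])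
  qed
  finally show ?thesis ..
qed

end

section \<open>The averaged symmetrization operator\<close>

context sphere_measure
begin

abbreviation gform :: "nat set \<Rightarrow> (nat \<Rightarrow> nat \<Rightarrow> real) \<Rightarrow> (nat \<Rightarrow> real) \<Rightarrow> (nat \<Rightarrow> real) \<Rightarrow> real" where
  "gform I \<omega> x y \<equiv> frame_form (gram \<omega>) I x y"

lemma gform_measurable:
  assumes I: "I \<subseteq> {..<n}" and f: "f \<in> measurable M \<Omega>" and X: "X \<in> measurable M \<sigma>" and Y: "Y \<in> measurable M \<sigma>"
  shows "(\<lambda>m. gform I (f m) (X m) (Y m)) \<in> borel_measurable M"
proof -
  have g: "(\<lambda>m. gram (f m) i k) \<in> borel_measurable M" if "i \<in> I" for i k
    using I that by (intro measurable_compose[OF f gram_measurable]) auto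
  show ?thesis unfolding frame_form_def dot_def
    by (intro borel_measurable_diff borel_measurable_times borel_measurable_sum borel_measurable_const
        coord_measurable_raw[OF X] coord_measurable_raw[OF Y] g)
qed

lemma poly_gform_measurable:
  "I \<subseteq> {..<n} \<Longrightarrow> f \<in> measurable M \<Omega> \<Longrightarrow> X \<in> measurable M \<sigma> \<Longrightarrow> Y \<in> measurable M \<sigma> \<Longrightarrow>
    (\<lambda>m. poly p (gform I (f m) (X m) (Y m))) \<in> borel_measurable M"
  by (rule measurable_compose[OF gform_measurable poly_measurable])

lemma gform_le:
  "I \<subseteq> {..<n} \<Longrightarrow> \<omega> \<in> space \<Omega> \<Longrightarrow> x \<in> unit_sphere n \<Longrightarrow> y \<in> unit_sphere n \<Longrightarrow> \<bar>gform I \<omega> x y\<bar> \<le> 1"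
  by (rule frame_form_le[OF orth_family_gram_\<Omega>])

lemma gform_measurable_const:
  assumes "I \<subseteq> {..<n}" "x \<in> unit_sphere n" "y \<in> unit_sphere n"
  shows "(\<lambda>\<omega>. gform I \<omega> x y) \<in> borel_measurable \<Omega>"
  by (rule gform_measurable[OF assms(1) measurable_ident_sets[OF refl, unfolded id_def]
        const_measurable[OF assms(2)] const_measurable[OF assms(3)]])

lemma integrable_\<Omega>:
  fixes F :: "_ \<Rightarrow> real"
  assumes "F \<in> borel_measurable \<Omega>" "\<And>\<omega>. \<omega> \<in> space \<Omega> \<Longrightarrow> \<bar>F \<omega>\<bar> \<le> C"
  shows "integrable \<Omega> F"
  by (rule finite_measure.integrable_const_bound[OF prob_space.finite_measure[OF prob_space_\<Omega>], of _ C])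
     (use assms in auto)

lemma integrable_poly_gform:
  assumes "I \<subseteq> {..<n}" "x \<in> unit_sphere n" "y \<in> unit_sphere n"
  shows "integrable \<Omega> (\<lambda>\<omega>. poly p (gform I \<omega> x y))"
  by (rule integrable_\<Omega>[of _ "poly_bound p"])
     (use measurable_compose[OF gform_measurable_const[OF assms] poly_measurable] poly_abs_le gform_le assms in auto)

lemma abs_integral_poly_gform_le:
  assumes I: "I \<subseteq> {..<n}" and xy: "x \<in> unit_sphere n" "y \<in> unit_sphere n"
  shows "\<bar>\<integral>\<omega>. poly p (gform I \<omega> x y) \<partial>\<Omega>\<bar> \<le> poly_bound p"
proof -
  have "\<bar>\<integral>\<omega>. poly p (gform I \<omega> x y) \<partial>\<Omega>\<bar> \<le> (\<integral>\<omega>. \<bar>poly p (gform I \<omega> x y)\<bar> \<partial>\<Omega>)" by (rule integral_abs_bound)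
  also have "\<dots> \<le> (\<integral>\<omega>. poly_bound p \<partial>\<Omega>)"
  proof (rule integral_mono)
    show "integrable \<Omega> (\<lambda>\<omega>. \<bar>poly p (gform I \<omega> x y)\<bar>)"
      by (intro integrable_abs integrable_poly_gform I xy)
    show "integrable \<Omega> (\<lambda>\<omega>. poly_bound p)"
      by (rule integrable_\<Omega>[of _ "\<bar>poly_bound p\<bar>"]) auto
    show "\<bar>poly p (gform I \<omega> x y)\<bar> \<le> poly_bound p" if "\<omega> \<in> space \<Omega>" for \<omega>
      by (intro poly_abs_le gform_le I that xy)
  qed
  also have "\<dots> = poly_bound p" using prob_space.prob_space[OF prob_space_\<Omega>] by simp
  finally show ?thesis .
qed

definition gform_poly :: "nat set \<Rightarrow> nat \<Rightarrow> real poly" where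
  "gform_poly I k = form_poly \<Omega> (\<lambda>\<omega>. (gform I \<omega> e0 e0 + gform I \<omega> e1 e1) / 2)
     (\<lambda>\<omega>. (gform I \<omega> e0 e0 - gform I \<omega> e1 e1) / 2) k"

lemma frame_form_lincomb:
  "frame_form b I (lincomb c e0 d e1) (lincomb c e0 (- d) e1) = c\<^sup>2 * frame_form b I e0 e0 - d\<^sup>2 * frame_form b I e1 e1"
proof -
  have "dot n (lincomb c e0 d e1) (lincomb c e0 (- d) e1) = c\<^sup>2 - d\<^sup>2"
    unfolding dot_lincomb_e by (simp add: lincomb_def e_apply power2_eq_square)
  moreover have "dot n e0 e0 = 1" "dot n e1 e1 = 1" using e_sphere by (simp_all add: sphere_iff)
  moreover have "(\<Sum>i\<in>I. dot n (lincomb c e0 d e1) (b i) * dot n (lincomb c e0 (- d) e1) (b i))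
      = c\<^sup>2 * (\<Sum>i\<in>I. dot n e0 (b i) * dot n e0 (b i)) - d\<^sup>2 * (\<Sum>i\<in>I. dot n e1 (b i) * dot n e1 (b i))"
    by (simp add: dot_lincomb_left sum_distrib_left sum_subtractf[symmetric] power2_eq_square algebra_simps)
  ultimately show ?thesis by (simp add: frame_form_def algebra_simps)
qed

text \<open>Conjugating the form of a frame by a reflection gives the form of the reflected frame, which has the
  same law.\<close>
lemma gform_zonal:
  assumes I: "I \<subseteq> {..<n}" and xy: "x \<in> unit_sphere n" "y \<in> unit_sphere n"
  shows "(\<integral>\<omega>. gform I \<omega> x y ^ k \<partial>\<Omega>) = poly (gform_poly I k) (dot n x y)"
  unfolding gform_poly_def
proof (rule random_form_zonal[OF prob_space_\<Omega> _ _ _ _ _ xy, where s = "gform I"])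
  show "\<bar>gform I \<omega> x x\<bar> \<le> 1" if "\<omega> \<in> space \<Omega>" "x \<in> unit_sphere n" for \<omega> x
    by (rule gform_le[OF I that that(2)])
  show "(\<integral>\<omega>. gform I \<omega> (reflection n u x) (reflection n u y) ^ k \<partial>\<Omega>) = (\<integral>\<omega>. gform I \<omega> x y ^ k \<partial>\<Omega>)"
    if u: "u \<in> unit_sphere n" and xy: "x \<in> unit_sphere n" "y \<in> unit_sphere n" for u x y
  proof -
    have "frame_form b I (reflection n u x) (reflection n u y) = frame_form (\<lambda>i. reflection n u (b i)) I x y" for b
      by (simp add: frame_form_def dot_reflection_reflection[OF u] dot_reflection_swap[of n u x] dot_reflection_swap[of n u y])
    moreover have "(\<integral>\<omega>. frame_form (\<lambda>i. reflection n u (gram \<omega> i)) I x y ^ k \<partial>\<Omega>) = (\<integral>\<omega>. gform I \<omega> x y ^ k \<partial>\<Omega>)"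
    proof (rule integral_gram_reflection[OF u, where F = "\<lambda>b. frame_form b I x y ^ k"])
      show "(\<lambda>\<omega>. gform I \<omega> x y ^ k) \<in> borel_measurable \<Omega>"
        by (intro borel_measurable_power gform_measurable_const I xy)
      show "frame_form b I x y ^ k = frame_form b' I x y ^ k" if "\<And>i. i < n \<Longrightarrow> b i = b' i" for b b'
        using that I by (auto simp: frame_form_def intro!: arg_cong[of _ _ "\<lambda>a. (_ - 2 * a) ^ k"] sum.cong)
    qed
    ultimately show ?thesis by simp
  qed
qed (rule gform_measurable_const[OF I e_sphere(1) e_sphere(1)] gform_measurable_const[OF I e_sphere(2) e_sphere(2)]
    frame_form_lincomb)+

text \<open>The kernel of a zonal operator after a random batch, in expectation.\<close>
definition avg_poly :: "real poly \<Rightarrow> real poly" where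
  "avg_poly p = smult (1 / 2 ^ n) (\<Sum>I\<in>Pow {..<n}. \<Sum>k\<le>degree p. smult (coeff p k) (gform_poly I k))"

lemma poly_avg_poly:
  assumes xy: "x \<in> unit_sphere n" "y \<in> unit_sphere n"
  shows "poly (avg_poly p) (dot n x y) = (\<Sum>I\<in>Pow {..<n}. \<integral>\<omega>. poly p (gform I \<omega> x y) \<partial>\<Omega>) / 2 ^ n"
proof -
  have "(\<integral>\<omega>. poly p (gform I \<omega> x y) \<partial>\<Omega>) = (\<Sum>k\<le>degree p. coeff p k * poly (gform_poly I k) (dot n x y))"
    if "I \<in> Pow {..<n}" for I
  proof -
    have I: "I \<subseteq> {..<n}" using that by simp
    have int: "integrable \<Omega> (\<lambda>\<omega>. gform I \<omega> x y ^ k)" for k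
      using integrable_poly_gform[OF I xy, of "monom 1 k"] by (simp add: poly_monom)
    show ?thesis
      unfolding poly_altdef[of p] using int by (simp add: Bochner_Integration.integral_sum gform_zonal[OF I xy])
  qed
  then show ?thesis by (simp add: avg_poly_def poly_sum sum_divide_distrib)
qed

text \<open>The factor by which a random batch multiplies the energy of degree \<open>k\<close>, in expectation.\<close>
definition contraction :: "nat \<Rightarrow> real" where
  "contraction k = (\<Sum>I\<in>Pow {..<n}. \<integral>\<omega>. ((gform I \<omega> e0 e0 + gform I \<omega> e1 e1) / 2) ^ k \<partial>\<Omega>) / 2 ^ n"

text \<open>Only the monomial of degree \<open>k\<close> contributes, with the leading coefficient found in \<open>random_form_zonal\<close>.\<close>
lemma coeff_avg_orth: "coeff (avg_poly (orth k)) k = contraction k"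
proof -
  have deg: "degree (orth k) = k"
    using low_degree_orth[of k] coeff_orth[of k]
    by (metis low_degreeD orth_nonzero le_degree less_Suc_eq_le le_antisym zero_neq_one)
  have "(\<Sum>j\<le>k. coeff (orth k) j * coeff (gform_poly I j) k)
      = (\<Sum>j\<le>k. if j = k then \<integral>\<omega>. ((gform I \<omega> e0 e0 + gform I \<omega> e1 e1) / 2) ^ k \<partial>\<Omega> else 0)" for I
    by (intro sum.cong refl) (auto simp: gform_poly_def coeff_form_poly coeff_orth)
  then show ?thesis
    by (simp add: avg_poly_def contraction_def deg coeff_sum)
qed

text \<open>The flips are orthogonal maps, hence they commute with the zonal operator with kernel \<open>p\<close>.\<close>
lemma avg_poly_conv: "avg_poly (conv p q) = conv p (avg_poly q)"
proof (rule zonal_poly_eqI)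
  fix x y assume xy: "x \<in> unit_sphere n" "y \<in> unit_sphere n"
  have swap: "(\<integral>\<omega>. poly (conv p q) (gform I \<omega> x y) \<partial>\<Omega>)
      = (\<integral>z. poly p (dot n x z) * (\<integral>\<omega>. poly q (gform I \<omega> z y) \<partial>\<Omega>) \<partial>\<sigma>)" if I: "I \<subseteq> {..<n}" for I
  proof -
    have "(\<integral>\<omega>. poly (conv p q) (gform I \<omega> x y) \<partial>\<Omega>) = (\<integral>\<omega>. (\<integral>z. poly p (dot n x z) * poly q (gform I \<omega> z y) \<partial>\<sigma>) \<partial>\<Omega>)"
    proof (intro Bochner_Integration.integral_cong refl)
      fix \<omega> assume "\<omega> \<in> space \<Omega>"
      then have "frame_flip (gram \<omega>) I y \<in> unit_sphere n"
        by (intro frame_flip_sphere orth_family_gram_\<Omega> I xy)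
      from poly_conv[OF xy(1) this, of p q]
      show "poly (conv p q) (gform I \<omega> x y) = (\<integral>z. poly p (dot n x z) * poly q (gform I \<omega> z y) \<partial>\<sigma>)"
        by (simp only: dot_frame_flip)
    qed
    also have "\<dots> = (\<integral>z. (\<integral>\<omega>. poly p (dot n x z) * poly q (gform I \<omega> z y) \<partial>\<Omega>) \<partial>\<sigma>)"
    proof (rule bounded_Fubini[OF prob_space_\<Omega> prob_space_axioms, where C = "poly_bound p * poly_bound q"])
      show "(\<lambda>m. poly p (dot n x (snd m)) * poly q (gform I (fst m) (snd m) y)) \<in> borel_measurable (\<Omega> \<Otimes>\<^sub>M \<sigma>)"
        by (intro borel_measurable_times poly_kernel_measurable poly_gform_measurable I const_measurable xy measurable_fst measurable_snd)
      show "\<bar>poly p (dot n x z) * poly q (gform I \<omega> z y)\<bar> \<le> poly_bound p * poly_bound q"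
        if "\<omega> \<in> space \<Omega>" "z \<in> space \<sigma>" for \<omega> z
        using that unfolding abs_mult space_\<sigma>
        by (intro mult_mono poly_kernel_le poly_abs_le gform_le I xy poly_bound_nonneg) auto
    qed
    finally show ?thesis by simp
  qed
  have "poly (avg_poly (conv p q)) (dot n x y)
      = (\<Sum>I\<in>Pow {..<n}. \<integral>z. poly p (dot n x z) * (\<integral>\<omega>. poly q (gform I \<omega> z y) \<partial>\<Omega>) \<partial>\<sigma>) / 2 ^ n"
    using swap by (simp add: poly_avg_poly[OF xy])
  also have "(\<Sum>I\<in>Pow {..<n}. \<integral>z. poly p (dot n x z) * (\<integral>\<omega>. poly q (gform I \<omega> z y) \<partial>\<Omega>) \<partial>\<sigma>)
      = (\<integral>z. (\<Sum>I\<in>Pow {..<n}. poly p (dot n x z) * (\<integral>\<omega>. poly q (gform I \<omega> z y) \<partial>\<Omega>)) \<partial>\<sigma>)"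
  proof (rule Bochner_Integration.integral_sum[symmetric])
    fix I assume "I \<in> Pow {..<n}"
    then have I: "I \<subseteq> {..<n}" by simp
    show "integrable \<sigma> (\<lambda>z. poly p (dot n x z) * (\<integral>\<omega>. poly q (gform I \<omega> z y) \<partial>\<Omega>))"
    proof (rule integrable_bounded_meas[OF bounded_meas_mult[OF kernel_section[OF kernel_poly xy(1)]]], rule bounded_measI)
      show "(\<lambda>z. \<integral>\<omega>. poly q (gform I \<omega> z y) \<partial>\<Omega>) \<in> borel_measurable \<sigma>"
      proof (rule sigma_finite_measure.borel_measurable_lebesgue_integral)
        show "sigma_finite_measure \<Omega>"
          using prob_space_\<Omega> by (simp add: prob_space_imp_sigma_finite)
        show "(\<lambda>(z, \<omega>). poly q (gform I \<omega> z y)) \<in> borel_measurable (\<sigma> \<Otimes>\<^sub>M \<Omega>)"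
          unfolding case_prod_unfold
          by (intro poly_gform_measurable I const_measurable xy measurable_fst measurable_snd)
      qed
      show "\<bar>\<integral>\<omega>. poly q (gform I \<omega> z y) \<partial>\<Omega>\<bar> \<le> poly_bound q" if "z \<in> unit_sphere n" for z
        by (rule abs_integral_poly_gform_le[OF I that xy(2)])
    qed
  qed
  also have "\<dots> / 2 ^ n = (\<integral>z. poly p (dot n x z) * ((\<Sum>I\<in>Pow {..<n}. \<integral>\<omega>. poly q (gform I \<omega> z y) \<partial>\<Omega>) / 2 ^ n) \<partial>\<sigma>)"
    unfolding integral_divide_zero[symmetric] sum_distrib_left[symmetric] by simp
  also have "\<dots> = (\<integral>z. poly p (dot n x z) * poly (avg_poly q) (dot n z y) \<partial>\<sigma>)"
    by (intro Bochner_Integration.integral_cong refl) (simp add: poly_avg_poly[OF _ xy(2)] space_\<sigma>)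
  also have "\<dots> = poly (conv p (avg_poly q)) (dot n x y)" by (rule poly_conv[OF xy, symmetric])
  finally show "poly (avg_poly (conv p q)) (dot n x y) = poly (conv p (avg_poly q)) (dot n x y)" .
qed

lemma avg_poly_smult: "avg_poly (smult a p) = smult a (avg_poly p)"
  by (rule zonal_poly_eqI) (simp add: poly_avg_poly sum_distrib_left)

text \<open>The averaged operator commutes with convolutions, of which the orthogonal polynomials are the
  common eigenfunctions.\<close>
lemma avg_orth: "avg_poly (orth k) = smult (contraction k) (orth k)"
proof -
  have "smult (tau k) (avg_poly (orth k)) = avg_poly (conv (orth k) (orth k))"
    by (simp add: conv_orth eig_orth avg_poly_smult)
  also have "\<dots> = conv (avg_poly (orth k)) (orth k)" by (simp only: avg_poly_conv conv_commute)
  also have "\<dots> = smult (eig (avg_poly (orth k)) k) (orth k)" by (rule conv_orth)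
  finally have "smult (1 / tau k) (smult (tau k) (avg_poly (orth k)))
      = smult (1 / tau k) (smult (eig (avg_poly (orth k)) k) (orth k))" by (rule arg_cong)
  then have eq: "avg_poly (orth k) = smult (eig (avg_poly (orth k)) k / tau k) (orth k)"
    using tau_pos[of k] by simp
  have "contraction k = eig (avg_poly (orth k)) k / tau k"
    using arg_cong[OF eq, of "\<lambda>p. coeff p k"] by (simp add: coeff_avg_orth coeff_orth)
  then show ?thesis using eq by simp
qed

subsection \<open>The contraction factors\<close>

lemma frame_form_complement:
  assumes b: "frame b" and I: "I \<subseteq> {..<n}"
  shows "frame_form b ({..<n} - I) x y = - frame_form b I x y"
proof -
  have "dot n x y = (\<Sum>i\<in>{..<n} - I. dot n x (b i) * dot n y (b i)) + (\<Sum>i\<in>I. dot n x (b i) * dot n y (b i))"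
    using frame_Parseval[OF b, of x y] sum.subset_diff[OF I] by simp
  then show ?thesis by (simp add: frame_form_def)
qed

text \<open>Exchanging the set of flipped frame vectors with its complement changes the sign of the form.\<close>
lemma contraction_odd: assumes k: "odd k" shows "contraction k = 0"
proof -
  define a where "a I = (\<integral>\<omega>. ((gform I \<omega> e0 e0 + gform I \<omega> e1 e1) / 2) ^ k \<partial>\<Omega>)" for I
  have neg: "a ({..<n} - I) = - a I" if I: "I \<subseteq> {..<n}" for I
  proof -
    have "a ({..<n} - I) = (\<integral>\<omega>. - (((gform I \<omega> e0 e0 + gform I \<omega> e1 e1) / 2) ^ k) \<partial>\<Omega>)"
      unfolding a_def
    proof (rule integral_cong_AE)
      show "AE \<omega> in \<Omega>. ((gform ({..<n} - I) \<omega> e0 e0 + gform ({..<n} - I) \<omega> e1 e1) / 2) ^ k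
          = - (((gform I \<omega> e0 e0 + gform I \<omega> e1 e1) / 2) ^ k)"
        using AE_frame_gram
      proof eventually_elim
        case (elim \<omega>)
        have "(- s + - t) / 2 = - ((s + t) / 2)" for s t :: real by (simp add: field_simps)
        then show ?case by (simp only: frame_form_complement[OF elim I] power_minus_odd[OF k])
      qed
      show "(\<lambda>\<omega>. - (((gform I \<omega> e0 e0 + gform I \<omega> e1 e1) / 2) ^ k)) \<in> borel_measurable \<Omega>"
        by (intro borel_measurable_uminus borel_measurable_power borel_measurable_divide borel_measurable_add
            borel_measurable_const gform_measurable_const I e_sphere)
      show "(\<lambda>\<omega>. ((gform ({..<n} - I) \<omega> e0 e0 + gform ({..<n} - I) \<omega> e1 e1) / 2) ^ k) \<in> borel_measurable \<Omega>"
        by (intro borel_measurable_power borel_measurable_divide borel_measurable_add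
            borel_measurable_const gform_measurable_const e_sphere) auto
    qed
    then show ?thesis by (simp add: a_def)
  qed
  have "(\<Sum>I\<in>Pow {..<n}. a I) = (\<Sum>I\<in>Pow {..<n}. a ({..<n} - I))"
    by (rule sum.reindex_bij_witness[of _ "\<lambda>I. {..<n} - I" "\<lambda>I. {..<n} - I"]) (auto simp: double_diff)
  also have "\<dots> = - (\<Sum>I\<in>Pow {..<n}. a I)" by (simp add: neg sum_negf)
  finally show ?thesis by (simp add: contraction_def a_def[symmetric])
qed

lemma contraction_even_nonneg: "even k \<Longrightarrow> 0 \<le> contraction k"
  unfolding contraction_def
  by (intro divide_nonneg_pos sum_nonneg Bochner_Integration.integral_nonneg) (auto simp: zero_le_even_power)

text \<open>The quadratic form of a frame reflection in a uniformly distributed point is the signed sum of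
  the squared coordinates of such a point.\<close>
lemma integral_frame_form:
  assumes b: "frame b" and I: "I \<subseteq> {..<n}"
  shows "(\<integral>x. frame_form b I x x ^ k \<partial>\<sigma>) = (\<integral>x. sgn_form I x ^ k \<partial>\<sigma>)"
proof -
  define T where "T x = (\<lambda>i. if i < n then dot n x (b i) else 0)" for x
  have dT: "dot n (T x) (T y) = dot n x y" for x y
    unfolding frame_Parseval[OF b, of x y] dot_def[of n "T x"] by (intro sum.cong refl) (simp add: T_def)
  have T: "orthogonal_map n T" by (auto simp: orthogonal_map_def dT) (simp add: Rn_iff T_def)
  have "(\<lambda>x. T x i) \<in> borel_measurable \<sigma>" for i
  proof (cases "i < n")
    case True
    then have [measurable]: "(\<lambda>_. b i) \<in> measurable \<sigma> \<sigma>" using b by (intro const_measurable) (simp add: frame_def)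
    show ?thesis using True by (simp add: T_def)
  qed (simp add: T_def)
  then have meas: "T \<in> measurable \<sigma> \<sigma>" by (rule orthogonal_map_measurable[OF T])
  have "frame_form b I x x = sgn_form I (T x)" for x
  proof -
    have "sgn_form I (T x) = (\<Sum>l<n. (dot n x (b l))\<^sup>2 - (if l \<in> I then 2 * (dot n x (b l))\<^sup>2 else 0))"
      unfolding sgn_form_def by (intro sum.cong) (auto simp: sgn_of_def T_def)
    also have "\<dots> = dot n x x - (\<Sum>l\<in>I. 2 * (dot n x (b l))\<^sup>2)"
      using I by (simp add: sum_subtractf frame_Parseval[OF b, of x x] power2_eq_square sum.If_cases Int_absorb1)
    finally show ?thesis by (simp add: frame_form_def sum_distrib_left power2_eq_square)
  qed
  then have "(\<integral>x. frame_form b I x x ^ k \<partial>\<sigma>) = (\<integral>x. sgn_form I (T x) ^ k \<partial>\<sigma>)" by simp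
  also have "\<dots> = (\<integral>x. sgn_form I x ^ k \<partial>\<sigma>)"
    by (rule integral_orthogonal[OF T meas, where F = "\<lambda>x. sgn_form I x ^ k"]) measurable
  finally show ?thesis .
qed

lemma integral_gform_sgn_form:
  assumes I: "I \<subseteq> {..<n}" and x: "x \<in> unit_sphere n"
  shows "(\<integral>\<omega>. gform I \<omega> x x ^ k \<partial>\<Omega>) = (\<integral>z. sgn_form I z ^ k \<partial>\<sigma>)"
proof -
  have same: "(\<integral>\<omega>. gform I \<omega> z z ^ k \<partial>\<Omega>) = (\<integral>\<omega>. gform I \<omega> x x ^ k \<partial>\<Omega>)" if "z \<in> unit_sphere n" for z
    using that x by (simp add: gform_zonal[OF I] sphere_iff)
  have "(\<integral>\<omega>. gform I \<omega> x x ^ k \<partial>\<Omega>) = (\<integral>z. (\<integral>\<omega>. gform I \<omega> x x ^ k \<partial>\<Omega>) \<partial>\<sigma>)" by (simp add: prob_space)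
  also have "\<dots> = (\<integral>z. (\<integral>\<omega>. gform I \<omega> z z ^ k \<partial>\<Omega>) \<partial>\<sigma>)"
    by (rule Bochner_Integration.integral_cong[OF refl]) (simp add: same space_\<sigma>)
  also have "\<dots> = (\<integral>\<omega>. (\<integral>z. gform I \<omega> z z ^ k \<partial>\<sigma>) \<partial>\<Omega>)"
  proof (rule bounded_Fubini[OF prob_space_axioms prob_space_\<Omega>, where C = 1])
    show "(\<lambda>m. gform I (snd m) (fst m) (fst m) ^ k) \<in> borel_measurable (\<sigma> \<Otimes>\<^sub>M \<Omega>)"
      by (intro borel_measurable_power gform_measurable I measurable_fst measurable_snd)
    show "\<bar>gform I \<omega> z z ^ k\<bar> \<le> 1" if "z \<in> space \<sigma>" "\<omega> \<in> space \<Omega>" for z \<omega>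
      using that by (intro abs_power_le_1 gform_le I) (auto simp: space_\<sigma>)
  qed
  also have "\<dots> = (\<integral>\<omega>. (\<integral>z. sgn_form I z ^ k \<partial>\<sigma>) \<partial>\<Omega>)"
  proof (rule integral_cong_AE)
    show "AE \<omega> in \<Omega>. (\<integral>z. gform I \<omega> z z ^ k \<partial>\<sigma>) = (\<integral>z. sgn_form I z ^ k \<partial>\<sigma>)"
      using AE_frame_gram by eventually_elim (rule integral_frame_form[OF _ I])
    show "(\<lambda>\<omega>. \<integral>z. gform I \<omega> z z ^ k \<partial>\<sigma>) \<in> borel_measurable \<Omega>"
      by (rule borel_measurable_lebesgue_integral, unfold case_prod_unfold,
          intro borel_measurable_power gform_measurable I measurable_fst measurable_snd)
  qed simp
  also have "\<dots> = (\<integral>z. sgn_form I z ^ k \<partial>\<sigma>)" using prob_space.prob_space[OF prob_space_\<Omega>] by simp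
  finally show ?thesis .
qed

text \<open>Convexity of the even power separates the two diagonal values of the form. Each of them has the law
  of the form of a fixed frame in a random point, because only the relative position of frame and
  point matters.\<close>
lemma contraction_even: assumes k: "even k" shows "contraction k \<le> sgn_moment k"
proof -
  have "(\<integral>\<omega>. ((gform I \<omega> e0 e0 + gform I \<omega> e1 e1) / 2) ^ k \<partial>\<Omega>) \<le> (\<integral>z. sgn_form I z ^ k \<partial>\<sigma>)"
    if "I \<in> Pow {..<n}" for I
  proof -
    have I: "I \<subseteq> {..<n}" using that by simp
    have int: "integrable \<Omega> (\<lambda>\<omega>. gform I \<omega> x x ^ k)" if "x \<in> unit_sphere n" for x
      using integrable_poly_gform[OF I that that, of "monom 1 k"] by (simp add: poly_monom)
    have "(\<integral>\<omega>. ((gform I \<omega> e0 e0 + gform I \<omega> e1 e1) / 2) ^ k \<partial>\<Omega>)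
        \<le> (\<integral>\<omega>. (gform I \<omega> e0 e0 ^ k + gform I \<omega> e1 e1 ^ k) / 2 \<partial>\<Omega>)"
    proof (rule integral_mono)
      show "integrable \<Omega> (\<lambda>\<omega>. ((gform I \<omega> e0 e0 + gform I \<omega> e1 e1) / 2) ^ k)"
      proof (rule integrable_\<Omega>[of _ 1])
        show "(\<lambda>\<omega>. ((gform I \<omega> e0 e0 + gform I \<omega> e1 e1) / 2) ^ k) \<in> borel_measurable \<Omega>"
          by (intro borel_measurable_power borel_measurable_divide borel_measurable_add
            borel_measurable_const gform_measurable_const I e_sphere)
        show "\<bar>((gform I \<omega> e0 e0 + gform I \<omega> e1 e1) / 2) ^ k\<bar> \<le> 1" if w: "\<omega> \<in> space \<Omega>" for \<omega>
          using gform_le[OF I w e_sphere(1) e_sphere(1)] gform_le[OF I w e_sphere(2) e_sphere(2)]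
          by (intro abs_power_le_1) (simp add: abs_le_iff)
      qed
      show "integrable \<Omega> (\<lambda>\<omega>. (gform I \<omega> e0 e0 ^ k + gform I \<omega> e1 e1 ^ k) / 2)"
        using int e_sphere by simp
      show "((gform I \<omega> e0 e0 + gform I \<omega> e1 e1) / 2) ^ k \<le> (gform I \<omega> e0 e0 ^ k + gform I \<omega> e1 e1 ^ k) / 2" for \<omega>
        using convex_onD[OF convex_power_even[OF k], of "1/2" "gform I \<omega> e0 e0" "gform I \<omega> e1 e1"]
        by (simp add: field_simps)
    qed
    also have "\<dots> = (\<integral>z. sgn_form I z ^ k \<partial>\<sigma>)"
      using int e_sphere by (simp add: integral_gform_sgn_form[OF I])
    finally show ?thesis .
  qed
  then show ?thesis unfolding contraction_def sgn_moment_def by (intro divide_right_mono sum_mono) auto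
qed

subsection \<open>Choosing the frames\<close>

lemma energy_gform_average:
  assumes g: "bounded_meas g" and I: "I \<subseteq> {..<n}"
  shows "(\<integral>\<omega>. energy (\<lambda>x y. poly p (gform I \<omega> x y)) g \<partial>\<Omega>) = energy (\<lambda>x y. \<integral>\<omega>. poly p (gform I \<omega> x y) \<partial>\<Omega>) g"
    and integrable_energy_gform: "integrable \<Omega> (\<lambda>\<omega>. energy (\<lambda>x y. poly p (gform I \<omega> x y)) g)"
proof -
  obtain C where C: "0 \<le> C" and gC: "\<forall>x\<in>unit_sphere n. \<bar>g x\<bar> \<le> C" using bounded_meas_bound[OF g] by blast
  note gm = bounded_measD[OF g]
  let ?K = "\<lambda>\<omega> x y. poly p (gform I \<omega> x y)"
  have K_le: "\<bar>?K \<omega> x y * g y\<bar> \<le> poly_bound p * C"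
    if "\<omega> \<in> space \<Omega>" "x \<in> unit_sphere n" "y \<in> unit_sphere n" for \<omega> x y
    unfolding abs_mult using gC that by (intro mult_mono poly_abs_le gform_le I poly_bound_nonneg) auto
  have K_sec: "(\<lambda>y. ?K \<omega> x y * g y) \<in> borel_measurable \<sigma>" if "\<omega> \<in> space \<Omega>" "x \<in> unit_sphere n" for \<omega> x
    using that by (intro borel_measurable_times gm poly_gform_measurable I measurable_const const_measurable) auto
  have op_meas: "(\<lambda>m. kernel_op (?K (fst m)) g (snd m)) \<in> borel_measurable (\<Omega> \<Otimes>\<^sub>M \<sigma>)"
    unfolding kernel_op_def
  proof (rule borel_measurable_lebesgue_integral)
    show "(\<lambda>(m, y). ?K (fst m) (snd m) y * g y) \<in> borel_measurable ((\<Omega> \<Otimes>\<^sub>M \<sigma>) \<Otimes>\<^sub>M \<sigma>)"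
      unfolding case_prod_unfold
      by (intro borel_measurable_times measurable_compose[OF measurable_snd gm] poly_gform_measurable I
          measurable_compose[OF measurable_fst measurable_fst] measurable_compose[OF measurable_fst measurable_snd] measurable_snd)
  qed
  have op_le: "\<bar>kernel_op (?K \<omega>) g x\<bar> \<le> poly_bound p * C" if "\<omega> \<in> space \<Omega>" "x \<in> unit_sphere n" for \<omega> x
    unfolding kernel_op_def by (rule integral_sphere_abs_le[OF K_sec[OF that] K_le[OF that]])
  have F_meas: "(\<lambda>m. g (snd m) * kernel_op (?K (fst m)) g (snd m)) \<in> borel_measurable (\<Omega> \<Otimes>\<^sub>M \<sigma>)"
    by (intro borel_measurable_times op_meas measurable_compose[OF measurable_snd gm])
  have F_le: "\<bar>g x * kernel_op (?K \<omega>) g x\<bar> \<le> C * (poly_bound p * C)" if "\<omega> \<in> space \<Omega>" "x \<in> unit_sphere n" for \<omega> x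
    unfolding abs_mult using gC that C op_le[OF that] by (intro mult_mono) auto
  have "(\<integral>\<omega>. energy (?K \<omega>) g \<partial>\<Omega>) = (\<integral>x. (\<integral>\<omega>. g x * kernel_op (?K \<omega>) g x \<partial>\<Omega>) \<partial>\<sigma>)"
    unfolding energy_def
    by (rule bounded_Fubini[OF prob_space_\<Omega> prob_space_axioms F_meas F_le]) (auto simp: space_\<sigma>)
  also have "\<dots> = energy (\<lambda>x y. \<integral>\<omega>. ?K \<omega> x y \<partial>\<Omega>) g"
    unfolding energy_def
  proof (intro Bochner_Integration.integral_cong refl)
    fix x assume "x \<in> space \<sigma>"
    then have x: "x \<in> unit_sphere n" by (simp add: space_\<sigma>)
    have "(\<integral>\<omega>. kernel_op (?K \<omega>) g x \<partial>\<Omega>) = (\<integral>y. (\<integral>\<omega>. ?K \<omega> x y * g y \<partial>\<Omega>) \<partial>\<sigma>)"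
      unfolding kernel_op_def
    proof (rule bounded_Fubini[OF prob_space_\<Omega> prob_space_axioms, where C = "poly_bound p * C"])
      show "(\<lambda>m. ?K (fst m) x (snd m) * g (snd m)) \<in> borel_measurable (\<Omega> \<Otimes>\<^sub>M \<sigma>)"
        by (intro borel_measurable_times measurable_compose[OF measurable_snd gm] poly_gform_measurable I
            measurable_fst measurable_snd const_measurable x)
    qed (use K_le x in \<open>auto simp: space_\<sigma>\<close>)
    then show "(\<integral>\<omega>. g x * kernel_op (?K \<omega>) g x \<partial>\<Omega>) = g x * kernel_op (\<lambda>x y. \<integral>\<omega>. ?K \<omega> x y \<partial>\<Omega>) g x"
      by (simp add: kernel_op_def)
  qed
  finally show "(\<integral>\<omega>. energy (?K \<omega>) g \<partial>\<Omega>) = energy (\<lambda>x y. \<integral>\<omega>. ?K \<omega> x y \<partial>\<Omega>) g" .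
  show "integrable \<Omega> (\<lambda>\<omega>. energy (?K \<omega>) g)"
  proof (rule integrable_\<Omega>[of _ "C * (poly_bound p * C)"])
    show "(\<lambda>\<omega>. energy (?K \<omega>) g) \<in> borel_measurable \<Omega>"
      unfolding energy_def
      by (rule borel_measurable_lebesgue_integral) (use F_meas in \<open>simp add: case_prod_unfold\<close>)
    show "\<bar>energy (?K \<omega>) g\<bar> \<le> C * (poly_bound p * C)" if w: "\<omega> \<in> space \<Omega>" for \<omega>
      unfolding energy_def
    proof (rule integral_sphere_abs_le[OF _ F_le[OF w]])
      show "(\<lambda>x. g x * kernel_op (?K \<omega>) g x) \<in> borel_measurable \<sigma>"
        using measurable_compose[OF measurable_Pair1'[OF w] F_meas] by simp
    qed
  qed
qed

lemma kernel_gform_average: assumes I: "I \<subseteq> {..<n}" shows "kernel (\<lambda>x y. \<integral>\<omega>. poly p (gform I \<omega> x y) \<partial>\<Omega>)"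
proof (rule kernelI)
  have sf: "sigma_finite_measure \<Omega>" using prob_space_\<Omega> by (simp add: prob_space_imp_sigma_finite)
  show "(\<lambda>m. \<integral>\<omega>. poly p (gform I \<omega> (fst m) (snd m)) \<partial>\<Omega>) \<in> borel_measurable (\<sigma> \<Otimes>\<^sub>M \<sigma>)"
  proof (rule sigma_finite_measure.borel_measurable_lebesgue_integral[OF sf])
    show "(\<lambda>(m, \<omega>). poly p (gform I \<omega> (fst m) (snd m))) \<in> borel_measurable ((\<sigma> \<Otimes>\<^sub>M \<sigma>) \<Otimes>\<^sub>M \<Omega>)"
      unfolding case_prod_unfold
      by (intro poly_gform_measurable I measurable_compose[OF measurable_fst measurable_fst]
          measurable_compose[OF measurable_fst measurable_snd] measurable_snd)
  qed
  show "\<bar>\<integral>\<omega>. poly p (gform I \<omega> x y) \<partial>\<Omega>\<bar> \<le> poly_bound p" if "x \<in> unit_sphere n" "y \<in> unit_sphere n" for x y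
    by (rule abs_integral_poly_gform_le[OF I that])
qed

lemma poly_energy_smult: "poly_energy (smult c p) g = c * poly_energy p g"
  by (simp add: energy_cmult)

text \<open>The expected energy after a random batch is the energy of the averaged kernel, so some frame does
  at least as well.\<close>
lemma exists_good_frame:
  assumes g: "bounded_meas g" and S: "finite S"
  shows "\<exists>b. frame b \<and> (\<Sum>k\<in>S. v k * poly_energy (orth k) (batch b g)) \<le> (\<Sum>k\<in>S. v k * contraction k * poly_energy (orth k) g)"
proof (rule ccontr)
  assume contra: "\<not> ?thesis"
  let ?R = "\<Sum>k\<in>S. v k * contraction k * poly_energy (orth k) g"
  \<comment> \<open>The weighted sum of the energies after the batch along the random frame.\<close>
  define \<Psi> where "\<Psi> \<omega> = (\<Sum>k\<in>S. v k * ((\<Sum>I\<in>Pow {..<n}. energy (\<lambda>x y. poly (orth k) (gform I \<omega> x y)) g) / 2 ^ n))" for \<omega>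
  have int: "integrable \<Omega> (\<lambda>\<omega>. energy (\<lambda>x y. poly p (gform I \<omega> x y)) g)" if "I \<in> Pow {..<n}" for I p
    using that by (intro integrable_energy_gform g) auto
  have int_sum: "integrable \<Omega> (\<lambda>\<omega>. v k * ((\<Sum>I\<in>Pow {..<n}. energy (\<lambda>x y. poly (orth k) (gform I \<omega> x y)) g) / 2 ^ n))" for k
    by (intro integrable_mult_right integrable_divide Bochner_Integration.integrable_sum int)
  have "integrable \<Omega> \<Psi>" unfolding \<Psi>_def by (intro Bochner_Integration.integrable_sum int_sum)
  moreover have "AE \<omega> in \<Omega>. ?R < \<Psi> \<omega>"
    using AE_frame_gram
  proof eventually_elim
    case (elim \<omega>)
    then show ?case using contra by (auto simp: \<Psi>_def energy_batch[OF elim g] not_le)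
  qed
  ultimately have "?R < (\<integral>\<omega>. \<Psi> \<omega> \<partial>\<Omega>)" by (rule prob_space.expectation_greater[OF prob_space_\<Omega>])
  moreover have "(\<integral>\<omega>. \<Psi> \<omega> \<partial>\<Omega>) = ?R"
  proof -
    have "(\<integral>\<omega>. \<Psi> \<omega> \<partial>\<Omega>) = (\<Sum>k\<in>S. v k * ((\<Sum>I\<in>Pow {..<n}. energy (\<lambda>x y. \<integral>\<omega>. poly (orth k) (gform I \<omega> x y) \<partial>\<Omega>) g) / 2 ^ n))"
    proof -
      have "(\<integral>\<omega>. \<Psi> \<omega> \<partial>\<Omega>) = (\<Sum>k\<in>S. \<integral>\<omega>. v k * ((\<Sum>I\<in>Pow {..<n}. energy (\<lambda>x y. poly (orth k) (gform I \<omega> x y)) g) / 2 ^ n) \<partial>\<Omega>)"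
        unfolding \<Psi>_def by (rule Bochner_Integration.integral_sum) (rule int_sum)
      also have "\<dots> = (\<Sum>k\<in>S. v k * ((\<Sum>I\<in>Pow {..<n}. \<integral>\<omega>. energy (\<lambda>x y. poly (orth k) (gform I \<omega> x y)) g \<partial>\<Omega>) / 2 ^ n))"
        using int by (simp add: Bochner_Integration.integral_sum)
      finally show ?thesis by (simp add: energy_gform_average[OF g])
    qed
    also have "\<dots> = ?R"
    proof (rule sum.cong[OF refl])
      fix k
      have "(\<Sum>I\<in>Pow {..<n}. energy (\<lambda>x y. \<integral>\<omega>. poly (orth k) (gform I \<omega> x y) \<partial>\<Omega>) g) / 2 ^ n
          = (1 / 2 ^ n) * energy (\<lambda>x y. \<Sum>I\<in>Pow {..<n}. \<integral>\<omega>. poly (orth k) (gform I \<omega> x y) \<partial>\<Omega>) g"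
        by (subst energy_sum) (auto intro: kernel_gform_average g)
      also have "\<dots> = energy (\<lambda>x y. (1 / 2 ^ n) * (\<Sum>I\<in>Pow {..<n}. \<integral>\<omega>. poly (orth k) (gform I \<omega> x y) \<partial>\<Omega>)) g"
        by (rule energy_cmult[symmetric])
      also have "\<dots> = poly_energy (avg_poly (orth k)) g"
        by (rule energy_cong) (simp add: poly_avg_poly)
      also have "\<dots> = contraction k * poly_energy (orth k) g" by (simp only: avg_orth poly_energy_smult)
      finally show "v k * ((\<Sum>I\<in>Pow {..<n}. energy (\<lambda>x y. \<integral>\<omega>. poly (orth k) (gform I \<omega> x y) \<partial>\<Omega>) g) / 2 ^ n)
          = v k * contraction k * poly_energy (orth k) g" by simp
    qed
    finally show ?thesis .
  qed
  ultimately show False by simp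
qed

text \<open>The frames are chosen one after the other. The weights in the choice of a frame anticipate the
  contraction by the frames still to come.\<close>
lemma exists_good_frames:
  assumes "bounded_meas g" and S: "finite S"
  shows "\<exists>bs. length bs = m \<and> (\<forall>b\<in>set bs. frame b) \<and>
    (\<Sum>k\<in>S. w k * poly_energy (orth k) (fold batch bs g)) \<le> (\<Sum>k\<in>S. w k * contraction k ^ m * poly_energy (orth k) g)"
  using assms(1)
proof (induction m arbitrary: g)
  case 0
  show ?case by (intro exI[of _ "[]"]) simp
next
  case (Suc m)
  obtain b where b: "frame b"
    and le: "(\<Sum>k\<in>S. (w k * contraction k ^ m) * poly_energy (orth k) (batch b g))
      \<le> (\<Sum>k\<in>S. (w k * contraction k ^ m) * contraction k * poly_energy (orth k) g)"
    using exists_good_frame[OF Suc.prems S, of "\<lambda>k. w k * contraction k ^ m"] by blast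
  obtain bs where bs: "length bs = m" "\<forall>b\<in>set bs. frame b"
    and le': "(\<Sum>k\<in>S. w k * poly_energy (orth k) (fold batch bs (batch b g)))
      \<le> (\<Sum>k\<in>S. w k * contraction k ^ m * poly_energy (orth k) (batch b g))"
    using Suc.IH[OF bounded_meas_batch[OF b Suc.prems]] by blast
  show ?case
    using b bs order_trans[OF le' le] by (intro exI[of _ "b # bs"]) (simp add: mult_ac)
qed

end

section \<open>Smoothing by even powers of the scalar product\<close>

lemma sum_sq_le_weighted:
  fixes a u v :: "'a \<Rightarrow> real"
  assumes "\<And>k. k \<in> S \<Longrightarrow> 0 \<le> u k" "\<And>k. k \<in> S \<Longrightarrow> 0 \<le> v k" "\<And>k. k \<in> S \<Longrightarrow> (a k)\<^sup>2 \<le> u k * v k"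
  shows "(\<Sum>k\<in>S. a k)\<^sup>2 \<le> (\<Sum>k\<in>S. u k) * (\<Sum>k\<in>S. v k)"
proof -
  have "\<bar>a k\<bar> \<le> sqrt (u k) * sqrt (v k)" if "k \<in> S" for k
    using real_sqrt_le_mono[OF assms(3)[OF that]] by (simp add: real_sqrt_mult)
  then have "\<bar>\<Sum>k\<in>S. a k\<bar> \<le> (\<Sum>k\<in>S. sqrt (u k) * sqrt (v k))"
    by (intro order_trans[OF sum_abs] sum_mono) auto
  then have "(\<Sum>k\<in>S. a k)\<^sup>2 \<le> (\<Sum>k\<in>S. sqrt (u k) * sqrt (v k))\<^sup>2"
    by (metis abs_ge_zero power2_abs power_mono)
  also have "\<dots> \<le> (\<Sum>k\<in>S. (sqrt (u k))\<^sup>2) * (\<Sum>k\<in>S. (sqrt (v k))\<^sup>2)"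
    by (rule Cauchy_Schwarz_ineq_sum)
  also have "\<dots> = (\<Sum>k\<in>S. u k) * (\<Sum>k\<in>S. v k)" using assms by simp
  finally show ?thesis .
qed

context sphere_measure
begin

text \<open>The kernel is even and of total mass one, and for large \<open>d\<close> it is concentrated where the scalar
  product is close to \<open>1\<close> or \<open>- 1\<close>.\<close>
definition smooth :: "nat \<Rightarrow> ((nat \<Rightarrow> real) \<Rightarrow> real) \<Rightarrow> (nat \<Rightarrow> real) \<Rightarrow> real" where
  "smooth d f x = kernel_op (\<lambda>x y. dot n x y ^ (2 * d)) f x / coord_moment (2 * d)"

lemma kernel_power: "kernel (\<lambda>x y. dot n x y ^ N)"
  using kernel_poly[of "monom 1 N"] by (simp add: poly_monom)

lemma integral_dot_power: "x \<in> unit_sphere n \<Longrightarrow> (\<integral>y. dot n x y ^ N \<partial>\<sigma>) = coord_moment N"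
  using integral_dot[of "\<lambda>t. t ^ N" x] by (simp add: coord_moment_def)

lemma enorm_diff_sphere:
  assumes "x \<in> unit_sphere n" "y \<in> unit_sphere n"
  shows "enorm n (\<lambda>i. x i - y i) = sqrt (2 - 2 * dot n x y)"
  using assms by (simp add: enorm_def dot_minus_left dot_minus_right sphere_iff dot_commute[of n y x])

text \<open>The even kernel is concentrated near \<open>x\<close> and \<open>- x\<close>, where an even Lipschitz function is close to
  its value at \<open>x\<close>.\<close>
lemma smooth_approx:
  assumes h: "bounded_meas h"
    and lip: "\<And>x y. x \<in> unit_sphere n \<Longrightarrow> y \<in> unit_sphere n \<Longrightarrow> \<bar>h x - h y\<bar> \<le> R * enorm n (\<lambda>i. x i - y i)"
    and even: "\<And>x. x \<in> unit_sphere n \<Longrightarrow> h (\<lambda>i. - x i) = h x"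
    and R: "0 \<le> R" and q: "0 < q" "(real n - 1) / (real n + 2 * real d) \<le> q\<^sup>2 / 2"
    and x: "x \<in> unit_sphere n"
  shows "\<bar>smooth d h x - h x\<bar> \<le> R * q"
proof -
  let ?N = "2 * d"
  define Z where "Z = coord_moment ?N"
  have Z: "0 < Z" unfolding Z_def by (rule coord_moment_pos)
  have sgn: "(\<lambda>i. - y i) \<in> unit_sphere n" if "y \<in> unit_sphere n" for y
    using that by (simp add: sphere_iff Rn_iff dot_uminus_left dot_uminus_right)
  have close: "\<bar>h y - h x\<bar> \<le> R * (((2 - 2 * (dot n x y)\<^sup>2) / q + q) / 2)" if y: "y \<in> unit_sphere n" for y
  proof -
    have near: "\<bar>h y - h x\<bar> \<le> R * sqrt (2 - 2 * \<bar>dot n x y\<bar>)"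
    proof (cases "0 \<le> dot n x y")
      case True
      then show ?thesis using lip[OF y x] by (simp add: enorm_diff_sphere[OF y x] dot_commute[of n y x])
    next
      case False
      then show ?thesis using lip[OF sgn[OF y] x] even[OF y]
        by (simp add: enorm_diff_sphere[OF sgn[OF y] x] dot_uminus_left dot_commute[of n y x])
    qed
    define v where "v = 2 - 2 * (dot n x y)\<^sup>2"
    have "\<bar>dot n x y\<bar> \<le> 1" by (rule sphere_dot_le[OF x y])
    then have "\<bar>dot n x y\<bar> * \<bar>dot n x y\<bar> \<le> \<bar>dot n x y\<bar> * 1" by (intro mult_left_mono) auto
    then have t: "2 - 2 * \<bar>dot n x y\<bar> \<le> v" by (simp add: v_def power2_eq_square)
    have v0: "0 \<le> v" using \<open>\<bar>dot n x y\<bar> \<le> 1\<close> by (simp add: v_def abs_square_le_1)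
    \<comment> \<open>The arithmetic--geometric mean inequality replaces the distance by a polynomial in the
      scalar product, whose integral against the kernel is a combination of moments.\<close>
    have "sqrt v \<le> (v / q + q) / 2"
    proof -
      have "0 \<le> (sqrt v - q)\<^sup>2" by simp
      then have "2 * q * sqrt v \<le> v + q * q" using v0 by (simp add: power2_diff power2_eq_square[of q] algebra_simps)
      then show ?thesis using q(1) by (simp add: field_simps)
    qed
    then have "sqrt (2 - 2 * \<bar>dot n x y\<bar>) \<le> (v / q + q) / 2"
      by (rule order_trans[OF real_sqrt_le_mono[OF t]])
    then show ?thesis using near mult_left_mono[OF _ R] by (fastforce simp: v_def)
  qed
  have int: "integrable \<sigma> (\<lambda>y. dot n x y ^ N)" for N
    using integrable_kernel[OF kernel_power bounded_meas_const[of 1] x] by simp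
  have [measurable]: "(\<lambda>_. x) \<in> measurable \<sigma> \<sigma>" by (rule const_measurable[OF x])
  have "Z * (smooth d h x - h x) = (\<integral>y. dot n x y ^ ?N * h y \<partial>\<sigma>) - (\<integral>y. dot n x y ^ ?N * h x \<partial>\<sigma>)"
    using Z by (simp add: smooth_def kernel_op_def Z_def[symmetric] integral_dot_power[OF x, of ?N] right_diff_distrib)
  also have "\<dots> = (\<integral>y. dot n x y ^ ?N * h y - dot n x y ^ ?N * h x \<partial>\<sigma>)"
    using integrable_kernel[OF kernel_power h x, of ?N] int[of ?N] by simp
  finally have eq: "Z * (smooth d h x - h x) = (\<integral>y. dot n x y ^ ?N * h y - dot n x y ^ ?N * h x \<partial>\<sigma>)" .
  have "Z * \<bar>smooth d h x - h x\<bar> = \<bar>Z * (smooth d h x - h x)\<bar>" using Z by (simp add: abs_mult)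
  also have "\<dots> = \<bar>\<integral>y. dot n x y ^ ?N * h y - dot n x y ^ ?N * h x \<partial>\<sigma>\<bar>" by (simp only: eq)
  also have "\<dots> \<le> (\<integral>y. \<bar>dot n x y ^ ?N * h y - dot n x y ^ ?N * h x\<bar> \<partial>\<sigma>)" by (rule integral_abs_bound)
  also have "\<dots> \<le> (\<integral>y. R * (dot n x y ^ ?N * (1 / q + q / 2) - dot n x y ^ (?N + 2) / q) \<partial>\<sigma>)"
  proof (rule integral_mono)
    show "integrable \<sigma> (\<lambda>y. \<bar>dot n x y ^ ?N * h y - dot n x y ^ ?N * h x\<bar>)"
      using integrable_kernel[OF kernel_power h x, of ?N] int[of ?N] by simp
    show "integrable \<sigma> (\<lambda>y. R * (dot n x y ^ ?N * (1 / q + q / 2) - dot n x y ^ (?N + 2) / q))"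
      using int[of ?N] int[of "?N + 2"] by simp
    fix y assume "y \<in> space \<sigma>"
    then have y: "y \<in> unit_sphere n" by (simp add: space_\<sigma>)
    have pos: "0 \<le> dot n x y ^ ?N" by simp
    have "\<bar>dot n x y ^ ?N * h y - dot n x y ^ ?N * h x\<bar> = dot n x y ^ ?N * \<bar>h y - h x\<bar>"
      unfolding right_diff_distrib[symmetric] abs_mult using pos by simp
    also have "\<dots> \<le> dot n x y ^ ?N * (R * (((2 - 2 * (dot n x y)\<^sup>2) / q + q) / 2))"
      by (rule mult_left_mono[OF close[OF y] pos])
    also have "\<dots> = R * (dot n x y ^ ?N * (1 / q + q / 2) - dot n x y ^ (?N + 2) / q)"
      by (simp add: power_add power2_eq_square diff_divide_distrib add_divide_distrib algebra_simps)
    finally show "\<bar>dot n x y ^ ?N * h y - dot n x y ^ ?N * h x\<bar> \<le> R * (dot n x y ^ ?N * (1 / q + q / 2) - dot n x y ^ (?N + 2) / q)" .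
  qed
  also have "\<dots> = R * (Z * (1 / q + q / 2) - coord_moment (?N + 2) / q)"
    using int[of ?N] int[of "?N + 2"] by (simp only: integral_mult_right_zero integral_mult_left_zero integral_divide_zero
        Bochner_Integration.integral_diff integrable_mult_left integrable_divide integral_dot_power[OF x] Z_def)
  also have "\<dots> \<le> R * (Z * q)"
  proof (rule mult_left_mono[OF _ R])
    have pos: "0 < real n + 2 * real d" using n_pos by simp
    have "coord_moment (?N + 2) = (2 * real d + 1) / (real n + 2 * real d) * Z"
      using coord_moment_Suc[of d] pos by (simp add: Z_def field_simps)
    then have "Z - coord_moment (?N + 2) = Z * ((real n - 1) / (real n + 2 * real d))"
      using pos by (simp add: field_simps)
    also have "\<dots> \<le> Z * (q\<^sup>2 / 2)" using q(2) Z by (intro mult_left_mono) simp_all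
    finally have "(Z - coord_moment (?N + 2)) / q \<le> Z * (q\<^sup>2 / 2) / q" using q(1) by (intro divide_right_mono) auto
    then show "Z * (1 / q + q / 2) - coord_moment (?N + 2) / q \<le> Z * q"
    proof -
      have "Z * (1 / q + q / 2) - coord_moment (?N + 2) / q = (Z - coord_moment (?N + 2)) / q + Z * q / 2"
        by (simp add: diff_divide_distrib distrib_left)
      also have "\<dots> \<le> Z * (q\<^sup>2 / 2) / q + Z * q / 2"
        using \<open>(Z - coord_moment (?N + 2)) / q \<le> Z * (q\<^sup>2 / 2) / q\<close> by (rule add_right_mono)
      also have "\<dots> = Z * q" using q(1) by (simp add: power2_eq_square)
      finally show ?thesis .
    qed
  qed
  finally have "Z * \<bar>smooth d h x - h x\<bar> \<le> Z * (R * q)" by (simp add: mult_ac)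
  then show ?thesis using Z by simp
qed

subsection \<open>Spectral bounds\<close>

text \<open>The coefficients of \<open>monom 1 N\<close> with respect to the orthogonal polynomials.\<close>
definition power_coeff :: "nat \<Rightarrow> nat \<Rightarrow> real" where
  "power_coeff N k = eig (monom 1 N) k / tau k"

text \<open>The quadratic form of the positive semidefinite kernel \<open><x, y>^N\<close> at an eigenfunction.\<close>
lemma eig_monom_nonneg: "0 \<le> eig (monom 1 N) k"
proof -
  let ?p = "poly (orth k)"
  have b: "bounded_meas (\<lambda>z. ?p (z 0))"
    using kernel_section[OF kernel_poly e_sphere(1), of "orth k"] by (simp add: dot_e)
  have "energy (\<lambda>x y. dot n x y ^ N) (\<lambda>z. ?p (z 0)) = eig (monom 1 N) k * poly_inner (orth k) (orth k)"
  proof -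
    have "kernel_op (\<lambda>x y. dot n x y ^ N) (\<lambda>z. ?p (z 0)) x = eig (monom 1 N) k * ?p (x 0)" if x: "x \<in> unit_sphere n" for x
      using poly_conv[OF x e_sphere(1), of "monom 1 N" "orth k"] by (simp add: kernel_op_def conv_orth poly_monom dot_e)
    then have "energy (\<lambda>x y. dot n x y ^ N) (\<lambda>z. ?p (z 0)) = (\<integral>x. eig (monom 1 N) k * (?p (x 0) * ?p (x 0)) \<partial>\<sigma>)"
      unfolding energy_def by (intro Bochner_Integration.integral_cong[OF refl]) (simp add: space_\<sigma>)
    then show ?thesis by (simp add: poly_inner_def)
  qed
  then have "0 \<le> eig (monom 1 N) k * poly_inner (orth k) (orth k)" using energy_power_nonneg[OF b, of N] by simp
  then show ?thesis using orth_norm_pos[of k] by (simp add: zero_le_mult_iff)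
qed

lemma power_coeff_nonneg: "0 \<le> power_coeff N k"
  using eig_monom_nonneg tau_pos[of k] by (simp add: power_coeff_def)

lemma power_coeff_eq: "poly_inner (monom 1 N) (orth k) / poly_inner (orth k) (orth k) = power_coeff N k"
  using orth_1_pos[of k] by (simp add: poly_inner_orth eig_orth power_coeff_def)

lemma monom_orth_expansion: "monom 1 N = (\<Sum>k<Suc N. smult (power_coeff N k) (orth k))"
proof -
  have "low_degree (Suc N) (monom (1::real) N)" by (simp add: low_degree_def)
  from orth_expansion[OF this] show ?thesis by (simp only: power_coeff_eq)
qed

lemma power_coeff_sum: "(\<Sum>k<Suc N. power_coeff N k * poly (orth k) 1) = 1"
  using arg_cong[OF monom_orth_expansion[of N], of "\<lambda>p. poly p 1"] by (simp add: poly_sum poly_monom)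

text \<open>Gram--Schmidt subtracts from \<open>monom 1 k\<close> a combination with nonnegative coefficients of polynomials
  that are positive at \<open>1\<close>.\<close>
lemma orth_1_le: "poly (orth k) 1 \<le> 1"
proof -
  have "orth k = monom 1 k - (\<Sum>i<k. smult (power_coeff k i) (orth i))"
    by (subst orth.simps) (simp only: power_coeff_eq)
  then have "poly (orth k) 1 = 1 - (\<Sum>i<k. power_coeff k i * poly (orth i) 1)"
    by (metis (no_types, lifting) poly_diff poly_monom poly_smult poly_sum power_one mult_1 sum.cong)
  also have "\<dots> \<le> 1" using power_coeff_nonneg orth_1_pos by (simp add: sum_nonneg less_imp_le)
  finally show ?thesis .
qed

lemma eig_monom_le: "eig (monom 1 (2 * d)) k \<le> coord_moment (2 * d)"
proof -
  have "eig (monom 1 (2 * d)) k * poly (orth k) 1 = (\<integral>z. z 0 ^ (2 * d) * poly (orth k) (z 0) \<partial>\<sigma>)"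
    by (simp add: poly_inner_orth[symmetric] poly_inner_def poly_monom)
  also have "\<dots> \<le> (\<integral>z. z 0 ^ (2 * d) * poly (orth k) 1 \<partial>\<sigma>)"
  proof (rule integral_mono)
    have b: "bounded_meas (\<lambda>z. poly p (z 0))" for p
      using kernel_section[OF kernel_poly e_sphere(1), of p] by (simp add: dot_e)
    have bm: "bounded_meas (\<lambda>z. z 0 ^ (2 * d))" using b[of "monom 1 (2 * d)"] by (simp add: poly_monom)
    show "integrable \<sigma> (\<lambda>z. z 0 ^ (2 * d) * poly (orth k) (z 0))" "integrable \<sigma> (\<lambda>z. z 0 ^ (2 * d) * poly (orth k) 1)"
      by (intro integrable_bounded_meas bounded_meas_mult[OF bm b] bounded_meas_mult[OF bm bounded_meas_const])+
    fix z assume "z \<in> space \<sigma>"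
    then have "\<bar>z 0\<bar> \<le> 1" by (simp add: space_\<sigma> sphere_coord_le[of z n 0])
    then have "poly (orth k) (z 0) \<le> poly (orth k) 1" using orth_abs_le[of "z 0" k] by (simp add: abs_le_iff)
    then show "z 0 ^ (2 * d) * poly (orth k) (z 0) \<le> z 0 ^ (2 * d) * poly (orth k) 1" by (intro mult_left_mono) auto
  qed
  also have "\<dots> = coord_moment (2 * d) * poly (orth k) 1" by (simp add: coord_moment_def)
  finally show ?thesis using orth_1_pos[of k] by simp
qed

lemma power_coeff_le: "power_coeff (2 * d) k * poly (orth k) 1 / coord_moment (2 * d) \<le> 1 / tau k"
proof -
  have "power_coeff (2 * d) k * poly (orth k) 1 \<le> power_coeff (2 * d) k * 1"
    using power_coeff_nonneg orth_1_le by (intro mult_left_mono) auto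
  also have "\<dots> \<le> coord_moment (2 * d) / tau k"
    using eig_monom_le[of d k] tau_pos[of k] by (simp add: power_coeff_def divide_right_mono)
  finally show ?thesis using coord_moment_pos[of d] by (simp add: divide_le_eq mult.commute)
qed

lemma orth_0: "orth 0 = 1"
  by (subst orth.simps) (simp add: monom_0 one_pCons)

lemma kernel_op_power_expand:
  assumes f: "bounded_meas f" and x: "x \<in> unit_sphere n"
  shows "kernel_op (\<lambda>x y. dot n x y ^ N) f x = (\<Sum>k<Suc N. power_coeff N k * poly_op (orth k) f x)"
proof -
  have "dot n x y ^ N = (\<Sum>k<Suc N. power_coeff N k * poly (orth k) (dot n x y))" for x y
    using arg_cong[OF monom_orth_expansion[of N], of "\<lambda>p. poly p (dot n x y)"] by (simp add: poly_sum poly_monom)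
  then have "kernel_op (\<lambda>x y. dot n x y ^ N) f x = kernel_op (\<lambda>x y. \<Sum>k<Suc N. power_coeff N k * poly (orth k) (dot n x y)) f x"
    by (simp only:)
  also have "\<dots> = (\<Sum>k<Suc N. kernel_op (\<lambda>x y. power_coeff N k * poly (orth k) (dot n x y)) f x)"
    by (rule kernel_op_sum) (auto intro: kernel_cmult kernel_poly f x)
  finally show ?thesis by (simp only: kernel_op_cmult)
qed

lemma energy_power_expand:
  assumes f: "bounded_meas f"
  shows "energy (\<lambda>x y. dot n x y ^ N) f = (\<Sum>k<Suc N. power_coeff N k * poly_energy (orth k) f)"
proof -
  have "dot n x y ^ N = (\<Sum>k<Suc N. power_coeff N k * poly (orth k) (dot n x y))" for x y
    using arg_cong[OF monom_orth_expansion[of N], of "\<lambda>p. poly p (dot n x y)"] by (simp add: poly_sum poly_monom)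
  then have "energy (\<lambda>x y. dot n x y ^ N) f = energy (\<lambda>x y. \<Sum>k<Suc N. power_coeff N k * poly (orth k) (dot n x y)) f"
    by (simp only:)
  also have "\<dots> = (\<Sum>k<Suc N. energy (\<lambda>x y. power_coeff N k * poly (orth k) (dot n x y)) f)"
    by (rule energy_sum) (auto intro: kernel_cmult kernel_poly f)
  finally show ?thesis by (simp only: energy_cmult)
qed

lemma energy_power_le:
  assumes f: "bounded_meas f" and R: "\<And>x. x \<in> unit_sphere n \<Longrightarrow> \<bar>f x\<bar> \<le> R"
  shows "energy (\<lambda>x y. dot n x y ^ (2 * d)) f \<le> R\<^sup>2 * coord_moment (2 * d)"
proof -
  have R0: "0 \<le> R" using R[OF e_sphere(1)] by linarith
  have "\<bar>kernel_op (\<lambda>x y. dot n x y ^ (2 * d)) f x\<bar> \<le> coord_moment (2 * d) * R" if x: "x \<in> unit_sphere n" for x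
  proof -
    have int: "integrable \<sigma> (\<lambda>y. dot n x y ^ (2 * d) * f y)" by (rule integrable_kernel[OF kernel_power f x])
    have int1: "integrable \<sigma> (\<lambda>y. dot n x y ^ (2 * d))"
      using integrable_kernel[OF kernel_power bounded_meas_const[of 1] x] by simp
    have "\<bar>kernel_op (\<lambda>x y. dot n x y ^ (2 * d)) f x\<bar> \<le> (\<integral>y. \<bar>dot n x y ^ (2 * d) * f y\<bar> \<partial>\<sigma>)"
      unfolding kernel_op_def by (rule integral_abs_bound)
    also have "\<dots> \<le> (\<integral>y. dot n x y ^ (2 * d) * R \<partial>\<sigma>)"
    proof (rule integral_mono)
      show "integrable \<sigma> (\<lambda>y. \<bar>dot n x y ^ (2 * d) * f y\<bar>)" using int by (rule integrable_abs)
      show "integrable \<sigma> (\<lambda>y. dot n x y ^ (2 * d) * R)" using int1 by simp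
      show "\<bar>dot n x y ^ (2 * d) * f y\<bar> \<le> dot n x y ^ (2 * d) * R" if "y \<in> space \<sigma>" for y
        using that R[of y] by (simp add: abs_mult space_\<sigma> mult_left_mono)
    qed
    also have "\<dots> = coord_moment (2 * d) * R" by (simp add: integral_dot_power[OF x])
    finally show ?thesis .
  qed
  then have "\<bar>f x * kernel_op (\<lambda>x y. dot n x y ^ (2 * d)) f x\<bar> \<le> R * (coord_moment (2 * d) * R)" if "x \<in> unit_sphere n" for x
    unfolding abs_mult using that R R0 by (intro mult_mono) auto
  then have "\<bar>energy (\<lambda>x y. dot n x y ^ (2 * d)) f\<bar> \<le> R * (coord_moment (2 * d) * R)"
    unfolding energy_def
    by (intro integral_sphere_abs_le bounded_measD[OF bounded_meas_mult[OF f bounded_meas_kernel_op[OF kernel_power f]]])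
  then show ?thesis by (simp add: power2_eq_square mult_ac)
qed

lemma integral_fold_sym_fun:
  assumes "set us \<subseteq> unit_sphere n" "bounded_meas g"
  shows "(\<integral>x. fold sym_fun us g x \<partial>\<sigma>) = (\<integral>x. g x \<partial>\<sigma>)"
  using assms
proof (induction us arbitrary: g)
  case (Cons u us)
  have u: "u \<in> unit_sphere n" using Cons.prems by simp
  have "(\<integral>x. sym_fun u g x \<partial>\<sigma>) = (\<integral>x. g x \<partial>\<sigma>)"
    unfolding sym_fun_def
    using integrable_bounded_meas[OF Cons.prems(2)] integrable_bounded_meas[OF bounded_meas_reflection[OF u Cons.prems(2)]]
      integral_reflection[OF u bounded_measD[OF Cons.prems(2)]] by simp
  then show ?case using Cons.IH[OF _ bounded_meas_sym_fun[OF u Cons.prems(2)]] Cons.prems(1) by simp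
qed simp

text \<open>The weights \<open>w\<close> distribute the Cauchy--Schwarz inequality over the degrees: \<open>w k\<close> has to outweigh
  the size of the kernel of degree \<open>k\<close>, while the contraction over \<open>m\<close> batches has to beat \<open>w k\<close>.\<close>
lemma exists_frames_smooth_small:
  assumes f: "bounded_meas f" and mean: "(\<integral>x. f x \<partial>\<sigma>) = 0"
    and R: "\<And>x. x \<in> unit_sphere n \<Longrightarrow> \<bar>f x\<bar> \<le> R"
    and d: "0 < d" and w: "\<And>k. 0 < w k"
    and wsum: "(\<Sum>k=1..2*d. power_coeff (2 * d) k * poly (orth k) 1 / coord_moment (2 * d) / w k) \<le> 2"
    and contr: "\<And>k. 1 \<le> k \<Longrightarrow> k \<le> 2 * d \<Longrightarrow> w k * contraction k ^ m \<le> \<eta>"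
  shows "\<exists>bs. length bs = m \<and> (\<forall>b\<in>set bs. frame b) \<and>
    (\<forall>x\<in>unit_sphere n. (smooth d (fold batch bs f) x)\<^sup>2 \<le> 2 * \<eta> * R\<^sup>2)"
proof -
  let ?Z = "coord_moment (2 * d)" and ?c = "power_coeff (2 * d)" and ?S = "{1..2*d}"
  have Z: "0 < ?Z" by (rule coord_moment_pos)
  have split: "{..<Suc (2 * d)} = insert 0 ?S" by auto
  obtain bs where bs: "length bs = m" "\<forall>b\<in>set bs. frame b"
    and en: "(\<Sum>k\<in>?S. (w k * ?c k / ?Z) * poly_energy (orth k) (fold batch bs f))
      \<le> (\<Sum>k\<in>?S. (w k * ?c k / ?Z) * contraction k ^ m * poly_energy (orth k) f)"
    using exists_good_frames[OF f, of ?S m "\<lambda>k. w k * ?c k / ?Z"] by auto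
  define f' where "f' = fold batch bs f"
  have f': "bounded_meas f' \<and> (\<integral>x. f' x \<partial>\<sigma>) = 0"
    unfolding f'_def using bs(2) f mean
  proof (induction bs arbitrary: f)
    case (Cons b bs)
    from integral_fold_sym_fun[OF frame_set[of b n] Cons.prems(2)] have "(\<integral>x. batch b f x \<partial>\<sigma>) = (\<integral>x. f x \<partial>\<sigma>)"
      using Cons.prems by (simp add: batch_def)
    then show ?case using Cons.IH[of "batch b f"] Cons.prems bounded_meas_batch by simp
  qed simp
  have e_nonneg: "0 \<le> poly_energy (orth k) g" if "bounded_meas g" for k g
    by (rule poly_energy_orth_nonneg[OF that e_sphere(1)])
  have total: "(\<Sum>k\<in>?S. ?c k / ?Z * poly_energy (orth k) f) \<le> R\<^sup>2"
  proof -
    have "(\<Sum>k\<in>?S. ?c k * poly_energy (orth k) f) \<le> energy (\<lambda>x y. dot n x y ^ (2 * d)) f"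
      unfolding energy_power_expand[OF f] split
      using power_coeff_nonneg[of "2 * d" 0] e_nonneg[OF f, of 0] by simp
    also have "\<dots> \<le> R\<^sup>2 * ?Z" by (rule energy_power_le[OF f R])
    finally have "(\<Sum>k\<in>?S. ?c k * poly_energy (orth k) f) / ?Z \<le> R\<^sup>2" using Z by (simp add: divide_le_eq)
    then show ?thesis by (simp add: sum_divide_distrib)
  qed
  have late_energy: "(\<Sum>k\<in>?S. (w k * ?c k / ?Z) * poly_energy (orth k) f') \<le> \<eta> * R\<^sup>2"
  proof -
    have "(\<Sum>k\<in>?S. (w k * ?c k / ?Z) * poly_energy (orth k) f')
        \<le> (\<Sum>k\<in>?S. (w k * ?c k / ?Z) * contraction k ^ m * poly_energy (orth k) f)"
      using en unfolding f'_def .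
    also have "\<dots> \<le> (\<Sum>k\<in>?S. \<eta> * (?c k / ?Z * poly_energy (orth k) f))"
    proof (rule sum_mono)
      fix k assume "k \<in> ?S"
      then have "(w k * contraction k ^ m) * (?c k / ?Z * poly_energy (orth k) f) \<le> \<eta> * (?c k / ?Z * poly_energy (orth k) f)"
        using contr[of k] power_coeff_nonneg Z e_nonneg[OF f] by (intro mult_right_mono) (auto simp: less_imp_le)
      then show "(w k * ?c k / ?Z) * contraction k ^ m * poly_energy (orth k) f \<le> \<eta> * (?c k / ?Z * poly_energy (orth k) f)"
        by (simp add: mult_ac)
    qed
    also have "\<dots> = \<eta> * (\<Sum>k\<in>?S. ?c k / ?Z * poly_energy (orth k) f)" by (simp add: sum_distrib_left)
    also have "\<dots> \<le> \<eta> * R\<^sup>2"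
    proof -
      have "0 \<le> w 2 * contraction 2 ^ m"
        using w[of 2] contraction_even_nonneg[of 2] by (simp add: less_imp_le)
      also have "\<dots> \<le> \<eta>" using d by (intro contr) auto
      finally show ?thesis by (rule mult_left_mono[OF total])
    qed
    finally show ?thesis .
  qed
  have late_energy_nonneg: "0 \<le> (\<Sum>k\<in>?S. (w k * ?c k / ?Z) * poly_energy (orth k) f')"
    using power_coeff_nonneg Z w f' e_nonneg by (intro sum_nonneg) (simp add: less_imp_le)
  have "(smooth d f' x)\<^sup>2 \<le> 2 * \<eta> * R\<^sup>2" if x: "x \<in> unit_sphere n" for x
  proof -
    have expand: "smooth d f' x = (\<Sum>k\<in>?S. ?c k * poly_op (orth k) f' x / ?Z)"
    proof -
      have "poly_op (orth 0) f' x = 0" using f' by (simp add: orth_0 kernel_op_def)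
      then show ?thesis
        unfolding smooth_def kernel_op_power_expand[OF conjunct1[OF f'] x] split by (simp add: sum_divide_distrib)
    qed
    have "(smooth d f' x)\<^sup>2
        \<le> (\<Sum>k\<in>?S. ?c k * poly (orth k) 1 / ?Z / w k) * (\<Sum>k\<in>?S. (w k * ?c k / ?Z) * poly_energy (orth k) f')"
      unfolding expand
    proof (rule sum_sq_le_weighted)
      fix k
      show "0 \<le> ?c k * poly (orth k) 1 / ?Z / w k"
        using power_coeff_nonneg orth_1_pos Z w by (simp add: less_imp_le)
      show "0 \<le> (w k * ?c k / ?Z) * poly_energy (orth k) f'"
        using power_coeff_nonneg Z w f' e_nonneg by (simp add: less_imp_le)
      have "(?c k * poly_op (orth k) f' x / ?Z)\<^sup>2 = (?c k / ?Z)\<^sup>2 * (poly_op (orth k) f' x)\<^sup>2"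
        by (simp add: power_mult_distrib power_divide)
      also have "\<dots> \<le> (?c k / ?Z)\<^sup>2 * (poly (orth k) 1 * poly_energy (orth k) f')"
        using f' x by (intro mult_left_mono poly_op_orth_bound) auto
      also have "\<dots> = (?c k * poly (orth k) 1 / ?Z / w k) * ((w k * ?c k / ?Z) * poly_energy (orth k) f')"
        using w[of k] by (simp add: power2_eq_square)
      finally show "(?c k * poly_op (orth k) f' x / ?Z)\<^sup>2
          \<le> (?c k * poly (orth k) 1 / ?Z / w k) * ((w k * ?c k / ?Z) * poly_energy (orth k) f')" .
    qed
    also have "\<dots> \<le> 2 * (\<eta> * R\<^sup>2)"
      by (rule mult_mono[OF wsum late_energy _ late_energy_nonneg]) simp
    finally show ?thesis by (simp add: mult.assoc)
  qed
  then show ?thesis using bs unfolding f'_def by blast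
qed

end

section \<open>Convex bodies and their support functions\<close>

text \<open>Compactness refers to the product topology of the function space, which induces the Euclidean one
  on \<open>Rn n\<close>.\<close>
definition regular_body :: "nat \<Rightarrow> (nat \<Rightarrow> real) set \<Rightarrow> bool" where
  "regular_body n K \<longleftrightarrow> compact K \<and> K \<subseteq> Rn n \<and> K \<noteq> {} \<and> convex_in_Rn K"

lemma convex_body_regular:
  assumes "convex_body n K" shows "regular_body n K"
proof -
  have "compactin (subtopology (powertop_real UNIV) (Rn n)) K"
    using assms by (simp add: convex_body_def Euclidean_space_def topspace_Euclidean_space)
  then have "compact K" "K \<subseteq> Rn n"
    by (simp_all add: compactin_subtopology euclidean_product_topology compactin_euclidean_iff)
  moreover have "K \<noteq> {}"
    using assms interior_of_subset[of "Euclidean_space n" K] by (auto simp: convex_body_def)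
  ultimately show ?thesis using assms by (simp add: regular_body_def convex_body_def)
qed

lemma normalize_sphere:
  assumes "y \<in> Rn n" "0 < enorm n y" shows "(\<lambda>i. (1 / enorm n y) * y i) \<in> unit_sphere n"
proof -
  have "dot n (\<lambda>i. (1 / enorm n y) * y i) (\<lambda>i. (1 / enorm n y) * y i) = (1 / enorm n y) * ((1 / enorm n y) * (enorm n y)\<^sup>2)"
    unfolding dot_scale_left dot_scale_right enorm_sq ..
  also have "\<dots> = 1" using assms by (simp add: power2_eq_square)
  finally show ?thesis using assms by (simp add: sphere_iff Rn_iff)
qed

lemma continuous_coord: "continuous_on S (\<lambda>x :: nat \<Rightarrow> real. x i)"
  by (rule continuous_on_subset[OF continuous_on_product_coordinates]) simp

lemma continuous_dot: "continuous_on S (\<lambda>x. dot n x u)"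
  unfolding dot_def by (intro continuous_intros continuous_coord)

lemma continuous_enorm_diff: "continuous_on S (\<lambda>x. enorm n (\<lambda>i. x i - y i))"
  unfolding enorm_def dot_def by (intro continuous_intros continuous_coord)

lemma support_fun_attained:
  assumes "regular_body n K"
  shows "\<exists>x\<in>K. dot n x u = support_fun n K u \<and> (\<forall>y\<in>K. dot n y u \<le> support_fun n K u)"
proof -
  have "compact K" "K \<noteq> {}" using assms by (simp_all add: regular_body_def)
  then obtain x where x: "x \<in> K" "\<forall>y\<in>K. dot n y u \<le> dot n x u"
    using continuous_attains_sup[OF _ _ continuous_dot] by blast
  have "support_fun n K u = dot n x u"
    unfolding support_fun_def using x by (intro cSup_eq_maximum) auto
  then show ?thesis using x by auto
qed

lemma support_fun_ge: "regular_body n K \<Longrightarrow> x \<in> K \<Longrightarrow> dot n x u \<le> support_fun n K u"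
  using support_fun_attained by blast

lemma support_fun_leI:
  assumes "regular_body n K" "\<And>x. x \<in> K \<Longrightarrow> dot n x u \<le> c" shows "support_fun n K u \<le> c"
  using support_fun_attained[OF assms(1), of u] assms(2) by force

lemma minkowski_symmetrization_eq:
  "minkowski_symmetrization n u K = (\<lambda>(a, b) i. 1 / 2 * (a i + reflection n u b i)) ` (K \<times> K)"
  by (force simp: minkowski_symmetrization_def dilate_def minkowski_sum_def)

lemma dot_symmetrization_point:
  "dot n (\<lambda>i. 1 / 2 * (a i + reflection n u b i)) x = (dot n a x + dot n b (reflection n u x)) / 2"
  unfolding dot_scale_left dot_add_left dot_reflection_swap by simp

lemma regular_body_symmetrization:
  assumes u: "u \<in> unit_sphere n" and K: "regular_body n K"
  shows "regular_body n (minkowski_symmetrization n u K)"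
proof -
  let ?f = "\<lambda>(a, b) i. 1 / 2 * (a i + reflection n u b i)"
  have cK: "compact K" and KR: "K \<subseteq> Rn n" and ne: "K \<noteq> {}" and conv: "convex_in_Rn K"
    using K by (simp_all add: regular_body_def)
  have "continuous_on (K \<times> K) ?f"
  proof (rule continuous_on_coordinatewise_then_product)
    fix i
    have c1: "continuous_on (K \<times> K) (\<lambda>p. fst p j)" "continuous_on (K \<times> K) (\<lambda>p. snd p j)" for j
      by (rule continuous_on_compose2[OF continuous_coord[of UNIV j] continuous_on_fst[OF continuous_on_id] subset_UNIV])
         (rule continuous_on_compose2[OF continuous_coord[of UNIV j] continuous_on_snd[OF continuous_on_id] subset_UNIV])
    show "continuous_on (K \<times> K) (\<lambda>x. ?f x i)"
      unfolding case_prod_unfold reflection_def dot_def by (intro continuous_intros c1)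
  qed
  then have "compact (?f ` (K \<times> K))" by (intro compact_continuous_image compact_Times cK)
  moreover have "?f p \<in> Rn n" if "p \<in> K \<times> K" for p
    using that KR reflection_Rn[OF u] by (auto simp: Rn_iff subset_iff)
  moreover have "convex_in_Rn (?f ` (K \<times> K))"
    unfolding convex_in_Rn_def
  proof (intro ballI allI impI)
    fix x y s t assume xy: "x \<in> ?f ` (K \<times> K)" "y \<in> ?f ` (K \<times> K)" and st: "0 \<le> (s::real)" "0 \<le> (t::real)" "s + t = 1"
    obtain a b where ab: "a \<in> K" "b \<in> K" "x = ?f (a, b)" using xy by auto
    obtain a' b' where ab': "a' \<in> K" "b' \<in> K" "y = ?f (a', b')" using xy by auto
    have "(\<lambda>i. s * a i + t * a' i) \<in> K" "(\<lambda>i. s * b i + t * b' i) \<in> K"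
      using conv ab ab' st by (simp_all add: convex_in_Rn_def)
    moreover have refl_eq: "reflection n u (\<lambda>i. s * b i + t * b' i) = (\<lambda>i. s * reflection n u b i + t * reflection n u b' i)"
      unfolding reflection_def dot_add_left dot_scale_left by (simp add: algebra_simps)
    have "(\<lambda>i. s * x i + t * y i) = ?f ((\<lambda>i. s * a i + t * a' i), (\<lambda>i. s * b i + t * b' i))"
      unfolding ab ab' case_prod_conv refl_eq by (simp add: fun_eq_iff field_simps)
    ultimately show "(\<lambda>i. s * x i + t * y i) \<in> ?f ` (K \<times> K)" by blast
  qed
  ultimately show ?thesis using ne unfolding regular_body_def minkowski_symmetrization_eq by auto
qed

text \<open>Minkowski addition adds support functions, and a reflection is its own adjoint.\<close>
lemma support_fun_symmetrization:
  assumes u: "u \<in> unit_sphere n" and K: "regular_body n K"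
  shows "support_fun n (minkowski_symmetrization n u K) x = (support_fun n K x + support_fun n K (reflection n u x)) / 2"
proof (rule antisym)
  note S = regular_body_symmetrization[OF u K]
  show "support_fun n (minkowski_symmetrization n u K) x \<le> (support_fun n K x + support_fun n K (reflection n u x)) / 2"
  proof (rule support_fun_leI[OF S])
    fix z assume "z \<in> minkowski_symmetrization n u K"
    then obtain a b where ab: "a \<in> K" "b \<in> K" "z = (\<lambda>i. 1 / 2 * (a i + reflection n u b i))"
      by (auto simp: minkowski_symmetrization_eq)
    have "dot n z x = (dot n a x + dot n b (reflection n u x)) / 2"
      unfolding ab(3) by (rule dot_symmetrization_point)
    also have "\<dots> \<le> (support_fun n K x + support_fun n K (reflection n u x)) / 2"
      using support_fun_ge[OF K ab(1)] support_fun_ge[OF K ab(2)] by (intro divide_right_mono add_mono) auto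
    finally show "dot n z x \<le> (support_fun n K x + support_fun n K (reflection n u x)) / 2" .
  qed
  obtain a where a: "a \<in> K" "dot n a x = support_fun n K x" using support_fun_attained[OF K, of x] by blast
  obtain b where b: "b \<in> K" "dot n b (reflection n u x) = support_fun n K (reflection n u x)"
    using support_fun_attained[OF K, of "reflection n u x"] by blast
  have "(\<lambda>i. 1 / 2 * (a i + reflection n u b i)) \<in> minkowski_symmetrization n u K"
    using a b by (force simp: minkowski_symmetrization_eq)
  from support_fun_ge[OF S this, of x]
  show "(support_fun n K x + support_fun n K (reflection n u x)) / 2 \<le> support_fun n (minkowski_symmetrization n u K) x"
    unfolding dot_symmetrization_point a b .
qed

lemma regular_body_radius:
  assumes "regular_body n K"
  shows "\<exists>y\<in>K. \<forall>x\<in>K. enorm n x \<le> enorm n y"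
proof -
  have "compact K" "K \<noteq> {}" using assms by (simp_all add: regular_body_def)
  moreover have "continuous_on K (enorm n)" using continuous_enorm_diff[of K n "\<lambda>_. 0"] by simp
  ultimately show ?thesis using continuous_attains_sup by blast
qed

lemma support_fun_Lipschitz:
  assumes K: "regular_body n K" and R: "\<And>x. x \<in> K \<Longrightarrow> enorm n x \<le> R"
  shows "\<bar>support_fun n K x - support_fun n K y\<bar> \<le> R * enorm n (\<lambda>i. x i - y i)"
proof -
  have one: "support_fun n K x - support_fun n K y \<le> R * enorm n (\<lambda>i. x i - y i)" for x y
  proof -
    obtain a where a: "a \<in> K" "dot n a x = support_fun n K x" using support_fun_attained[OF K, of x] by blast
    have "support_fun n K x - dot n a y = dot n a (\<lambda>i. x i - y i)" by (simp add: a dot_minus_right)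
    also have "\<dots> \<le> enorm n a * enorm n (\<lambda>i. x i - y i)" using dot_Cauchy_Schwarz[of n a] abs_le_D1 by blast
    also have "\<dots> \<le> R * enorm n (\<lambda>i. x i - y i)" using R[OF a(1)] enorm_nonneg by (rule mult_right_mono)
    finally show ?thesis using support_fun_ge[OF K a(1), of y] by linarith
  qed
  have "enorm n (\<lambda>i. y i - x i) = enorm n (\<lambda>i. x i - y i)"
    by (simp add: enorm_def dot_def algebra_simps)
  then show ?thesis using one[of x y] one[of y x] by (simp add: abs_le_iff)
qed

lemma support_fun_continuous:
  assumes K: "regular_body n K" shows "continuous_on UNIV (support_fun n K)"
proof -
  obtain y0 where R: "\<And>x. x \<in> K \<Longrightarrow> enorm n x \<le> enorm n y0" using regular_body_radius[OF K] by blast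
  have "isCont (support_fun n K) y" for y
  proof -
    have "continuous_on UNIV (\<lambda>x. enorm n y0 * enorm n (\<lambda>i. x i - y i))"
      by (intro continuous_intros continuous_enorm_diff)
    then have "isCont (\<lambda>x. enorm n y0 * enorm n (\<lambda>i. x i - y i)) y"
      by (simp add: continuous_on_eq_continuous_at)
    then have "((\<lambda>x. enorm n y0 * enorm n (\<lambda>i. x i - y i)) \<longlongrightarrow> enorm n y0 * enorm n (\<lambda>i. y i - y i)) (at y)"
      unfolding isCont_def .
    then have lim: "((\<lambda>x. enorm n y0 * enorm n (\<lambda>i. x i - y i)) \<longlongrightarrow> 0) (at y)"
      by (simp add: enorm_def dot_def)
    have "((\<lambda>x. support_fun n K x - support_fun n K y) \<longlongrightarrow> 0) (at y)"
      by (rule Lim_null_comparison[OF _ lim], rule always_eventually) (use support_fun_Lipschitz[OF K R] in simp)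
    then show ?thesis unfolding isCont_def by (rule LIM_zero_cancel)
  qed
  then show ?thesis by (simp add: continuous_at_imp_continuous_on)
qed

text \<open>The point of \<open>K\<close> closest to an outside point gives a separating direction.\<close>
lemma regular_body_memI:
  assumes K: "regular_body n K" and x: "x \<in> Rn n"
    and le: "\<And>u. u \<in> unit_sphere n \<Longrightarrow> dot n x u \<le> support_fun n K u"
  shows "x \<in> K"
proof (rule ccontr)
  assume "x \<notin> K"
  have cK: "compact K" and KR: "K \<subseteq> Rn n" and ne: "K \<noteq> {}" and conv: "convex_in_Rn K"
    using K by (simp_all add: regular_body_def)
  obtain y where y: "y \<in> K" "\<And>z. z \<in> K \<Longrightarrow> enorm n (\<lambda>i. y i - x i) \<le> enorm n (\<lambda>i. z i - x i)"
    using continuous_attains_inf[OF cK ne continuous_enorm_diff[of K n x]] by blast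
  define d where "d = (\<lambda>i. x i - y i)"
  have dR: "d \<in> Rn n" using x y KR by (auto simp: d_def Rn_iff)
  have "dot n d d \<noteq> 0"
  proof
    assume "dot n d d = 0"
    then have "\<forall>i<n. x i = y i" by (simp add: dot_self_0 d_def)
    then show False using \<open>x \<notin> K\<close> y(1) KR x Rn_eqI[of x n y] by auto
  qed
  then have dd: "0 < dot n d d" using dot_self_nonneg[of n d] by simp
  have sep: "dot n z d \<le> dot n y d" if z: "z \<in> K" for z
  proof (rule ccontr)
    assume "\<not> dot n z d \<le> dot n y d"
    define e where "e = (\<lambda>i. z i - y i)"
    have pos: "0 < dot n e d" using \<open>\<not> dot n z d \<le> dot n y d\<close> by (simp add: e_def dot_minus_left)
    \<comment> \<open>Moving from \<open>y\<close> towards \<open>z\<close> does not decrease the distance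
      to \<open>x\<close>; this fails for small \<open>t\<close>.\<close>
    have ineq: "2 * dot n e d \<le> t * dot n e e" if t: "0 < t" "t \<le> 1" for t
    proof -
      have "(\<lambda>i. (1 - t) * y i + t * z i) \<in> K" using conv y(1) z t by (simp add: convex_in_Rn_def)
      from y(2)[OF this] have "enorm n (\<lambda>i. y i - x i) \<le> enorm n (\<lambda>i. ((1 - t) * y i + t * z i) - x i)" .
      moreover have "(\<lambda>i. ((1 - t) * y i + t * z i) - x i) = (\<lambda>i. t * e i - d i)"
        by (simp add: e_def d_def fun_eq_iff algebra_simps)
      moreover have "(\<lambda>i. y i - x i) = (\<lambda>i. - d i)" by (simp add: d_def)
      ultimately have "(enorm n (\<lambda>i. - d i))\<^sup>2 \<le> (enorm n (\<lambda>i. t * e i - d i))\<^sup>2"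
        by (intro power_mono) (auto simp: enorm_nonneg)
      then have "dot n d d \<le> t * (t * dot n e e) - 2 * (t * dot n e d) + dot n d d"
        unfolding enorm_sq dot_uminus_left dot_uminus_right dot_minus_left dot_minus_right dot_scale_left dot_scale_right
        by (simp add: dot_commute[of n d e])
      then have "t * (2 * dot n e d) \<le> t * (t * dot n e e)" by simp
      then show ?thesis using t by simp
    qed
    define t where "t = min 1 (dot n e d / (dot n e e + 1))"
    have ee: "0 \<le> dot n e e" by (rule dot_self_nonneg)
    have t: "0 < t" "t \<le> 1" using pos ee by (auto simp: t_def)
    have "t * dot n e e \<le> dot n e d / (dot n e e + 1) * dot n e e" using ee by (intro mult_right_mono) (auto simp: t_def)
    also have "\<dots> \<le> dot n e d" using ee pos by (simp add: field_simps)
    finally show False using ineq[OF t] pos by linarith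
  qed
  define r where "r = enorm n d"
  have r: "0 < r" "r * r = dot n d d"
    using dd enorm_sq[of n d] by (auto simp: r_def enorm_def power2_eq_square)
  define u where "u = (\<lambda>i. (1 / r) * d i)"
  have u: "u \<in> unit_sphere n" unfolding u_def r_def using r by (intro normalize_sphere dR) (simp add: r_def)
  have du: "dot n z u = (1 / r) * dot n z d" for z unfolding u_def dot_scale_right ..
  have "support_fun n K u \<le> dot n y u"
    by (rule support_fun_leI[OF K]) (use sep r in \<open>simp add: du divide_right_mono\<close>)
  moreover have "dot n x u = dot n y u + (1 / r) * dot n d d"
    by (simp add: du d_def dot_minus_left diff_divide_distrib)
  moreover have "0 < (1 / r) * dot n d d" using r dd by simp
  ultimately show False using le[OF u] by linarith
qed

lemma support_fun_bound:
  assumes K: "regular_body n K" and R: "\<And>x. x \<in> K \<Longrightarrow> enorm n x \<le> R" and u: "u \<in> unit_sphere n"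
  shows "\<bar>support_fun n K u\<bar> \<le> R"
proof -
  obtain a where a: "a \<in> K" "dot n a u = support_fun n K u" using support_fun_attained[OF K, of u] by blast
  then show ?thesis using dot_Cauchy_Schwarz[of n a u] R[OF a(1)] u by (simp add: unit_sphere_def)
qed

context sphere_measure
begin

lemma regular_body_fold:
  "set us \<subseteq> unit_sphere n \<Longrightarrow> regular_body n K \<Longrightarrow>
    regular_body n (fold (minkowski_symmetrization n) us K) \<and>
    support_fun n (fold (minkowski_symmetrization n) us K) = fold sym_fun us (support_fun n K)"
proof (induction us arbitrary: K)
  case (Cons u us)
  then have u: "u \<in> unit_sphere n" by simp
  have "support_fun n (minkowski_symmetrization n u K) = sym_fun u (support_fun n K)"
    by (rule ext) (simp add: support_fun_symmetrization[OF u Cons.prems(2)] sym_fun_def)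
  then show ?case
    using Cons.IH[OF _ regular_body_symmetrization[OF u Cons.prems(2)]] Cons.prems(1) by simp
qed simp

lemma bounded_meas_support_fun: assumes K: "regular_body n K" shows "bounded_meas (support_fun n K)"
proof -
  obtain y where "\<And>x. x \<in> K \<Longrightarrow> enorm n x \<le> enorm n y" using regular_body_radius[OF K] by blast
  then show ?thesis
    by (intro bounded_measI[of _ "enorm n y"] continuous_sphere_measurable support_fun_continuous K support_fun_bound)
qed

definition even_fun :: "((nat \<Rightarrow> real) \<Rightarrow> real) \<Rightarrow> bool" where
  "even_fun h \<longleftrightarrow> (\<forall>x. h (\<lambda>i. - x i) = h x)"

lemma even_fun_fold: "even_fun h \<Longrightarrow> even_fun (fold sym_fun us h)"
proof (induction us arbitrary: h)
  case (Cons u us)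
  have "reflection n u (\<lambda>i. - x i) = (\<lambda>i. - reflection n u x i)" for x
    by (simp add: reflection_def dot_uminus_left)
  then have "even_fun (sym_fun u h)" using Cons.prems by (simp add: even_fun_def sym_fun_def)
  then show ?case using Cons.IH by simp
qed simp

definition flip_coords :: "nat set \<Rightarrow> (nat \<Rightarrow> real) \<Rightarrow> nat \<Rightarrow> real" where
  "flip_coords I x = (\<lambda>i. if i \<in> I then - x i else x i)"

lemma reflection_unit_vec:
  assumes "i < n" shows "reflection n (unit_vec i) x = flip_coords {i} x"
proof
  fix j
  have "reflection n (unit_vec i) x j = x j - 2 * x i * unit_vec i j"
    by (simp add: reflection_def dot_unit_vec[OF assms])
  then show "reflection n (unit_vec i) x j = flip_coords {i} x j"
    by (simp add: flip_coords_def unit_vec_def)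
qed

text \<open>The symmetrizations along the coordinate axes average over all coordinate sign changes, one of which
  is the reflection in the origin.\<close>
lemma fold_unit_vec_flip:
  assumes "l \<le> n" "I \<subseteq> {..<l}"
  shows "fold sym_fun (map unit_vec [0..<l]) h (flip_coords I x) = fold sym_fun (map unit_vec [0..<l]) h x"
  using assms
proof (induction l arbitrary: I x)
  case 0 then show ?case by (simp add: flip_coords_def)
next
  case (Suc l)
  let ?g = "fold sym_fun (map unit_vec [0..<l]) h"
  have l: "l < n" using Suc.prems by simp
  have IH: "?g (flip_coords J y) = ?g y" if "J \<subseteq> {..<l}" for J y using Suc.IH[of J y] that Suc.prems by simp
  define J where "J = I - {l}"
  have J: "J \<subseteq> {..<l}" using Suc.prems by (auto simp: J_def)
  have g: "fold sym_fun (map unit_vec [0..<Suc l]) h y = (?g y + ?g (flip_coords {l} y)) / 2" for y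
    by (simp add: sym_fun_def reflection_unit_vec[OF l])
  have comm: "flip_coords {l} (flip_coords J y) = flip_coords J (flip_coords {l} y)" for y
    by (auto simp: flip_coords_def)
  show ?case
  proof (cases "l \<in> I")
    case True
    have "flip_coords I x = flip_coords {l} (flip_coords J x)" "flip_coords {l} (flip_coords I x) = flip_coords J x"
      using True by (auto simp: flip_coords_def J_def fun_eq_iff)
    then show ?thesis unfolding g by (simp add: comm IH[OF J] add.commute)
  next
    case False
    then have "I = J" by (simp add: J_def)
    then show ?thesis unfolding g by (simp add: comm IH[OF J])
  qed
qed

lemma even_fun_coordinate_batch:
  assumes "\<And>x y. (\<And>i. i < n \<Longrightarrow> x i = y i) \<Longrightarrow> h x = h y"
  shows "even_fun (batch unit_vec h)"
proof -
  have cong: "fold sym_fun us h x = fold sym_fun us h y" if "\<And>i. i < n \<Longrightarrow> x i = y i" for us x y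
    using assms that
  proof (induction us arbitrary: h x y)
    case Nil
    show ?case unfolding fold.simps id_apply by (rule Nil.prems(1)[OF Nil.prems(2)])
  next
    case (Cons u us)
    have "sym_fun u h x = sym_fun u h y" if xy: "\<And>i. i < n \<Longrightarrow> x i = y i" for x y
    proof -
      have "dot n x u = dot n y u" using xy by (simp add: dot_def)
      then have "h (reflection n u x) = h (reflection n u y)" using xy by (intro Cons.prems(1)) (simp add: reflection_def)
      then show ?thesis using Cons.prems(1)[OF xy] by (simp add: sym_fun_def)
    qed
    from Cons.IH[of "sym_fun u h", OF this Cons.prems(2)] show ?case by simp
  qed
  have "batch unit_vec h (\<lambda>i. - x i) = batch unit_vec h (flip_coords {..<n} x)" for x
    unfolding batch_def by (rule cong) (simp add: flip_coords_def)
  then show ?thesis unfolding even_fun_def batch_def by (simp add: fold_unit_vec_flip)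
qed

lemma support_fun_cong: "(\<And>i. i < n \<Longrightarrow> x i = y i) \<Longrightarrow> support_fun n K x = support_fun n K y"
  by (simp add: support_fun_def dot_def)

lemma frame_unit_vec: "frame unit_vec"
  by (simp add: frame_def unit_vec_sphere dot_unit_vec) (simp add: unit_vec_def)

text \<open>An even support function dominates the absolute value of a linear functional whose square has mean
  \<open>R\<^sup>2 / n\<close>.\<close>
lemma radius_le_mean_width:
  assumes K: "regular_body n K" and even: "even_fun (support_fun n K)" and y: "y \<in> K"
    and R: "\<And>x. x \<in> K \<Longrightarrow> enorm n x \<le> enorm n y"
  shows "enorm n y \<le> real n * (\<integral>x. support_fun n K x \<partial>\<sigma>)"
proof -
  let ?h = "support_fun n K" and ?R = "enorm n y"
  have h_ge: "\<bar>dot n y z\<bar> \<le> ?h z" for z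
    using support_fun_ge[OF K y, of z] support_fun_ge[OF K y, of "\<lambda>i. - z i"] even
    by (simp add: even_fun_def dot_uminus_right abs_le_iff)
  show ?thesis
  proof (cases "?R = 0")
    case True
    have "0 \<le> (\<integral>x. ?h x \<partial>\<sigma>)"
      by (rule Bochner_Integration.integral_nonneg) (meson abs_ge_zero h_ge order_trans)
    then show ?thesis using True by simp
  next
    case False
    then have R0: "0 < ?R" using enorm_nonneg[of n y] by simp
    define v where "v = (\<lambda>i. (1 / ?R) * y i)"
    have v: "v \<in> unit_sphere n"
      unfolding v_def using K y R0 by (intro normalize_sphere) (auto simp: regular_body_def)
    have "?R * (1 / real n) = (\<integral>z. ?R * (dot n v z)\<^sup>2 \<partial>\<sigma>)"
      using integral_dot_power[OF v, of 2] by (simp add: coord_moment_2)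
    also have "\<dots> \<le> (\<integral>z. ?h z \<partial>\<sigma>)"
    proof (rule integral_mono)
      show "integrable \<sigma> (\<lambda>z. ?R * (dot n v z)\<^sup>2)"
        using integrable_kernel[OF kernel_power[of 2] bounded_meas_const[of 1] v] by simp
      show "integrable \<sigma> ?h" by (rule integrable_bounded_meas[OF bounded_meas_support_fun[OF K]])
      fix z assume "z \<in> space \<sigma>"
      then have "\<bar>dot n v z\<bar> \<le> 1" using sphere_dot_le[OF v] by (simp add: space_\<sigma>)
      then have "\<bar>dot n v z\<bar> * \<bar>dot n v z\<bar> \<le> \<bar>dot n v z\<bar> * 1" by (intro mult_left_mono) auto
      then have "?R * (dot n v z)\<^sup>2 \<le> ?R * \<bar>dot n v z\<bar>" using R0 by (simp add: power2_eq_square)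
      also have "\<dots> = \<bar>dot n y z\<bar>" unfolding v_def dot_scale_left using R0 by (simp add: abs_mult)
      also have "\<dots> \<le> ?h z" by (rule h_ge)
      finally show "?R * (dot n v z)\<^sup>2 \<le> ?h z" .
    qed
    finally show ?thesis using n_pos by (simp add: field_simps)
  qed
qed

lemma batch_diff_const: "fold batch bs (\<lambda>x. g x - c) = (\<lambda>x. fold batch bs g x - c)"
proof -
  have sym: "fold sym_fun us (\<lambda>x. g x - c) = (\<lambda>x. fold sym_fun us g x - c)" for us g
  proof (induction us arbitrary: g)
    case (Cons u us)
    have "sym_fun u (\<lambda>x. g x - c) = (\<lambda>x. sym_fun u g x - c)"
      by (simp add: sym_fun_def fun_eq_iff field_simps)
    then show ?case using Cons.IH by simp
  qed simp
  show ?thesis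
    by (induction bs arbitrary: g) (simp_all add: batch_def sym)
qed

definition frames_list :: "(nat \<Rightarrow> nat \<Rightarrow> real) list \<Rightarrow> (nat \<Rightarrow> real) list" where
  "frames_list bs = concat (map (\<lambda>b. map b [0..<n]) bs)"

lemma fold_frames_list: "fold sym_fun (frames_list bs) g = fold batch bs g"
  by (induction bs arbitrary: g) (simp_all add: frames_list_def batch_def)

lemma length_frames_list: "length (frames_list bs) = length bs * n"
  by (induction bs) (simp_all add: frames_list_def)

lemma set_frames_list: "\<forall>b\<in>set bs. frame b \<Longrightarrow> set (frames_list bs) \<subseteq> unit_sphere n"
  by (auto simp: frames_list_def frame_def)

text \<open>If the smoothed support function is nearly constant, then so is the support function: first
  its maximum is controlled, and the maximum is the Lipschitz constant.\<close>
lemma near_ball_of_smooth: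
  assumes K: "regular_body n K" and even: "even_fun (support_fun n K)"
    and \<epsilon>: "0 < \<epsilon>" "\<epsilon> < 1 / 2" and M: "0 \<le> M"
    and d: "(real n - 1) / (real n + 2 * real d) \<le> (\<epsilon> / 8)\<^sup>2 / 2"
    and smooth: "\<And>x. x \<in> unit_sphere n \<Longrightarrow> \<bar>smooth d (support_fun n K) x - M\<bar> \<le> \<epsilon> / 8 * M"
  shows "dilate ((1 - \<epsilon>) * M) (unit_ball n) \<subseteq> K" and "K \<subseteq> dilate ((1 + \<epsilon>) * M) (unit_ball n)"
proof -
  let ?h = "support_fun n K"
  obtain y where y: "y \<in> K" and R: "\<And>x. x \<in> K \<Longrightarrow> enorm n x \<le> enorm n y" using regular_body_radius[OF K] by blast
  define \<rho> where "\<rho> = enorm n y"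
  have KR: "K \<subseteq> Rn n" using K by (simp add: regular_body_def)
  have R0: "0 \<le> \<rho>" by (simp add: \<rho>_def enorm_nonneg)
  have close: "\<bar>?h x - M\<bar> \<le> \<epsilon> / 8 * M + \<rho> * (\<epsilon> / 8)" if x: "x \<in> unit_sphere n" for x
  proof -
    have "\<bar>smooth d ?h x - ?h x\<bar> \<le> \<rho> * (\<epsilon> / 8)"
      by (rule smooth_approx[OF bounded_meas_support_fun[OF K]])
         (use support_fun_Lipschitz[OF K R] even R0 \<epsilon> d x in \<open>auto simp: even_fun_def \<rho>_def\<close>)
    moreover have "\<bar>?h x - M\<bar> = \<bar>(smooth d ?h x - M) - (smooth d ?h x - ?h x)\<bar>" by simp
    ultimately show ?thesis
      using smooth[OF x] abs_triangle_ineq4[of "smooth d ?h x - M" "smooth d ?h x - ?h x"] by linarith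
  qed
  have "\<rho> \<le> M + (\<epsilon> / 8 * M + \<rho> * (\<epsilon> / 8))"
  proof (cases "\<rho> = 0")
    case True then show ?thesis using M \<epsilon> by simp
  next
    case False
    then have pos: "0 < \<rho>" using R0 by simp
    define v where "v = (\<lambda>i. (1 / \<rho>) * y i)"
    have v: "v \<in> unit_sphere n"
      unfolding v_def \<rho>_def using y KR pos by (intro normalize_sphere) (auto simp: \<rho>_def)
    have "\<rho> = (1 / \<rho>) * \<rho>\<^sup>2" using pos by (simp add: power2_eq_square)
    also have "\<dots> = dot n y v" unfolding v_def dot_scale_right \<rho>_def enorm_sq ..
    also have "\<dots> \<le> ?h v" by (rule support_fun_ge[OF K y])
    finally show ?thesis using close[OF v] by (simp add: abs_le_iff)
  qed
  then have "\<rho> * (1 - \<epsilon> / 8) \<le> M * (1 + \<epsilon> / 8)" by (simp add: algebra_simps)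
  also have "M * (1 + \<epsilon> / 8) \<le> M * ((1 + \<epsilon> / 2) * (1 - \<epsilon> / 8))"
  proof (rule mult_left_mono[OF _ M])
    have "\<epsilon> * \<epsilon> \<le> \<epsilon> * 1" using \<epsilon> by (intro mult_left_mono) auto
    moreover have "(1 + \<epsilon> / 2) * (1 - \<epsilon> / 8) = 1 + 3 * \<epsilon> / 8 - \<epsilon> * \<epsilon> / 16" by (simp add: field_simps)
    ultimately show "1 + \<epsilon> / 8 \<le> (1 + \<epsilon> / 2) * (1 - \<epsilon> / 8)" using \<epsilon>(1) by linarith
  qed
  finally have "\<rho> * (1 - \<epsilon> / 8) \<le> (M * (1 + \<epsilon> / 2)) * (1 - \<epsilon> / 8)" by (simp add: mult.assoc)
  then have \<rho>: "\<rho> \<le> M * (1 + \<epsilon> / 2)" using \<epsilon> by (simp add: mult_le_cancel_right)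
  have Me: "0 \<le> M * \<epsilon>" using M \<epsilon> by simp
  have "\<rho> * (\<epsilon> / 8) \<le> M * (1 + \<epsilon> / 2) * (\<epsilon> / 8)" using \<rho> \<epsilon> by (intro mult_right_mono) auto
  also have "\<dots> \<le> M * 2 * (\<epsilon> / 8)" using M \<epsilon> by (intro mult_right_mono mult_left_mono) auto
  finally have dev: "\<epsilon> / 8 * M + \<rho> * (\<epsilon> / 8) \<le> \<epsilon> * M" using Me by (simp add: mult.commute)
  show "K \<subseteq> dilate ((1 + \<epsilon>) * M) (unit_ball n)"
  proof
    fix x assume x: "x \<in> K"
    have "enorm n x \<le> (1 + \<epsilon>) * M" using R[OF x] \<rho> Me by (simp add: \<rho>_def algebra_simps)
    show "x \<in> dilate ((1 + \<epsilon>) * M) (unit_ball n)"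
    proof (cases "(1 + \<epsilon>) * M = 0")
      case True
      have "enorm n x = 0" using \<open>enorm n x \<le> (1 + \<epsilon>) * M\<close> enorm_nonneg[of n x] True by (metis order_antisym)
      then have "dot n x x = 0" using enorm_sq[of n x] by simp
      then have "\<forall>i<n. x i = 0" by (simp only: dot_self_0)
      moreover have "x i = 0" if "i \<ge> n" for i using x KR that by (auto simp: Rn_iff)
      ultimately have "x i = 0" for i by (cases "i < n") auto
      then have "x = (\<lambda>i. (1 + \<epsilon>) * M * 0)" by (simp add: fun_eq_iff)
      moreover have "(\<lambda>_. 0) \<in> unit_ball n" by (simp add: unit_ball_def Rn_iff enorm_def dot_def)
      ultimately show ?thesis unfolding dilate_def by (intro image_eqI[of _ _ "\<lambda>_. 0"]) auto
    next
      case False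
      define r where "r = (1 + \<epsilon>) * M"
      have r: "0 < r" using False M \<epsilon> by (simp add: r_def)
      have "(enorm n (\<lambda>i. (1 / r) * x i))\<^sup>2 = (1 / r) * ((1 / r) * (enorm n x)\<^sup>2)"
        unfolding enorm_sq dot_scale_left dot_scale_right ..
      also have "\<dots> = (enorm n x / r)\<^sup>2" by (simp add: power2_eq_square)
      also have "\<dots> \<le> 1" using \<open>enorm n x \<le> (1 + \<epsilon>) * M\<close> r enorm_nonneg[of n x]
        by (intro power_le_one) (auto simp: r_def)
      finally have "enorm n (\<lambda>i. (1 / r) * x i) \<le> 1" by (simp add: abs_square_le_1 abs_le_iff)
      then have z: "(\<lambda>i. (1 / r) * x i) \<in> unit_ball n" using x KR by (auto simp: unit_ball_def Rn_iff)
      have xz: "x = (\<lambda>i. r * ((1 / r) * x i))" using r by simp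
      show ?thesis unfolding dilate_def r_def[symmetric]
        by (rule image_eqI[where x = "\<lambda>i. (1 / r) * x i"], fact xz, fact z)
    qed
  qed
  show "dilate ((1 - \<epsilon>) * M) (unit_ball n) \<subseteq> K"
  proof
    fix x assume "x \<in> dilate ((1 - \<epsilon>) * M) (unit_ball n)"
    then obtain z where z: "z \<in> unit_ball n" "x = (\<lambda>i. (1 - \<epsilon>) * M * z i)" by (auto simp: dilate_def)
    have zR: "z \<in> Rn n" "enorm n z \<le> 1" using z by (simp_all add: unit_ball_def)
    have c: "0 \<le> (1 - \<epsilon>) * M" using M \<epsilon> by simp
    show "x \<in> K"
    proof (rule regular_body_memI[OF K])
      show "x \<in> Rn n" using zR by (simp add: z Rn_iff)
      fix u assume u: "u \<in> unit_sphere n"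
      have "dot n z u \<le> enorm n z * enorm n u" using dot_Cauchy_Schwarz[of n z u] by simp
      then have "dot n z u \<le> 1" using zR u by (simp add: unit_sphere_def)
      then have "(1 - \<epsilon>) * M * dot n z u \<le> (1 - \<epsilon>) * M * 1" using c by (rule mult_left_mono)
      then have "dot n x u \<le> (1 - \<epsilon>) * M" unfolding z(2) dot_scale_left by simp
      also have "\<dots> = M - \<epsilon> * M" by (simp add: algebra_simps)
      also have "\<dots> \<le> ?h u" using close[OF u] dev by (simp add: abs_le_iff)
      finally show "dot n x u \<le> ?h u" .
    qed
  qed
qed

end

section \<open>Numerical estimates and conclusion\<close>

lemma half_powers_sum_le: "(\<Sum>k=1..N. (1 / 2 :: real) ^ k) \<le> 1"
proof -
  have "(\<Sum>k=1..N. (1 / 2 :: real) ^ k) = 1 - (1 / 2) ^ N" by (induction N) auto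
  then show ?thesis by simp
qed

lemma ninetenths_power_le: "(9 / 10 :: real) ^ p \<le> exp (- real p / 10)"
proof -
  have "(9 / 10 :: real) \<le> exp (- 1 / 10)" using exp_ge_add_one_self[of "- 1 / 10 :: real"] by simp
  then have "(9 / 10 :: real) ^ p \<le> exp (- 1 / 10) ^ p" by (intro power_mono) auto
  also have "\<dots> = exp (- real p / 10)" by (simp flip: exp_of_nat_mult)
  finally show ?thesis .
qed

lemma exp_ge_two_power: "2 ^ p \<le> exp (real p)"
proof -
  have "(2 :: real) ^ p \<le> exp 1 ^ p" using exp_ge_add_one_self[of "1 :: real"] by (intro power_mono) auto
  then show ?thesis by (simp flip: exp_of_nat_mult)
qed

text \<open>A single term of the binomial expansion of \<open>1\<close>.\<close>
lemma binomial_mult_powers_le: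
  fixes x :: real
  assumes "0 \<le> x" "x \<le> 1" shows "real ((q + d) choose d) * (x ^ q * (1 - x) ^ d) \<le> 1"
proof -
  have "(\<Sum>k\<le>q + d. real ((q + d) choose k) * (1 - x) ^ k * x ^ (q + d - k)) = ((1 - x) + x) ^ (q + d)"
    by (rule binomial_ring[symmetric])
  moreover have "real ((q + d) choose d) * (1 - x) ^ d * x ^ (q + d - d)
      \<le> (\<Sum>k\<le>q + d. real ((q + d) choose k) * (1 - x) ^ k * x ^ (q + d - k))"
    using assms by (intro member_le_sum) auto
  ultimately show ?thesis by (simp add: mult_ac)
qed

lemma exp_le_one_minus:
  fixes x :: real
  assumes "0 \<le> x" "x \<le> 1 / 2" shows "exp (- 2 * x) \<le> 1 - x"
proof -
  have "x * x \<le> x * (1 / 2)" using assms by (intro mult_left_mono) auto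
  then have "- 2 * x \<le> ln (1 - x)"
    using ln_one_minus_pos_lower_bound[of x] assms by (simp add: power2_eq_square)
  then show ?thesis using assms by (subst (asm) ln_ge_iff) auto
qed

context sphere_measure
begin

lemma sgn_moment_le_inv_dim: "1 \<le> j \<Longrightarrow> sgn_moment (2 * j) \<le> 3 / real n"
proof (induction j rule: dec_induct)
  case base
  have "(real n + 2) * sgn_moment 2 \<le> 3" using sgn_moment_Suc[of 0] by (simp add: sgn_moment_0 numeral_2_eq_2)
  moreover have "0 \<le> sgn_moment 2" using sgn_moment_nonneg[of 1] by simp
  ultimately have "real n * sgn_moment 2 \<le> 3" by (simp add: algebra_simps)
  then show ?case using n2 by (simp add: field_simps numeral_2_eq_2)
next
  case (step j)
  then show ?case using sgn_moment_decreasing[of j] by simp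
qed

lemma sgn_moment_antimono: "i \<le> j \<Longrightarrow> sgn_moment (2 * j) \<le> sgn_moment (2 * i)"
proof (induction j rule: dec_induct)
  case (step j)
  then show ?case using sgn_moment_decreasing[of j] by simp
qed simp

text \<open>For \<open>i < (n + 3) div 4\<close> the ratio \<open>3 * (2 * i + 1) / (n + 4 * i + 2)\<close> in the recursion is at most
  \<open>9 / 10\<close>.\<close>
lemma sgn_moment_geometric: "j \<le> (n + 3) div 4 \<Longrightarrow> sgn_moment (2 * j) \<le> (9 / 10) ^ j"
proof (induction j)
  case 0 then show ?case by (simp add: sgn_moment_0)
next
  case (Suc j)
  let ?D = "real n + 4 * real j + 2"
  have "4 * j + 1 \<le> n" using Suc.prems by simp
  then have "8 * j + 4 \<le> 3 * n" using n2 by (cases j) auto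
  then have "8 * real j + 4 \<le> 3 * real n" by linarith
  then have r: "3 * (2 * real j + 1) \<le> ?D * (9 / 10)" by simp
  have "?D * sgn_moment (2 * j + 2) \<le> 3 * (2 * real j + 1) * sgn_moment (2 * j)" by (rule sgn_moment_Suc)
  also have "\<dots> \<le> (?D * (9 / 10)) * (9 / 10) ^ j"
    using Suc sgn_moment_nonneg[of j] by (intro mult_mono r) auto
  finally have "?D * sgn_moment (2 * j + 2) \<le> ?D * (9 / 10) ^ Suc j" by (simp only: power_Suc mult.assoc)
  then show ?case by (simp add: mult_le_cancel_left_pos)
qed

text \<open>Compared with the recursion of \<open>coord_moment\<close>, the squared ratio of consecutive values exceeds the
  product of two ratios of moments by at most the factor \<open>3\<close>. The kernels of low degree have size
  \<open>1 / tau\<close>, a reciprocal moment up to an exponential factor, so that the contraction by two batches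
  compensates for it up to such a factor.\<close>
lemma sgn_moment_sq_le: "(sgn_moment (2 * j))\<^sup>2 \<le> 3 ^ j * coord_moment (4 * j)"
proof (induction j)
  case 0
  then show ?case using coord_moment_even[of 0] by (simp add: sgn_moment_0)
next
  case (Suc j)
  let ?A = "real n + 4 * real j" and ?Z = "coord_moment (4 * j)"
  have A: "0 < ?A" using n2 by simp
  have Z: "0 < ?Z" using coord_moment_pos[of "2 * j"] by simp
  have "coord_moment (4 * j + 2) * ?A = (4 * real j + 1) * ?Z"
    using coord_moment_Suc[of "2 * j"] by simp
  moreover have "coord_moment (4 * j + 4) * (?A + 2) = (4 * real j + 3) * coord_moment (4 * j + 2)"
  proof -
    have "2 * (2 * j + 1) + 2 = 4 * j + 4" "2 * (2 * j + 1) = 4 * j + 2" by simp_all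
    then have "coord_moment (4 * j + 4) * (real n + 2 * real (2 * j + 1)) = (2 * real (2 * j + 1) + 1) * coord_moment (4 * j + 2)"
      using coord_moment_Suc[of "2 * j + 1"] by metis
    moreover have "real n + 2 * real (2 * j + 1) = ?A + 2" "2 * real (2 * j + 1) + 1 = 4 * real j + 3" by simp_all
    ultimately show ?thesis by metis
  qed
  ultimately have Z4: "coord_moment (4 * j + 4) * ((?A + 2) * ?A) = (4 * real j + 3) * (4 * real j + 1) * ?Z"
    by (simp only: mult.assoc[symmetric]) (simp only: mult.assoc)
  have "(?A + 2)\<^sup>2 * (sgn_moment (2 * j + 2))\<^sup>2 = ((?A + 2) * sgn_moment (2 * j + 2))\<^sup>2"
    by (rule power_mult_distrib[symmetric])
  also have "\<dots> \<le> (3 * (2 * real j + 1) * sgn_moment (2 * j))\<^sup>2"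
    using sgn_moment_Suc[of j] sgn_moment_nonneg[of "Suc j"] A by (intro power_mono) auto
  also have "\<dots> = (3 * (2 * real j + 1))\<^sup>2 * (sgn_moment (2 * j))\<^sup>2" by (rule power_mult_distrib)
  also have "\<dots> \<le> (3 * (2 * real j + 1))\<^sup>2 * (3 ^ j * ?Z)" by (rule mult_left_mono[OF Suc.IH]) simp
  also have "\<dots> \<le> (3 * ((4 * real j + 3) * (4 * real j + 1))) * (3 ^ j * ?Z)"
    using Z by (intro mult_right_mono) (auto simp: power2_eq_square algebra_simps)
  also have "\<dots> = 3 ^ Suc j * ((4 * real j + 3) * (4 * real j + 1) * ?Z)" by (simp only: power_Suc mult_ac)
  also have "\<dots> = 3 ^ Suc j * (coord_moment (4 * j + 4) * ((?A + 2) * ?A))" unfolding Z4 ..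
  also have "\<dots> \<le> 3 ^ Suc j * (coord_moment (4 * j + 4) * ((?A + 2) * (?A + 2)))"
  proof -
    have "2 * (2 * j + 2) = 4 * j + 4" by simp
    then have "0 < coord_moment (4 * j + 4)" using coord_moment_pos[of "2 * j + 2"] by metis
    then show ?thesis using A by (intro mult_left_mono) auto
  qed
  finally have "(?A + 2)\<^sup>2 * (sgn_moment (2 * j + 2))\<^sup>2 \<le> (?A + 2)\<^sup>2 * (3 ^ Suc j * coord_moment (4 * j + 4))"
    by (simp only: power2_eq_square mult_ac)
  then have "(sgn_moment (2 * j + 2))\<^sup>2 \<le> 3 ^ Suc j * coord_moment (4 * j + 4)"
    using A by (subst (asm) mult_le_cancel_left_pos) auto
  moreover have "2 * Suc j = 2 * j + 2" "4 * Suc j = 4 * j + 4" by simp_all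
  ultimately show ?case by metis
qed

text \<open>The product formula for the moment is compared factor by factor with that of the binomial
  coefficient.\<close>
lemma inverse_coord_moment_le:
  assumes "n \<le> 2 * q"
  shows "1 / coord_moment (2 * Suc d) \<le> 2 * real q * real ((q + d) choose d)"
proof (induction d)
  case 0
  have "1 / coord_moment 2 = real n" using coord_moment_even[of 1] by simp
  then show ?case using assms by simp
next
  case (Suc d)
  let ?B = "real n + 2 * real (Suc d)" and ?Z = "coord_moment (2 * Suc d)"
  have Z: "0 < ?Z" by (rule coord_moment_pos)
  have rec: "coord_moment (2 * Suc (Suc d)) = (2 * real (Suc d) + 1) * ?Z / ?B"
    using coord_moment_Suc[of "Suc d"] n2 by (simp add: field_simps)
  have "1 / coord_moment (2 * Suc (Suc d)) = ?B / (2 * real (Suc d) + 1) * (1 / ?Z)" unfolding rec by simp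
  also have "\<dots> \<le> real (Suc (q + d)) / real (Suc d) * (2 * real q * real ((q + d) choose d))"
  proof (rule mult_mono[OF _ Suc.IH])
    have "?B / (2 * real (Suc d) + 1) \<le> (2 * real (Suc (q + d))) / (2 * real (Suc d))"
      using assms by (intro frac_le) auto
    also have "\<dots> = real (Suc (q + d)) / real (Suc d)" by (rule mult_divide_mult_cancel_left) simp
    finally show "?B / (2 * real (Suc d) + 1) \<le> real (Suc (q + d)) / real (Suc d)" .
  qed (use Z in auto)
  also have "real (Suc (q + d)) * real ((q + d) choose d) = real (Suc d) * real (Suc (q + d) choose Suc d)"
    using Suc_times_binomial[of d "q + d"] by (metis of_nat_mult)
  then have "real (Suc (q + d)) / real (Suc d) * (2 * real q * real ((q + d) choose d))
      = 2 * real q * real ((q + Suc d) choose Suc d)" by (simp add: field_simps)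
  finally show ?case .
qed

text \<open>In low degrees the weight is the size of the kernel with a geometric margin, so that the sum over the
  degrees converges; in high degrees the cruder size of the whole smoothing kernel suffices.\<close>
definition weight :: "nat \<Rightarrow> nat \<Rightarrow> nat \<Rightarrow> real" where
  "weight q d k = (if k \<le> q then 2 ^ k / tau k else 1 / coord_moment (2 * d))"

lemma weight_pos: "0 < weight q d k"
  using tau_pos[of k] coord_moment_pos[of d] by (simp add: weight_def)

lemma weight_sum_le: "(\<Sum>k=1..2*d. power_coeff (2 * d) k * poly (orth k) 1 / coord_moment (2 * d) / weight q d k) \<le> 2"
proof -
  let ?p = "\<lambda>k. power_coeff (2 * d) k * poly (orth k) 1" and ?Z = "coord_moment (2 * d)"
  have Z: "0 < ?Z" by (rule coord_moment_pos)
  have p: "0 \<le> ?p k" for k using power_coeff_nonneg[of "2 * d" k] orth_1_pos[of k] by simp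
  have "?p k / ?Z / weight q d k \<le> (1 / 2) ^ k + ?p k" for k
  proof (cases "k \<le> q")
    case True
    have "?p k / ?Z / weight q d k = ?p k / ?Z * (tau k / 2 ^ k)" using True by (simp add: weight_def)
    also have "\<dots> \<le> 1 / tau k * (tau k / 2 ^ k)"
      using tau_pos[of k] by (intro mult_right_mono power_coeff_le) auto
    also have "\<dots> = (1 / 2) ^ k" using tau_pos[of k] by (simp add: power_one_over)
    finally show ?thesis using p[of k] by linarith
  next
    case False
    then have "?p k / ?Z / weight q d k = ?p k" using Z by (simp add: weight_def)
    then show ?thesis by simp
  qed
  then have "(\<Sum>k=1..2*d. ?p k / ?Z / weight q d k) \<le> (\<Sum>k=1..2*d. (1 / 2) ^ k + ?p k)" by (intro sum_mono)
  also have "\<dots> = (\<Sum>k=1..2*d. (1 / 2) ^ k) + (\<Sum>k=1..2*d. ?p k)" by (rule sum.distrib)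
  also have "(\<Sum>k=1..2*d. ?p k) \<le> (\<Sum>k<Suc (2 * d). ?p k)" using p by (intro sum_mono2) auto
  finally show ?thesis using half_powers_sum_le[of "2 * d"] power_coeff_sum[of "2 * d"] by linarith
qed

text \<open>Of the \<open>m\<close> factors, two pay for the weight, two yield \<open>1 / n\<^sup>2\<close>, and the geometric decay of the others
  in \<open>j\<close> beats the remaining exponential factor \<open>48 ^ j\<close>.\<close>
lemma low_degree_contraction:
  assumes j: "1 \<le> j" "j \<le> (n + 3) div 4" and m: "4 \<le> m" "48 * (9 / 10) ^ (m - 4) \<le> (1 :: real)"
  shows "2 ^ (2 * j) / tau (2 * j) * sgn_moment (2 * j) ^ m \<le> 9 / (real n)\<^sup>2 * (48 * (9 / 10) ^ (m - 4))"
proof -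
  let ?s = "sgn_moment (2 * j)"
  have s0: "0 \<le> ?s" by (rule sgn_moment_nonneg)
  have Z: "0 < coord_moment (4 * j)" using coord_moment_pos[of "2 * j"] by simp
  have tau: "coord_moment (4 * j) \<le> 4 ^ j * tau (2 * j)"
  proof -
    have "coord_moment (4 * j) \<le> tau (2 * j) * 2 ^ (2 * j)" using tau_ge[of "2 * j"] by (simp add: divide_le_eq)
    moreover have "(2 :: real) ^ (2 * j) = 4 ^ j" by (simp add: power_mult)
    ultimately show ?thesis by (metis mult.commute)
  qed
  have sq: "2 ^ (2 * j) / tau (2 * j) * ?s\<^sup>2 \<le> 48 ^ j"
  proof -
    have "4 ^ j * ?s\<^sup>2 \<le> 4 ^ j * (3 ^ j * coord_moment (4 * j))" by (intro mult_left_mono sgn_moment_sq_le) simp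
    also have "\<dots> \<le> 4 ^ j * (3 ^ j * (4 ^ j * tau (2 * j)))" by (intro mult_left_mono tau) auto
    also have "\<dots> = (4 * 3 * 4) ^ j * tau (2 * j)" unfolding power_mult_distrib by (simp only: mult_ac)
    finally show ?thesis using tau_pos[of "2 * j"] by (simp add: power_mult divide_le_eq)
  qed
  have "m = 2 + (2 + (m - 4))" using m by simp
  then have "?s ^ m = ?s\<^sup>2 * (?s\<^sup>2 * ?s ^ (m - 4))" by (metis power_add)
  then have "2 ^ (2 * j) / tau (2 * j) * ?s ^ m = (2 ^ (2 * j) / tau (2 * j) * ?s\<^sup>2) * (?s\<^sup>2 * ?s ^ (m - 4))"
    by (simp only: mult.assoc)
  also have "\<dots> \<le> 48 ^ j * ((3 / real n)\<^sup>2 * ((9 / 10) ^ j) ^ (m - 4))"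
    using s0 j by (intro mult_mono sq power_mono sgn_moment_le_inv_dim sgn_moment_geometric) auto
  also have "\<dots> = (3 / real n)\<^sup>2 * (48 * (9 / 10) ^ (m - 4)) ^ j"
    unfolding power_mult_distrib power_mult[symmetric] by (simp only: mult_ac)
  also have "\<dots> \<le> (3 / real n)\<^sup>2 * (48 * (9 / 10) ^ (m - 4)) ^ 1"
    using m j by (intro mult_left_mono power_decreasing) auto
  finally show ?thesis by (simp add: power_divide)
qed

lemma high_degree_contraction:
  assumes j: "(n + 3) div 4 \<le> j" and m: "2 \<le> m"
  shows "sgn_moment (2 * j) ^ m \<le> 9 / (real n)\<^sup>2 * (9 / 10) ^ ((n + 3) div 4 * (m - 2))"
proof -
  let ?s = "sgn_moment (2 * j)" and ?J = "(n + 3) div 4"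
  have s0: "0 \<le> ?s" by (rule sgn_moment_nonneg)
  have "1 \<le> j" using j n2 by simp
  have "?s \<le> (9 / 10) ^ ?J" using sgn_moment_antimono[OF j] sgn_moment_geometric[of ?J] by simp
  have "m = 2 + (m - 2)" using m by simp
  then have "?s ^ m = ?s\<^sup>2 * ?s ^ (m - 2)" by (metis power_add)
  also have "\<dots> \<le> (3 / real n)\<^sup>2 * ((9 / 10) ^ ?J) ^ (m - 2)"
    using s0 \<open>1 \<le> j\<close> \<open>?s \<le> (9 / 10) ^ ?J\<close> by (intro mult_mono power_mono sgn_moment_le_inv_dim) auto
  finally show ?thesis by (simp add: power_divide power_mult)
qed

text \<open>The binomial coefficient is bounded by \<open>binomial_mult_powers_le\<close> with \<open>x = \<epsilon>\<^sup>2\<close>. This choice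
  balances the two powers: as \<open>d * \<epsilon>\<^sup>2\<close> is of order \<open>n\<close>, \<open>(1 - x) ^ d\<close> is not smaller than an exponential
  in \<open>n\<close>.\<close>
lemma inverse_coord_moment_le_exp:
  assumes \<epsilon>: "0 < \<epsilon>" "\<epsilon> < 1 / 2" and J: "n \<le> 4 * J" and d: "real d * \<epsilon>\<^sup>2 \<le> 64 * real n"
  shows "1 / coord_moment (2 * Suc d) \<le> 4 * real J * exp (real J * (4 * ln (1 / \<epsilon>) + 512))"
proof -
  let ?B = "real ((2 * J + d) choose d)"
  have x: "0 \<le> \<epsilon>\<^sup>2" "\<epsilon>\<^sup>2 \<le> 1 / 2" "\<epsilon>\<^sup>2 \<le> 1"
    using power_mono[of \<epsilon> "1 / 2" 2] \<epsilon> by (simp_all add: power2_eq_square)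
  have eq: "(\<epsilon>\<^sup>2) ^ (2 * J) = exp (- (4 * real J * ln (1 / \<epsilon>)))"
  proof -
    have "\<epsilon> ^ (4 * J) = exp (ln \<epsilon>) ^ (4 * J)" using \<epsilon> by simp
    also have "\<dots> = exp (real (4 * J) * ln \<epsilon>)" by (rule exp_of_nat_mult[symmetric])
    finally show ?thesis using \<epsilon> by (simp add: ln_div flip: power_mult)
  qed
  have "- (512 * real J) \<le> real d * (- 2 * \<epsilon>\<^sup>2)" using d J by simp
  then have "exp (- (512 * real J)) \<le> exp (real d * (- 2 * \<epsilon>\<^sup>2))" by simp
  also have "\<dots> = exp (- 2 * \<epsilon>\<^sup>2) ^ d" by (rule exp_of_nat_mult)
  also have "\<dots> \<le> (1 - \<epsilon>\<^sup>2) ^ d" by (intro power_mono exp_le_one_minus x) simp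
  finally have "?B * (exp (- (4 * real J * ln (1 / \<epsilon>))) * exp (- (512 * real J))) \<le> ?B * ((\<epsilon>\<^sup>2) ^ (2 * J) * (1 - \<epsilon>\<^sup>2) ^ d)"
    unfolding eq by (intro mult_left_mono) auto
  also have "\<dots> \<le> 1" by (rule binomial_mult_powers_le[OF x(1,3)])
  finally have "?B * exp (- (real J * (4 * ln (1 / \<epsilon>) + 512))) \<le> 1"
    by (simp add: algebra_simps flip: exp_add)
  then have B: "?B \<le> exp (real J * (4 * ln (1 / \<epsilon>) + 512))"
    by (simp add: exp_minus divide_inverse[symmetric] divide_le_eq)
  have "1 / coord_moment (2 * Suc d) \<le> 2 * real (2 * J) * ?B" using J by (intro inverse_coord_moment_le) simp
  also have "\<dots> \<le> 2 * real (2 * J) * exp (real J * (4 * ln (1 / \<epsilon>) + 512))" by (rule mult_left_mono[OF B]) simp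
  finally show ?thesis by simp
qed

text \<open>Both regimes need a number \<open>m\<close> of batches proportional to \<open>ln (1 / \<epsilon>)\<close> only: in high degrees a
  batch contracts by a factor exponentially small in \<open>n\<close>, which matches the exponential size of the
  weight. The factor \<open>1 / n\<^sup>2\<close> compensates for the bound of the radius by \<open>n\<close> times the mean width.\<close>
lemma weight_contraction_le:
  assumes \<epsilon>: "0 < \<epsilon>" "\<epsilon> < 1 / 2" and m: "60 * ln (1 / \<epsilon>) + 6000 \<le> real m" and d: "real d * \<epsilon>\<^sup>2 \<le> 64 * real n"
    and k: "1 \<le> k"
  shows "weight (2 * ((n + 3) div 4)) (Suc d) k * contraction k ^ m \<le> \<epsilon>\<^sup>2 / (128 * (real n)\<^sup>2)"
proof -
  define J L where "J = (n + 3) div 4" and "L = ln (1 / \<epsilon>)"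
  have L: "0 < L" using \<epsilon> by (simp add: L_def)
  have m6: "6000 \<le> real m" using m L by (simp add: L_def)
  have J: "1 \<le> J" "n \<le> 4 * J" using n2 by (simp_all add: J_def)
  have eps: "\<epsilon>\<^sup>2 = exp (- 2 * L)"
  proof -
    have "\<epsilon>\<^sup>2 = exp (ln \<epsilon>) ^ 2" using \<epsilon> by simp
    also have "\<dots> = exp (real 2 * ln \<epsilon>)" by (rule exp_of_nat_mult[symmetric])
    finally show ?thesis using \<epsilon> by (simp add: L_def ln_div)
  qed
  have big: "55296 \<le> exp (16 :: real)" using exp_ge_two_power[of 16] by simp
  show ?thesis
  proof (cases "even k")
    case False
    then have "contraction k ^ m = 0" using m6 by (simp add: contraction_odd power_0_left)
    then show ?thesis by (simp only: mult_zero_right) simp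
  next
    case True
    then obtain j where j: "k = 2 * j" by blast
    have j1: "1 \<le> j" using k j by simp
    have "weight (2 * J) (Suc d) k * contraction k ^ m \<le> weight (2 * J) (Suc d) k * sgn_moment k ^ m"
      using weight_pos[of "2 * J" "Suc d" k] True
      by (intro mult_left_mono power_mono contraction_even contraction_even_nonneg) auto
    also have "\<dots> \<le> \<epsilon>\<^sup>2 / (128 * (real n)\<^sup>2)"
    proof (cases "j \<le> J")
      case True
      have "48 * 9 * 128 * (9 / 10) ^ (m - 4) \<le> 55296 * exp (- real (m - 4) / 10)"
        using ninetenths_power_le[of "m - 4"] by simp
      also have "\<dots> \<le> exp 16 * exp (- 16 - 2 * L)"
        using m L m6 by (intro mult_mono big) (auto simp: L_def of_nat_diff)
      also have "\<dots> = \<epsilon>\<^sup>2" by (simp add: eps flip: exp_add)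
      finally have small: "48 * 9 * 128 * (9 / 10) ^ (m - 4) \<le> \<epsilon>\<^sup>2" .
      moreover have "\<epsilon>\<^sup>2 \<le> 1" using \<epsilon> by (intro power_le_one) auto
      ultimately have le1: "48 * (9 / 10) ^ (m - 4) \<le> (1 :: real)" by linarith
      have "weight (2 * J) (Suc d) k * sgn_moment k ^ m = 2 ^ (2 * j) / tau (2 * j) * sgn_moment (2 * j) ^ m"
        using True by (simp add: weight_def j)
      also have "\<dots> \<le> 9 / (real n)\<^sup>2 * (48 * (9 / 10) ^ (m - 4))"
        using m6 True by (intro low_degree_contraction le1 j1) (auto simp: J_def)
      also have "\<dots> = (48 * 9 * 128 * (9 / 10) ^ (m - 4)) / (128 * (real n)\<^sup>2)" by simp
      also have "\<dots> \<le> \<epsilon>\<^sup>2 / (128 * (real n)\<^sup>2)" by (rule divide_right_mono[OF small]) simp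
      finally show ?thesis .
    next
      case False
      define E where "E = (9 / 10 :: real) ^ (J * (m - 2))"
      have "E \<le> exp (- real (J * (m - 2)) / 10)" unfolding E_def by (rule ninetenths_power_le)
      also have "\<dots> \<le> exp (real J * (- 6 * L - 599))"
      proof -
        have "- real (m - 2) / 10 \<le> - 6 * L - 599" using m m6 by (simp add: L_def of_nat_diff)
        then have "real J * (- real (m - 2) / 10) \<le> real J * (- 6 * L - 599)" by (rule mult_left_mono) simp
        then show ?thesis by simp
      qed
      finally have E: "E \<le> exp (real J * (- 6 * L - 599))" .
      have "1152 * (1 / coord_moment (2 * Suc d) * E)
          \<le> 1152 * (4 * real J * exp (real J * (4 * L + 512)) * exp (real J * (- 6 * L - 599)))"
        using inverse_coord_moment_le_exp[OF \<epsilon> J(2) d] E coord_moment_pos[of "Suc d"]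
        by (intro mult_left_mono mult_mono) (auto simp: L_def E_def)
      also have "\<dots> = 4608 * real J * exp (real J * (4 * L + 512) + real J * (- 6 * L - 599))"
        by (simp add: exp_add)
      also have "real J * (4 * L + 512) + real J * (- 6 * L - 599) = - (real J * (2 * L + 87))"
        by (simp add: algebra_simps)
      also have "4608 * real J * exp (- (real J * (2 * L + 87))) \<le> 4608 * exp (real J) * exp (- real J - 86 - 2 * L)"
      proof (intro mult_mono)
        show "real J \<le> exp (real J)" using exp_ge_add_one_self[of "real J"] by linarith
        have "1 * (2 * L + 86) \<le> real J * (2 * L + 86)" using J L by (intro mult_right_mono) auto
        then show "exp (- (real J * (2 * L + 87))) \<le> exp (- real J - 86 - 2 * L)" by (simp add: algebra_simps)
      qed auto
      also have "\<dots> = 4608 * exp (- 86 - 2 * L)" by (simp flip: exp_add)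
      also have "\<dots> \<le> exp 16 * exp (- 16 - 2 * L)" using big by (intro mult_mono) auto
      also have "\<dots> = \<epsilon>\<^sup>2" by (simp add: eps flip: exp_add)
      finally have small: "1152 * (1 / coord_moment (2 * Suc d) * E) \<le> \<epsilon>\<^sup>2" .
      have "weight (2 * J) (Suc d) k * sgn_moment k ^ m = 1 / coord_moment (2 * Suc d) * sgn_moment (2 * j) ^ m"
        using False by (simp add: weight_def j)
      also have "\<dots> \<le> 1 / coord_moment (2 * Suc d) * (9 / (real n)\<^sup>2 * E)"
        using high_degree_contraction[of j m] False m6 coord_moment_pos[of "Suc d"] 
        by (intro mult_left_mono) (auto simp: J_def E_def)
      also have "\<dots> = 1152 * (1 / coord_moment (2 * Suc d) * E) / (128 * (real n)\<^sup>2)" by simp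
      also have "\<dots> \<le> \<epsilon>\<^sup>2 / (128 * (real n)\<^sup>2)" by (rule divide_right_mono[OF small]) simp
      finally show ?thesis .
    qed
    finally show ?thesis by (simp add: J_def)
  qed
qed

lemma smooth_diff_const:
  assumes g: "bounded_meas g" and x: "x \<in> unit_sphere n"
  shows "smooth d (\<lambda>y. g y - c) x = smooth d g x - c"
proof -
  have "kernel_op (\<lambda>x y. dot n x y ^ (2 * d)) (\<lambda>y. g y - c) x
      = kernel_op (\<lambda>x y. dot n x y ^ (2 * d)) g x - coord_moment (2 * d) * c"
    unfolding kernel_op_def right_diff_distrib
    using integrable_kernel[OF kernel_power g x] integrable_kernel[OF kernel_power bounded_meas_const x]
    by (subst Bochner_Integration.integral_diff) (simp_all add: integral_dot_power[OF x])
  then show ?thesis using coord_moment_pos[of d] by (simp add: smooth_def diff_divide_distrib)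
qed

text \<open>One batch along the coordinate axes makes the support function even, and the batches along the
  chosen frames make its smoothing nearly constant. The degree \<open>2 * Suc d\<close> of the smoothing kernel, of
  order \<open>n / \<epsilon>\<^sup>2\<close>, is what an accuracy of \<open>\<epsilon> / 8\<close> for Lipschitz functions requires.\<close>
lemma symmetrized_near_ball:
  assumes K: "regular_body n K" and \<epsilon>: "0 < \<epsilon>" "\<epsilon> < 1 / 2"
  defines "M \<equiv> \<integral>x. support_fun n K x \<partial>\<sigma>"
  shows "\<exists>us. set us \<subseteq> unit_sphere n \<and> real (length us) \<le> 12064 * real n * ln (1 / \<epsilon>) \<and>
    dilate ((1 - \<epsilon>) * M) (unit_ball n) \<subseteq> fold (minkowski_symmetrization n) us K \<and>
    fold (minkowski_symmetrization n) us K \<subseteq> dilate ((1 + \<epsilon>) * M) (unit_ball n)"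
proof -
  define L where "L = ln (1 / \<epsilon>)"
  define d where "d = nat \<lfloor>64 * real n / \<epsilon>\<^sup>2\<rfloor>"
  define m where "m = nat \<lceil>60 * L + 6000\<rceil>"
  define us0 where "us0 = map unit_vec [0..<n]"
  define K1 where "K1 = fold (minkowski_symmetrization n) us0 K"
  define h where "h = support_fun n K1"
  \<comment> \<open>The number of batches is \<open>60 * L\<close> plus a constant, which a lower bound of
    \<open>L\<close> absorbs.\<close>
  have L: "1 / 2 \<le> L"
  proof -
    have "ln (4 :: real) = ln (2 ^ 2)" by simp
    also have "\<dots> = 2 * ln 2" by (subst ln_realpow) auto
    finally have "ln (4 :: real) = 2 * ln 2" .
    moreover have "1 \<le> ln (4 :: real)" using exp_le by (subst ln_ge_iff) auto
    moreover have "ln 2 \<le> ln (1 / \<epsilon>)" using \<epsilon> by (subst ln_le_cancel_iff) (auto simp: field_simps)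
    ultimately show ?thesis by (simp add: L_def)
  qed
  have us0: "set us0 \<subseteq> unit_sphere n" using frame_unit_vec by (auto simp: us0_def frame_def)
  have K1: "regular_body n K1" and h_eq: "h = fold sym_fun us0 (support_fun n K)"
    using regular_body_fold[OF us0 K] by (simp_all add: K1_def h_def)
  have h_batch: "h = batch unit_vec (support_fun n K)" by (simp add: h_eq us0_def batch_def)
  have h_even: "even_fun h"
    unfolding h_batch by (rule even_fun_coordinate_batch) (rule support_fun_cong)
  have h_meas: "bounded_meas h" unfolding h_def by (rule bounded_meas_support_fun[OF K1])
  have M: "(\<integral>x. h x \<partial>\<sigma>) = M"
    unfolding h_eq M_def by (rule integral_fold_sym_fun[OF us0 bounded_meas_support_fun[OF K]])
  obtain y where y: "y \<in> K1" and R: "\<And>x. x \<in> K1 \<Longrightarrow> enorm n x \<le> enorm n y"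
    using regular_body_radius[OF K1] by blast
  have RM: "enorm n y \<le> real n * M"
    using radius_le_mean_width[OF K1 h_even[unfolded h_def] y R] M by (simp add: h_def)
  have h0: "0 \<le> h x" for x
    using support_fun_ge[OF K1 y, of x] support_fun_ge[OF K1 y, of "\<lambda>i. - x i"] h_even
    by (simp add: even_fun_def dot_uminus_right h_def)
  have hR: "h x \<le> enorm n y" if "x \<in> unit_sphere n" for x
    using support_fun_bound[OF K1 R that] by (simp add: h_def)
  have M0: "0 \<le> M" unfolding M[symmetric] by (intro integral_nonneg_AE AE_I2 h0)
  have MR: "M \<le> enorm n y"
  proof -
    have "(\<integral>x. h x \<partial>\<sigma>) \<le> (\<integral>x. enorm n y \<partial>\<sigma>)"
      using integrable_bounded_meas[OF h_meas] hR by (intro integral_mono) (auto simp: space_\<sigma>)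
    then show ?thesis by (simp add: M prob_space)
  qed
  have f_bound: "\<bar>h x - M\<bar> \<le> enorm n y" if "x \<in> unit_sphere n" for x
    using h0[of x] hR[OF that] M0 MR unfolding abs_le_iff by linarith
  have f_meas: "bounded_meas (\<lambda>x. h x - M)"
    by (rule bounded_measI[OF _ f_bound]) (use bounded_measD[OF h_meas] in measurable)
  have f_mean: "(\<integral>x. h x - M \<partial>\<sigma>) = 0"
    using integrable_bounded_meas[OF h_meas] by (simp add: M prob_space)
  have d_eps: "real d * \<epsilon>\<^sup>2 \<le> 64 * real n"
  proof -
    have "real d \<le> 64 * real n / \<epsilon>\<^sup>2" using \<epsilon> by (simp add: d_def)
    then show ?thesis using \<epsilon> by (simp add: field_simps)
  qed
  have m: "60 * ln (1 / \<epsilon>) + 6000 \<le> real m" "real m \<le> 60 * L + 6001"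
    using L by (auto simp: m_def L_def) linarith+
  obtain bs where bs: "length bs = m" "\<forall>b\<in>set bs. frame b"
    and small: "\<forall>x\<in>unit_sphere n. (smooth (Suc d) (fold batch bs (\<lambda>x. h x - M)) x)\<^sup>2
      \<le> 2 * (\<epsilon>\<^sup>2 / (128 * (real n)\<^sup>2)) * (enorm n y)\<^sup>2"
    using exists_frames_smooth_small[OF f_meas f_mean f_bound _ weight_pos weight_sum_le
        weight_contraction_le[OF \<epsilon> m(1) d_eps]]
    by auto
  define us where "us = us0 @ frames_list bs"
  define K' where "K' = fold (minkowski_symmetrization n) us K"
  have K'_eq: "K' = fold (minkowski_symmetrization n) (frames_list bs) K1" by (simp add: K'_def us_def K1_def)
  have K': "regular_body n K'" and h': "support_fun n K' = fold batch bs h"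
    using regular_body_fold[OF set_frames_list[OF bs(2)] K1] by (simp_all add: K'_eq h_def fold_frames_list)
  have even': "even_fun (support_fun n K')"
    unfolding h' fold_frames_list[symmetric] by (rule even_fun_fold[OF h_even])
  have close: "\<bar>smooth (Suc d) (support_fun n K') x - M\<bar> \<le> \<epsilon> / 8 * M" if x: "x \<in> unit_sphere n" for x
  proof (rule power2_le_imp_le)
    have eq: "fold batch bs (\<lambda>x. h x - M) = (\<lambda>x. support_fun n K' x - M)" unfolding h' by (rule batch_diff_const)
    have "(smooth (Suc d) (support_fun n K') x - M)\<^sup>2 \<le> 2 * (\<epsilon>\<^sup>2 / (128 * (real n)\<^sup>2)) * (enorm n y)\<^sup>2"
      using bspec[OF small x] unfolding eq smooth_diff_const[OF bounded_meas_support_fun[OF K'] x] .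
    also have "\<dots> \<le> 2 * (\<epsilon>\<^sup>2 / (128 * (real n)\<^sup>2)) * (real n * M)\<^sup>2"
      by (intro mult_left_mono power_mono RM enorm_nonneg) auto
    also have "\<dots> = (\<epsilon> / 8 * M)\<^sup>2" using n2 by (simp add: power_mult_distrib power_divide)
    finally show "\<bar>smooth (Suc d) (support_fun n K') x - M\<bar>\<^sup>2 \<le> (\<epsilon> / 8 * M)\<^sup>2" by simp
  qed (use \<epsilon> M0 in simp)
  have width: "(real n - 1) / (real n + 2 * real (Suc d)) \<le> (\<epsilon> / 8)\<^sup>2 / 2"
  proof -
    have "64 * real n / \<epsilon>\<^sup>2 \<le> real (Suc d)" unfolding d_def by linarith
    then have "64 * real n \<le> real (Suc d) * \<epsilon>\<^sup>2" using \<epsilon> by (simp add: field_simps)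
    then have "128 * (real n - 1) \<le> \<epsilon>\<^sup>2 * (2 * real (Suc d))" by (simp add: algebra_simps)
    also have "\<dots> \<le> \<epsilon>\<^sup>2 * (real n + 2 * real (Suc d))" by (intro mult_left_mono) auto
    finally show ?thesis using n2 by (simp add: divide_le_eq power_divide)
  qed
  have "real (length us) = real n * (real m + 1)"
    by (simp add: us_def us0_def length_frames_list bs(1) algebra_simps)
  also have "\<dots> \<le> real n * (12064 * L)" using m L by (intro mult_left_mono) auto
  finally have "real (length us) \<le> 12064 * real n * ln (1 / \<epsilon>)" by (simp add: L_def)
  moreover have "set us \<subseteq> unit_sphere n" using us0 set_frames_list[OF bs(2)] by (simp add: us_def)
  ultimately show ?thesis
    using near_ball_of_smooth[OF K' even' \<epsilon> M0 width close] unfolding K'_def by blast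
qed

end

theorem theorem1p3:
  shows "\<exists>c::real. c > 0 \<and>
    (\<forall>(n::nat) (\<epsilon>::real) (K :: (nat \<Rightarrow> real) set) (\<sigma> :: (nat \<Rightarrow> real) measure).
       n \<ge> 2 \<longrightarrow> 0 < \<epsilon> \<longrightarrow> \<epsilon> < 1/2 \<longrightarrow> convex_body n K \<longrightarrow> rotation_invariant_prob n \<sigma> \<longrightarrow>
       (\<exists>us :: (nat \<Rightarrow> real) list.
          set us \<subseteq> unit_sphere n \<and>
          real (length us) \<le> c * real n * ln (1 / \<epsilon>) \<and>
          dilate ((1 - \<epsilon>) * Mstar n \<sigma> K) (unit_ball n) \<subseteq> fold (minkowski_symmetrization n) us K \<and>
          fold (minkowski_symmetrization n) us K \<subseteq> dilate ((1 + \<epsilon>) * Mstar n \<sigma> K) (unit_ball n)))"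
proof (intro exI[of _ "12064::real"] conjI allI impI)
  fix n :: nat and \<epsilon> :: real and K :: "(nat \<Rightarrow> real) set" and \<sigma> :: "(nat \<Rightarrow> real) measure"
  assume n: "2 \<le> n" and \<epsilon>: "0 < \<epsilon>" "\<epsilon> < 1 / 2" and K: "convex_body n K" and \<sigma>: "rotation_invariant_prob n \<sigma>"
  interpret sphere_measure n \<sigma> using n \<sigma> by unfold_locales
  show "\<exists>us :: (nat \<Rightarrow> real) list.
          set us \<subseteq> unit_sphere n \<and>
          real (length us) \<le> 12064 * real n * ln (1 / \<epsilon>) \<and>
          dilate ((1 - \<epsilon>) * Mstar n \<sigma> K) (unit_ball n) \<subseteq> fold (minkowski_symmetrization n) us K \<and>
          fold (minkowski_symmetrization n) us K \<subseteq> dilate ((1 + \<epsilon>) * Mstar n \<sigma> K) (unit_ball n)"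
    unfolding Mstar_def by (rule symmetrized_near_ball[OF convex_body_regular[OF K] \<epsilon>])
qed simp

end
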